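(* Assume (A1), (A2), (A3), (A4) below. Let $(U_n)_{n\ge1}$ be non-random utility functions with $r_n(x):=-U_n''(x)/U_n'(x)$ satisfying $\lim_{n\to\infty}r_n(x)=+\infty$ for all $x>0$. Let $G\in\mathcal W^{0,+}_T$ be such that it is not the case that $G=0$ $\mathcal Q^T$-q.s. Then $\lim_{n\to\infty}p_n(G,x)=\pi(G)$ for all $x>0$.
   Context: Framework: $T\ge1$; Polish spaces $\Omega_1,\dots,\Omega_T$; $\Omega^t:=\Omega_1\times\cdots\times\Omega_t$ ($\Omega^0$ a singleton). $\mathfrak P(X)$: Borel probability measures on Polish $X$; $\mathcal B_c(X)$: universal $\sigma$-algebra, each $P$ extended to it; universally measurable = $\mathcal B_c$-measurable. $\mathcal SK_t$: universally measurable stochastic kernels on $\Omega_t$ given $\Omega^{t-1}$; $P\otimes p(A):=\int\int1_A(\omega^{t-1},\omega_t)p(d\omega_t,\omega^{t-1})P(d\omega^{t-1})$. Random sets $\mathcal Q_{t+1}:\Omega^t\twoheadrightarrow\mathfrak P(\Omega_{t+1})$ are given; $\mathcal Q^t:=\{Q_1\otimes q_2\otimes\cdots\otimes q_t:Q_1\in\mathcal Q_1,\ q_{s+1}\in\mathcal SK_{s+1},\ q_{s+1}(\cdot,\omega^s)\in\mathcal Q_{s+1}(\omega^s)\ Q_s\text{-a.s.}\}$, $Q_s:=Q_1\otimes\cdots\otimes q_s$. Polar sets, "$\mathcal Q^t$-q.s.", full measure: as usual (contained in a $P$-null universally measurable set for every $P\in\mathcal Q^t$, etc.). $\mathcal W^0_t$: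 universally measurable $X:\Omega^t\to\mathbb R\cup\{\pm\infty\}$; $\mathcal W^{0,+}_t$ nonnegative ones; $\mathcal W^r_t:=\{X\in\mathcal W^0_t:\sup_{P\in\mathcal Q^t}E_P|X|^r<\infty\}$. (A1): each $\mathcal Q_{t+1}$ has nonempty convex values and analytic graph. $S=(S_t)_{0\le t\le T}$ $\mathbb R^d$-valued, $S_t$ universally measurable, $\Delta S_t:=S_t-S_{t-1}$; (A2): each $S_t$ is Borel. $\Phi$: strategies $(\phi_t)_{1\le t\le T}$, $\phi_t:\Omega^{t-1}\to\mathbb R^d$ universally measurable; $V_t^{x,\phi}:=x+\sum_{s\le t}\phi_s\cdot\Delta S_s$. (A3): $V_T^{0,\phi}\ge0$ q.s. implies $V_T^{0,\phi}=0$ q.s. for all $\phi\in\Phi$. $D^{t+1}(\omega^t)$: affine hull of the intersection of all closed $A\subset\mathbb R^d$ with $P(\Delta S_{t+1}(\omega^t,\cdot)\in A)=1$ for all $P\in\mathcal Q_{t+1}(\omega^t)$; fixed $\mathcal Q^t$-full-measure $\Omega^t_{NA}$ and universally measurable $\alpha_t:\Omega^t\to(0,\infty)$ such that for $\omega^t\in\Omega^t_{NA}$, $D^{t+1}(\omega^t)$ is a vector space and every $h\in D^{t+1}(\omega^t)\setminus\{0\}$ admits $P_h\in\mathcal Q_{t+1}(\omega^t)$ with $P_h(\frac h{|h|}\cdot\Delta S_{t+1}(\omega^t,\cdot)<-\alpha_t(\omega^t))>\alpha_t(\omega^t)$. (A4): for all $r\in(0,\infty)$, $\Delta S_t\in\mathcal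 W^r_t$ ($1\le t\le T$) and $1/\alpha_t\in\mathcal W^r_t$ ($1\le t\le T-1$). $\mathcal A(G,x):=\{\phi\in\Phi:V_T^{x,\phi}\ge G\ \mathcal Q^T\text{-q.s.}\}$; $\pi(G):=\inf\{z:\mathcal A(G,z)\ne\emptyset\}$ ($+\infty$ if none). A non-random utility function is $U:(0,\infty)\to\mathbb R$ concave, strictly increasing, $C^2$, extended by right-continuity at $0$ and by $-\infty$ on $(-\infty,0)$. $\mathcal A(U_n,G,x):=\{\phi\in\mathcal A(G,x):E_PU_n^+(V_T^{x,\phi}-G)<\infty\ \forall P\in\mathcal Q^T\}$; $u_n(G,x):=\sup_{\phi\in\mathcal A(U_n,G,x)}\inf_{P\in\mathcal Q^T}E_PU_n(V_T^{x,\phi}-G)$ ($-\infty$ if empty); $p_n(G,x):=\inf\{z\in\mathbb R:u_n(G,x+z)\ge u_n(0,x)\}$ ($+\infty$ if empty). *)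

theory Defs
  imports "HOL-Probability.Probability"
begin

definition Polish_space :: "'a topology \<Rightarrow> bool" where
  "Polish_space X \<longleftrightarrow> completely_metrizable_space X \<and> separable_space X"

definition borel_of :: "'a topology \<Rightarrow> 'a measure" where
  "borel_of X = sigma (topspace X) {U. openin X U}"

text \<open>Omega^t = Omega_1 x ... x Omega_t, realised as extensional functions on {1..t};
  Omega^0 is the singleton.  Concatenation (w^t, w_{t+1}) is w(Suc t := y).\<close>
definition OmT :: "(nat \<Rightarrow> 'a topology) \<Rightarrow> nat \<Rightarrow> (nat \<Rightarrow> 'a) topology" where
  "OmT Om t = product_topology Om {1..t}"

definition OmM :: "(nat \<Rightarrow> 'a topology) \<Rightarrow> nat \<Rightarrow> (nat \<Rightarrow> 'a) measure" where
  "OmM Om t = borel_of (OmT Om t)"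

definition probs :: "'a measure \<Rightarrow> 'a measure set" where
  "probs M = {P. sets P = sets M \<and> prob_space P}"

definition univ_sets :: "'a measure \<Rightarrow> 'a set set" where
  "univ_sets M = {A. A \<subseteq> space M \<and> (\<forall>P\<in>probs M. A \<in> sets (completion P))}"

definition univ_meas :: "'a measure \<Rightarrow> 'b measure \<Rightarrow> ('a \<Rightarrow> 'b) \<Rightarrow> bool" where
  "univ_meas M N f \<longleftrightarrow> f \<in> space M \<rightarrow> space N \<and> (\<forall>B\<in>sets N. f -` B \<inter> space M \<in> univ_sets M)"

definition weak_top :: "'a topology \<Rightarrow> 'a measure topology" where
  "weak_top X = topology_generated_by
     {{P \<in> probs (borel_of X). (\<integral>w. f w \<partial>P) \<in> U} | f U.
        continuous_map X euclideanreal f \<and> bounded (f ` topspace X) \<and> open U}"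

definition baire_space :: "(nat \<Rightarrow> nat) topology" where
  "baire_space = product_topology (\<lambda>_. discrete_topology (UNIV :: nat set)) (UNIV :: nat set)"

definition analytic_in :: "'a topology \<Rightarrow> 'a set \<Rightarrow> bool" where
  "analytic_in X A \<longleftrightarrow> A \<subseteq> topspace X \<and>
     (A = {} \<or> (\<exists>f. continuous_map baire_space X f \<and> f ` topspace baire_space = A))"

definition mix :: "real \<Rightarrow> 'a measure \<Rightarrow> 'a measure \<Rightarrow> 'a measure" where
  "mix c P Q = measure_of (space P) (sets P)
     (\<lambda>A. ennreal c * emeasure P A + ennreal (1 - c) * emeasure Q A)"

definition convex_measures :: "'a measure set \<Rightarrow> bool" where
  "convex_measures K \<longleftrightarrow> (\<forall>P\<in>K. \<forall>Q\<in>K. \<forall>c\<in>{0..1}. mix c P Q \<in> K)"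

definition is_kernel :: "(nat \<Rightarrow> 'a topology) \<Rightarrow> nat \<Rightarrow> ((nat \<Rightarrow> 'a) \<Rightarrow> 'a measure) \<Rightarrow> bool" where
  "is_kernel Om t q \<longleftrightarrow>
     (\<forall>w\<in>space (OmM Om t). q w \<in> probs (borel_of (Om (Suc t)))) \<and>
     (\<forall>B\<in>sets (borel_of (Om (Suc t))). univ_meas (OmM Om t) borel (\<lambda>w. emeasure (q w) B))"

text \<open>P \<otimes> q, with P extended to the universal sigma-algebra (completion).\<close>
definition kprod :: "(nat \<Rightarrow> 'a topology) \<Rightarrow> nat \<Rightarrow> (nat \<Rightarrow> 'a) measure
    \<Rightarrow> ((nat \<Rightarrow> 'a) \<Rightarrow> 'a measure) \<Rightarrow> (nat \<Rightarrow> 'a) measure" where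
  "kprod Om t P q = measure_of (space (OmM Om (Suc t))) (sets (OmM Om (Suc t)))
     (\<lambda>A. \<integral>\<^sup>+ w. (\<integral>\<^sup>+ y. indicator A (w(Suc t := y)) \<partial>(q w)) \<partial>(completion P))"

primrec QQ :: "(nat \<Rightarrow> 'a topology) \<Rightarrow> (nat \<Rightarrow> (nat \<Rightarrow> 'a) \<Rightarrow> 'a measure set)
    \<Rightarrow> nat \<Rightarrow> (nat \<Rightarrow> 'a) measure set" where
  "QQ Om QR 0 = {return (OmM Om 0) (\<lambda>_. undefined)}"
| "QQ Om QR (Suc t) = {kprod Om t P q | P q. P \<in> QQ Om QR t \<and> is_kernel Om t q \<and>
      (AE w in completion P. q w \<in> QR (Suc t) w)}"

definition polar :: "(nat \<Rightarrow> 'a topology) \<Rightarrow> (nat \<Rightarrow> (nat \<Rightarrow> 'a) \<Rightarrow> 'a measure set)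
    \<Rightarrow> nat \<Rightarrow> (nat \<Rightarrow> 'a) set \<Rightarrow> bool" where
  "polar Om QR t N \<longleftrightarrow> (\<forall>P\<in>QQ Om QR t. \<exists>A\<in>univ_sets (OmM Om t).
      N \<subseteq> A \<and> emeasure (completion P) A = 0)"

definition qs :: "(nat \<Rightarrow> 'a topology) \<Rightarrow> (nat \<Rightarrow> (nat \<Rightarrow> 'a) \<Rightarrow> 'a measure set)
    \<Rightarrow> nat \<Rightarrow> ((nat \<Rightarrow> 'a) \<Rightarrow> bool) \<Rightarrow> bool" where
  "qs Om QR t Pr \<longleftrightarrow> polar Om QR t {w \<in> space (OmM Om t). \<not> Pr w}"

definition full_measure :: "(nat \<Rightarrow> 'a topology) \<Rightarrow> (nat \<Rightarrow> (nat \<Rightarrow> 'a) \<Rightarrow> 'a measure set)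
    \<Rightarrow> nat \<Rightarrow> (nat \<Rightarrow> 'a) set \<Rightarrow> bool" where
  "full_measure Om QR t A \<longleftrightarrow> A \<subseteq> space (OmM Om t) \<and> polar Om QR t (space (OmM Om t) - A)"

definition Wr :: "(nat \<Rightarrow> 'a topology) \<Rightarrow> (nat \<Rightarrow> (nat \<Rightarrow> 'a) \<Rightarrow> 'a measure set)
    \<Rightarrow> nat \<Rightarrow> real \<Rightarrow> ((nat \<Rightarrow> 'a) \<Rightarrow> 'b::real_normed_vector) \<Rightarrow> bool" where
  "Wr Om QR t r X \<longleftrightarrow> univ_meas (OmM Om t) borel X \<and>
     (SUP P\<in>QQ Om QR t. \<integral>\<^sup>+ w. ennreal (norm (X w) powr r) \<partial>(completion P)) < \<infinity>"

definition dS :: "(nat \<Rightarrow> (nat \<Rightarrow> 'a) \<Rightarrow> real^'d) \<Rightarrow> nat \<Rightarrow> (nat \<Rightarrow> 'a) \<Rightarrow> real^'d" where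
  "dS S t w = S t w - S (t - 1) (restrict w {1..t - 1})"

definition Dset :: "(nat \<Rightarrow> 'a topology) \<Rightarrow> (nat \<Rightarrow> (nat \<Rightarrow> 'a) \<Rightarrow> 'a measure set)
    \<Rightarrow> (nat \<Rightarrow> (nat \<Rightarrow> 'a) \<Rightarrow> real^'d) \<Rightarrow> nat \<Rightarrow> (nat \<Rightarrow> 'a) \<Rightarrow> (real^'d) set" where
  "Dset Om QR S t w = affine hull (\<Inter>{A. closed A \<and>
     (\<forall>P\<in>QR (Suc t) w. emeasure P {y \<in> topspace (Om (Suc t)). dS S (Suc t) (w(Suc t := y)) \<in> A} = 1)})"

definition Phi :: "(nat \<Rightarrow> 'a topology) \<Rightarrow> nat \<Rightarrow> (nat \<Rightarrow> (nat \<Rightarrow> 'a) \<Rightarrow> real^'d) set" where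
  "Phi Om T = {phi. \<forall>t\<in>{1..T}. univ_meas (OmM Om (t - 1)) borel (phi t)}"

definition V :: "(nat \<Rightarrow> (nat \<Rightarrow> 'a) \<Rightarrow> real^'d) \<Rightarrow> nat \<Rightarrow> real
    \<Rightarrow> (nat \<Rightarrow> (nat \<Rightarrow> 'a) \<Rightarrow> real^'d) \<Rightarrow> (nat \<Rightarrow> 'a) \<Rightarrow> real" where
  "V S T x phi w = x + (\<Sum>t=1..T. phi t (restrict w {1..t - 1}) \<bullet> dS S t (restrict w {1..t}))"

definition Aset :: "(nat \<Rightarrow> 'a topology) \<Rightarrow> (nat \<Rightarrow> (nat \<Rightarrow> 'a) \<Rightarrow> 'a measure set)
    \<Rightarrow> (nat \<Rightarrow> (nat \<Rightarrow> 'a) \<Rightarrow> real^'d) \<Rightarrow> nat \<Rightarrow> ((nat \<Rightarrow> 'a) \<Rightarrow> ereal) \<Rightarrow> real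
    \<Rightarrow> (nat \<Rightarrow> (nat \<Rightarrow> 'a) \<Rightarrow> real^'d) set" where
  "Aset Om QR S T G x = {phi \<in> Phi Om T. qs Om QR T (\<lambda>w. G w \<le> ereal (V S T x phi w))}"

definition superhedging_price :: "(nat \<Rightarrow> 'a topology) \<Rightarrow> (nat \<Rightarrow> (nat \<Rightarrow> 'a) \<Rightarrow> 'a measure set)
    \<Rightarrow> (nat \<Rightarrow> (nat \<Rightarrow> 'a) \<Rightarrow> real^'d) \<Rightarrow> nat \<Rightarrow> ((nat \<Rightarrow> 'a) \<Rightarrow> ereal) \<Rightarrow> ereal" where
  "superhedging_price Om QR S T G = Inf {ereal z | z. Aset Om QR S T G z \<noteq> {}}"

definition utility :: "(real \<Rightarrow> real) \<Rightarrow> bool" where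
  "utility f \<longleftrightarrow> concave_on {0<..} f \<and> strict_mono_on {0<..} f \<and>
     (\<forall>x>0. f differentiable (at x) \<and> deriv f differentiable (at x)) \<and>
     continuous_on {0<..} (deriv (deriv f))"

definition abs_risk :: "(real \<Rightarrow> real) \<Rightarrow> real \<Rightarrow> real" where
  "abs_risk f x = - deriv (deriv f) x / deriv f x"

text \<open>Extension of U: right-continuous at 0, -infinity on the negatives.\<close>
definition UE :: "(real \<Rightarrow> real) \<Rightarrow> ereal \<Rightarrow> ereal" where
  "UE f y = (if y = \<infinity> then \<infinity> else if 0 < y then ereal (f (real_of_ereal y))
     else if y = 0 then (INF z\<in>{0<..}. ereal (f z)) else -\<infinity>)"

definition expE :: "'a measure \<Rightarrow> ('a \<Rightarrow> ereal) \<Rightarrow> ereal" where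
  "expE P X = enn2ereal (\<integral>\<^sup>+ w. e2ennreal (X w) \<partial>P) - enn2ereal (\<integral>\<^sup>+ w. e2ennreal (- X w) \<partial>P)"

definition AUset :: "(nat \<Rightarrow> 'a topology) \<Rightarrow> (nat \<Rightarrow> (nat \<Rightarrow> 'a) \<Rightarrow> 'a measure set)
    \<Rightarrow> (nat \<Rightarrow> (nat \<Rightarrow> 'a) \<Rightarrow> real^'d) \<Rightarrow> nat \<Rightarrow> (real \<Rightarrow> real)
    \<Rightarrow> ((nat \<Rightarrow> 'a) \<Rightarrow> ereal) \<Rightarrow> real \<Rightarrow> (nat \<Rightarrow> (nat \<Rightarrow> 'a) \<Rightarrow> real^'d) set" where
  "AUset Om QR S T f G x = {phi \<in> Aset Om QR S T G x. \<forall>P\<in>QQ Om QR T.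
      (\<integral>\<^sup>+ w. e2ennreal (UE f (ereal (V S T x phi w) - G w)) \<partial>(completion P)) < \<infinity>}"

definition uval :: "(nat \<Rightarrow> 'a topology) \<Rightarrow> (nat \<Rightarrow> (nat \<Rightarrow> 'a) \<Rightarrow> 'a measure set)
    \<Rightarrow> (nat \<Rightarrow> (nat \<Rightarrow> 'a) \<Rightarrow> real^'d) \<Rightarrow> nat \<Rightarrow> (real \<Rightarrow> real)
    \<Rightarrow> ((nat \<Rightarrow> 'a) \<Rightarrow> ereal) \<Rightarrow> real \<Rightarrow> ereal" where
  "uval Om QR S T f G x = (SUP phi\<in>AUset Om QR S T f G x. INF P\<in>QQ Om QR T.
      expE (completion P) (\<lambda>w. UE f (ereal (V S T x phi w) - G w)))"

definition indiff_price :: "(nat \<Rightarrow> 'a topology) \<Rightarrow> (nat \<Rightarrow> (nat \<Rightarrow> 'a) \<Rightarrow> 'a measure set)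
    \<Rightarrow> (nat \<Rightarrow> (nat \<Rightarrow> 'a) \<Rightarrow> real^'d) \<Rightarrow> nat \<Rightarrow> (real \<Rightarrow> real)
    \<Rightarrow> ((nat \<Rightarrow> 'a) \<Rightarrow> ereal) \<Rightarrow> real \<Rightarrow> ereal" where
  "indiff_price Om QR S T f G x = Inf {ereal z | z.
      uval Om QR S T f (\<lambda>_. 0) x \<le> uval Om QR S T f G (x + z)}"

end

theory Submission
  imports Defs
begin

text \<open>
  Adding a superhedge of G to any strategy shows that the indifference price never exceeds the
  superhedging price. Conversely, let c be smaller than the superhedging price. Strategies that are
  nonnegative at the end have wealth dominated by the initial capital times the product of the factors
  1 + |increment| / alpha, which has bounded moments over all models; the set of superhedged claims is
  closed, because strategies can be replaced by pointwise bounded ones and cluster points can be selected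
  measurably. By Borel-Cantelli, this closedness yields a number d such that every strategy superhedging G
  from x + c has, in some model, probability more than a fixed p of ending below x - d after paying G. As the
  risk aversion explodes, the marginal utility at x is negligible compared with the loss
  U(x) - U(x - d), while concavity bounds the gains by the marginal utility at x times the expected
  wealth. So selling G at a price below c becomes worse than doing nothing.

  Passing from conditional to global statements rests on measurable selection: images of Borel subsets of Baire
  space under continuous maps are universally measurable (inner approximation by compact sets) and have
  universally measurable selectors (lexicographically least points of closed fibres).
\<close>

text \<open>The models may be mutually singular, so nothing can be argued up to null sets of one
  reference measure: a limit strategy has to be defined path by path, the same for all models.
  Projecting a strategy onto the span of the conditional support would call for measurable random
  sets; instead the support is known only through the countably many balls that some model charges,
  and a strategy is rounded to a vector of a countable dense set that nearly agrees with it on that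
  support. Rounded strategies are pointwise bounded, so cluster points exist on every path. The
  numbers d and p arise by contradiction. If for every n some strategy from x + c ended below G + x
  - e_n with probability at most (1/2)^n under every model, where e_n tends to 0, then almost surely
  under each model one sequence of strategies would eventually stay above these levels, and
  closedness would superhedge G from c. Failure at some n gives p = (1/2)^n and d = e_n, with d < x
  so that U(x - d) is finite. Both are fixed before the utility varies.\<close>

declare One_nat_def [simp del] \<comment> \<open>otherwise the simplifier turns {1..t} into {Suc 0..t}\<close>

subsection \<open>Universally measurable sets and functions\<close>

text \<open>Only the sigma-algebra counts. Packing it into a measure makes
  \<open>\<rightarrow>\<^sub>M\<close> and the \<open>measurable\<close> method available for
  universal measurability.\<close>

definition universal :: "'a measure \<Rightarrow> 'a measure" where
  "universal M = sigma (space M) (univ_sets M)"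

lemma univ_sets_sigma_algebra: "sigma_algebra (space M) (univ_sets M)"
proof -
  have "sigma_algebra (space M) {A. A \<subseteq> space M \<and> (\<forall>P\<in>probs M. A \<in> sets (completion P))}"
  proof (unfold sigma_algebra_iff2, safe)
    fix A x P assume "A \<subseteq> space M" "\<forall>P\<in>probs M. A \<in> sets (completion P)" "P \<in> probs M"
    moreover from this have "space M = space (completion P)"
      by (auto simp: probs_def dest: sets_eq_imp_space_eq)
    ultimately show "space M - A \<in> sets (completion P)" by auto
  qed (auto intro!: sets.countable_UN)
  then show ?thesis unfolding univ_sets_def .
qed

lemma sets_universal: "sets (universal M) = univ_sets M"
  unfolding universal_def by (rule sigma_algebra.sets_measure_of_eq[OF univ_sets_sigma_algebra])

lemma space_universal [simp]: "space (universal M) = space M"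
  unfolding universal_def by (auto simp: space_measure_of_conv)

lemma univ_meas_iff: "univ_meas M N f \<longleftrightarrow> f \<in> universal M \<rightarrow>\<^sub>M N"
  by (auto simp: univ_meas_def measurable_def sets_universal)

lemma probsD:
  assumes "P \<in> probs M"
  shows "sets P = sets M" "space P = space M" "prob_space P"
  using assms by (auto simp: probs_def dest: sets_eq_imp_space_eq)

lemma sets_universalD: "A \<in> sets (universal M) \<Longrightarrow> P \<in> probs M \<Longrightarrow> A \<in> sets (completion P)"
  by (auto simp: sets_universal univ_sets_def)

lemma sets_universalI:
  "A \<subseteq> space M \<Longrightarrow> (\<And>P. P \<in> probs M \<Longrightarrow> A \<in> sets (completion P)) \<Longrightarrow> A \<in> sets (universal M)"
  by (auto simp: sets_universal univ_sets_def)

lemma sets_imp_sets_universal: "A \<in> sets M \<Longrightarrow> A \<in> sets (universal M)"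
  by (intro sets_universalI) (auto dest: probsD sets.sets_into_space)

lemma measurable_univ_completion:
  assumes "f \<in> universal M \<rightarrow>\<^sub>M N" "P \<in> probs M"
  shows "f \<in> completion P \<rightarrow>\<^sub>M N"
  using assms by (auto simp: measurable_def probsD sets_universalD)

lemma measurable_imp_univ: "f \<in> M \<rightarrow>\<^sub>M N \<Longrightarrow> f \<in> universal M \<rightarrow>\<^sub>M N"
  by (auto simp: measurable_def sets_imp_sets_universal)

text \<open>The image law of any P under f is a probability on N, so A lies between a measurable set
  and its union with a null set of that law; both pull back along f.\<close>

lemma measurable_univ_univ:
  assumes f: "f \<in> M \<rightarrow>\<^sub>M N"
  shows "f \<in> universal M \<rightarrow>\<^sub>M universal N"
proof (rule measurableI)
  show "f x \<in> space (universal N)" if "x \<in> space (universal M)" for x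
    using that f by (auto dest: measurable_space)
  fix A assume A: "A \<in> sets (universal N)"
  show "f -` A \<inter> space (universal M) \<in> sets (universal M)"
  proof (rule sets_universalI)
    fix P assume P: "P \<in> probs M"
    have f': "f \<in> P \<rightarrow>\<^sub>M N" using f probsD(1)[OF P] by (simp cong: measurable_cong_sets)
    have "distr P N f \<in> probs N"
      using f' P by (auto simp: probs_def intro!: prob_space.prob_space_distr)
    then have "A \<in> sets (completion (distr P N f))"
      using A by (rule sets_universalD[rotated])
    then obtain S N' N0 where *: "A = S \<union> N'" "N' \<subseteq> N0" "N0 \<in> null_sets (distr P N f)" "S \<in> sets (distr P N f)"
      by (rule sets_completionE)
    have "f -` N0 \<inter> space P \<in> null_sets P"
      using *(3) f' by (auto simp: null_sets_def emeasure_distr)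
    moreover have "f -` S \<inter> space P \<in> sets P" using *(4) f' by auto
    ultimately have "(f -` S \<inter> space P) \<union> (f -` N' \<inter> space P) \<in> sets (completion P)"
      using *(2) by (intro sets_completionI[OF refl _ _ ]) auto
    also have "(f -` S \<inter> space P) \<union> (f -` N' \<inter> space P) = f -` A \<inter> space (universal M)"
      using * probsD(2)[OF P] by auto
    finally show "f -` A \<inter> space (universal M) \<in> sets (completion P)" .
  qed auto
qed

text \<open>The descent to Borel sets used throughout: a universally measurable exceptional set is
  replaced by a Borel subset plus a null set, because the formulas for products and image laws are
  available for Borel sets.\<close>

lemma univ_inner_approx:
  assumes "A \<in> sets (universal M)" "P \<in> probs M"
  obtains B N where "B \<in> sets M" "B \<subseteq> A" "N \<in> null_sets P" "A - B \<subseteq> N"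
    "emeasure P B = emeasure (completion P) A"
proof -
  have A: "A \<in> sets (completion P)" using assms by (rule sets_universalD)
  then obtain S N' N0 where *: "A = S \<union> N'" "N' \<subseteq> N0" "N0 \<in> null_sets P" "S \<in> sets P"
    by (rule sets_completionE)
  have "emeasure (completion P) A = emeasure (completion P) S"
  proof (rule emeasure_eq_AE)
    show "AE x in completion P. (x \<in> A) = (x \<in> S)"
      using AE_not_in[OF *(3)] *(1,2) by (subst AE_completion_iff) (auto elim!: eventually_mono)
  qed (use A * in auto)
  with * show ?thesis using probsD(1)[OF assms(2)] by (intro that[of S N0]) auto
qed

text \<open>A polar set may be covered by a different universally measurable set for each model, and
  Borel null sets are universally measurable. Hence quasi-sure statements can be handled by the
  calculus of \<open>AE\<close>, one model at a time.\<close>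

lemma qs_iff_AE:
  assumes "QQ Om QR t \<subseteq> probs (OmM Om t)"
  shows "qs Om QR t Pr \<longleftrightarrow> (\<forall>P\<in>QQ Om QR t. AE w in P. Pr w)"
proof -
  have "(\<exists>A\<in>univ_sets (OmM Om t). {w \<in> space (OmM Om t). \<not> Pr w} \<subseteq> A \<and> emeasure (completion P) A = 0)
     \<longleftrightarrow> (AE w in P. Pr w)" if "P \<in> QQ Om QR t" for P
  proof
    have P: "P \<in> probs (OmM Om t)" using that assms by auto
    note P' = probsD[OF P]
    assume "\<exists>A\<in>univ_sets (OmM Om t). {w \<in> space (OmM Om t). \<not> Pr w} \<subseteq> A \<and> emeasure (completion P) A = 0"
    then obtain A where A: "A \<in> univ_sets (OmM Om t)" "{w \<in> space (OmM Om t). \<not> Pr w} \<subseteq> A"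
      "emeasure (completion P) A = 0" by auto
    then have "A \<in> null_sets (completion P)"
      using sets_universalD[OF _ P, of A] by (auto simp: sets_universal)
    then have "AE w in completion P. Pr w"
      by (rule AE_I') (use A P' in auto)
    then show "AE w in P. Pr w" by (simp add: AE_completion_iff)
  next
    have P: "P \<in> probs (OmM Om t)" using that assms by auto
    note P' = probsD[OF P]
    assume "AE w in P. Pr w"
    then obtain N where N: "{w\<in>space P. \<not> Pr w} \<subseteq> N" "emeasure P N = 0" "N \<in> sets P" by (rule AE_E)
    then show "\<exists>A\<in>univ_sets (OmM Om t). {w \<in> space (OmM Om t). \<not> Pr w} \<subseteq> A \<and> emeasure (completion P) A = 0"
      using P' sets_imp_sets_universal[of N "OmM Om t"] by (intro bexI[of _ N]) (auto simp: sets_universal)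
  qed
  then show ?thesis unfolding qs_def polar_def by auto
qed

subsection \<open>Borel structure of the path spaces\<close>

lemma space_borel_of [simp]: "space (borel_of X) = topspace X"
  by (simp add: borel_of_def space_measure_of_conv)

lemma sets_borel_of: "sets (borel_of X) = sigma_sets (topspace X) {U. openin X U}"
  unfolding borel_of_def by (rule sets_measure_of) (auto dest: openin_subset)

lemma openin_sets_borel_of: "openin X U \<Longrightarrow> U \<in> sets (borel_of X)"
  by (auto simp: sets_borel_of)

lemma closedin_sets_borel_of: "closedin X U \<Longrightarrow> U \<in> sets (borel_of X)"
proof -
  assume "closedin X U"
  then have "space (borel_of X) - (topspace X - U) \<in> sets (borel_of X)"
    by (intro sets.compl_sets openin_sets_borel_of) auto
  with \<open>closedin X U\<close> show ?thesis
    using closedin_subset by (fastforce simp: double_diff)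
qed

lemma continuous_map_measurable_borel_of:
  assumes "continuous_map X Y f"
  shows "f \<in> borel_of X \<rightarrow>\<^sub>M borel_of Y"
proof -
  have "f \<in> borel_of X \<rightarrow>\<^sub>M sigma (topspace Y) {U. openin Y U}"
  proof (rule measurable_sigma_sets)
    show "sets (sigma (topspace Y) {U. openin Y U}) = sigma_sets (topspace Y) {U. openin Y U}"
      by (rule sets_measure_of) (auto dest: openin_subset)
    fix U assume "U \<in> {U. openin Y U}"
    with assms have "openin X {x \<in> topspace X. f x \<in> U}"
      by (auto simp: continuous_map_def)
    moreover have "{x \<in> topspace X. f x \<in> U} = f -` U \<inter> space (borel_of X)" by auto
    ultimately show "f -` U \<inter> space (borel_of X) \<in> sets (borel_of X)"
      by (metis openin_sets_borel_of)
  qed (use assms in \<open>auto dest: openin_subset simp: continuous_map_def\<close>)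
  then show ?thesis by (simp add: borel_of_def)
qed

lemma continuous_map_borel_measurable:
  fixes f :: "'a \<Rightarrow> 'b::topological_space"
  assumes "continuous_map X euclidean f"
  shows "f \<in> borel_measurable (borel_of X)"
proof -
  have "borel_of (euclidean :: 'b topology) = borel"
    by (simp add: borel_of_def borel_def)
  with continuous_map_measurable_borel_of[OF assms] show ?thesis by simp
qed

lemma borel_of_euclidean: "borel_of (euclidean :: 'b::topological_space topology) = borel"
  by (simp add: borel_of_def borel_def)

lemma Polish_space_second_countable:
  assumes "Polish_space X"
  shows "second_countable X"
proof -
  from assms obtain M d where Md: "Metric_space M d" "X = Metric_space.mtopology M d"
    unfolding Polish_space_def
    by (meson completely_metrizable_imp_metrizable_space metrizable_space_def)
  interpret Metric_space M d by fact
  from assms obtain C where C: "countable C" "C \<subseteq> topspace X" "X closure_of C = topspace X"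
    unfolding Polish_space_def separable_space_def by auto
  define B where "B = (\<lambda>(c,n). mball c (1 / real (Suc n))) ` (C \<times> UNIV)"
  have "\<exists>V\<in>B. x \<in> V \<and> V \<subseteq> U" if U: "openin X U" "x \<in> U" for U x
  proof -
    from U Md have "U \<subseteq> M" "\<exists>r>0. mball x r \<subseteq> U"
      by (auto simp: openin_mtopology)
    then obtain r where r: "r > 0" "mball x r \<subseteq> U" and x: "x \<in> M"
      using U by blast
    obtain n where n: "1 / real (Suc n) < r / 2" using r nat_approx_posE[of "r/2"] by auto
    have "x \<in> X closure_of C" using C x Md by auto
    moreover have "x \<in> mball x (1 / real (Suc n))" using x by simp
    ultimately obtain c where c: "c \<in> C" "c \<in> mball x (1 / real (Suc n))"
      using Md(2) openin_mball[of x "1 / real (Suc n)"] unfolding in_closure_of by blast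
    have "mball c (1 / real (Suc n)) \<subseteq> U"
    proof
      fix y assume y: "y \<in> mball c (1 / real (Suc n))"
      have "d x y \<le> d x c + d c y" using y c x by (intro triangle) auto
      also have "\<dots> < r" using y c n by auto
      finally show "y \<in> U" using r y x by auto
    qed
    then show ?thesis using c
      by (intro bexI[of _ "mball c (1 / real (Suc n))"]) (auto simp: B_def commute)
  qed
  moreover have "countable B" "\<forall>V\<in>B. openin X V" using C Md by (auto simp: B_def)
  ultimately show ?thesis unfolding second_countable_def by blast
qed

lemma Polish_space_metrizable: "Polish_space X \<Longrightarrow> metrizable_space X"
  by (simp add: Polish_space_def completely_metrizable_imp_metrizable_space)

lemma topspace_OmT: "topspace (OmT Om t) = (\<Pi>\<^sub>E i\<in>{1..t}. topspace (Om i))"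
  by (simp add: OmT_def topspace_product_topology)

lemma space_OmM: "space (OmM Om t) = (\<Pi>\<^sub>E i\<in>{1..t}. topspace (Om i))"
  by (simp add: OmM_def topspace_OmT)

lemma continuous_map_OmT_restrict:
  "s \<le> t \<Longrightarrow> continuous_map (OmT Om t) (OmT Om s) (\<lambda>w. restrict w {1..s})"
  unfolding OmT_def
  by (auto simp: continuous_map_componentwise intro!: continuous_map_product_projection)

lemma measurable_OmM_restrict: "s \<le> t \<Longrightarrow> (\<lambda>w. restrict w {1..s}) \<in> OmM Om t \<rightarrow>\<^sub>M OmM Om s"
  unfolding OmM_def by (intro continuous_map_measurable_borel_of continuous_map_OmT_restrict)

lemma measurable_OmM_coordinate: "i \<in> {1..t} \<Longrightarrow> (\<lambda>w. w i) \<in> OmM Om t \<rightarrow>\<^sub>M borel_of (Om i)"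
  unfolding OmM_def OmT_def
  by (intro continuous_map_measurable_borel_of continuous_map_product_projection)

lemma continuous_map_OmT_extend:
  "continuous_map (prod_topology (OmT Om t) (Om (Suc t))) (OmT Om (Suc t)) (\<lambda>(w, y). w(Suc t := y))"
  unfolding OmT_def continuous_map_componentwise
proof safe
  fix w y assume "(w, y) \<in> topspace (prod_topology (product_topology Om {1..t}) (Om (Suc t)))"
  then show "w(Suc t := y) \<in> extensional {1..Suc t}"
    by (auto simp: PiE_def extensional_def topspace_product_topology)
next
  fix k assume k: "k \<in> {1..Suc t}"
  show "continuous_map (prod_topology (product_topology Om {1..t}) (Om (Suc t))) (Om k)
          (\<lambda>x. (case x of (w, y) \<Rightarrow> w(Suc t := y)) k)"
  proof (cases "k = Suc t")
    case True
    then show ?thesis using continuous_map_snd[of _ "Om (Suc t)"] by (simp add: case_prod_unfold)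
  next
    case False
    then have "k \<in> {1..t}" using k by auto
    then have "continuous_map (prod_topology (product_topology Om {1..t}) (Om (Suc t))) (Om k) ((\<lambda>x. x k) \<circ> fst)"
      by (intro continuous_map_compose[OF continuous_map_fst] continuous_map_product_projection)
    with False show ?thesis by (simp add: case_prod_unfold comp_def)
  qed
qed

lemma OmM_extend:
  assumes "w \<in> space (OmM Om t)" "y \<in> topspace (Om (Suc t))"
  shows "w(Suc t := y) \<in> space (OmM Om (Suc t))" "restrict (w(Suc t := y)) {1..t} = w"
  using assms by (auto simp: space_OmM PiE_iff extensional_def fun_eq_iff)

lemma OmM_restrict:
  assumes "w \<in> space (OmM Om t)"
  shows "s \<le> t \<Longrightarrow> restrict w {1..s} \<in> space (OmM Om s)" "restrict w {1..t} = w"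
    "i \<in> {1..t} \<Longrightarrow> w i \<in> topspace (Om i)"
  using assms by (auto simp: space_OmM PiE_iff extensional_def fun_eq_iff)

lemma OmM_split:
  assumes "w \<in> space (OmM Om (Suc t))"
  shows "(restrict w {1..t})(Suc t := w (Suc t)) = w"
  using assms by (auto simp: space_OmM PiE_iff extensional_def fun_eq_iff)

lemma restrict_restrict_le: "s \<le> t \<Longrightarrow> restrict (restrict w {1..t}) {1..s} = restrict w {1..s::nat}"
  by (auto simp: fun_eq_iff)

definition rect :: "(nat \<Rightarrow> 'a topology) \<Rightarrow> nat \<Rightarrow> (nat \<Rightarrow> 'a) set \<Rightarrow> 'a set \<Rightarrow> (nat \<Rightarrow> 'a) set" where
  "rect Om t A B = {w \<in> space (OmM Om (Suc t)). restrict w {1..t} \<in> A \<and> w (Suc t) \<in> B}"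

definition rects :: "(nat \<Rightarrow> 'a topology) \<Rightarrow> nat \<Rightarrow> (nat \<Rightarrow> 'a) set set" where
  "rects Om t = {rect Om t A B | A B. A \<in> sets (OmM Om t) \<and> B \<in> sets (borel_of (Om (Suc t)))}"

lemma rect_open_basis:
  assumes U: "openin (OmT Om (Suc t)) U" and w: "w \<in> U"
  obtains A B where "openin (OmT Om t) A" "openin (Om (Suc t)) B" "w \<in> rect Om t A B" "rect Om t A B \<subseteq> U"
proof -
  let ?e = "\<lambda>(w, y). w(Suc t := y)"
  let ?X = "prod_topology (OmT Om t) (Om (Suc t))"
  have wS: "w \<in> space (OmM Om (Suc t))" using U w openin_subset by (fastforce simp: OmM_def)
  have "openin ?X {p \<in> topspace ?X. ?e p \<in> U}"
    using continuous_map_OmT_extend[of Om t] U by (auto simp: continuous_map_def)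
  moreover have "(restrict w {1..t}, w (Suc t)) \<in> {p \<in> topspace ?X. ?e p \<in> U}"
    using OmM_split[OF wS] w OmM_restrict(1)[OF wS, of t] OmM_restrict(3)[OF wS, of "Suc t"] by (auto simp: OmM_def)
  ultimately obtain A B where AB: "openin (OmT Om t) A" "openin (Om (Suc t)) B"
    "restrict w {1..t} \<in> A" "w (Suc t) \<in> B" "A \<times> B \<subseteq> {p \<in> topspace ?X. ?e p \<in> U}"
    unfolding openin_prod_topology_alt by meson
  show ?thesis
  proof (rule that[OF AB(1,2)])
    show "w \<in> rect Om t A B" using AB wS by (auto simp: rect_def)
    show "rect Om t A B \<subseteq> U"
    proof
      fix v assume v: "v \<in> rect Om t A B"
      then have "(restrict v {1..t}, v (Suc t)) \<in> A \<times> B" unfolding rect_def by simp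
      from subsetD[OF AB(5) this] have "(restrict v {1..t})(Suc t := v (Suc t)) \<in> U" by simp
      moreover have "v \<in> space (OmM Om (Suc t))" using v by (simp add: rect_def)
      ultimately show "v \<in> U" by (simp only: OmM_split)
    qed
  qed
qed

lemma openin_rect:
  assumes "openin (OmT Om t) A" "openin (Om (Suc t)) B"
  shows "openin (OmT Om (Suc t)) (rect Om t A B)"
proof -
  have "openin (OmT Om (Suc t)) {w \<in> topspace (OmT Om (Suc t)). restrict w {1..t} \<in> A}"
    using continuous_map_OmT_restrict[of t "Suc t" Om] assms by (auto simp: continuous_map_def)
  moreover have "openin (OmT Om (Suc t)) {w \<in> topspace (OmT Om (Suc t)). w (Suc t) \<in> B}"
    using continuous_map_product_projection[of "Suc t" "{1..Suc t}" Om] assms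
    by (auto simp: continuous_map_def OmT_def)
  ultimately have "openin (OmT Om (Suc t)) ({w \<in> topspace (OmT Om (Suc t)). restrict w {1..t} \<in> A} \<inter>
      {w \<in> topspace (OmT Om (Suc t)). w (Suc t) \<in> B})" by auto
  also have "\<dots> = rect Om t A B" by (auto simp: rect_def OmM_def)
  finally show ?thesis .
qed

lemma second_countableE:
  assumes "second_countable X"
  obtains \<B> where "countable \<B>" "\<forall>V\<in>\<B>. openin X V"
    "\<forall>U x. openin X U \<and> x \<in> U \<longrightarrow> (\<exists>V\<in>\<B>. x \<in> V \<and> V \<subseteq> U)"
proof -
  from assms obtain \<B> where "countable \<B> \<and> (\<forall>V\<in>\<B>. openin X V) \<and>
    (\<forall>U x. openin X U \<and> x \<in> U \<longrightarrow> (\<exists>V\<in>\<B>. x \<in> V \<and> V \<subseteq> U))"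
    unfolding second_countable_def ..
  with that[of \<B>] show ?thesis by simp
qed

lemma second_countable_OmT:
  "(\<forall>i\<in>{1..t}. second_countable (Om i)) \<Longrightarrow> second_countable (OmT Om t)"
proof (induction t)
  case 0
  have "countable {topspace (OmT Om 0)}" by simp
  moreover have "\<exists>V\<in>{topspace (OmT Om 0)}. x \<in> V \<and> V \<subseteq> U"
    if "openin (OmT Om 0) U" "x \<in> U" for U x
    using that openin_subset[OF that(1)] by (auto simp: topspace_OmT)
  ultimately show ?case unfolding second_countable_def
    by (intro exI[of _ "{topspace (OmT Om 0)}"]) auto
next
  case (Suc t)
  have 1: "second_countable (OmT Om t)"
    by (rule Suc.IH) (meson Suc.prems atLeastAtMost_iff le_SucI)
  have 2: "second_countable (Om (Suc t))"
    by (rule bspec[OF Suc.prems]) simp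
  obtain \<B> where B: "countable \<B>" "\<forall>V\<in>\<B>. openin (OmT Om t) V"
      "\<forall>U x. openin (OmT Om t) U \<and> x \<in> U \<longrightarrow> (\<exists>V\<in>\<B>. x \<in> V \<and> V \<subseteq> U)"
    by (rule second_countableE[OF 1])
  obtain \<C> where C: "countable \<C>" "\<forall>V\<in>\<C>. openin (Om (Suc t)) V"
      "\<forall>U x. openin (Om (Suc t)) U \<and> x \<in> U \<longrightarrow> (\<exists>V\<in>\<C>. x \<in> V \<and> V \<subseteq> U)"
    by (rule second_countableE[OF 2])
  let ?D = "(\<lambda>(A,B). rect Om t A B) ` (\<B> \<times> \<C>)"
  have "\<exists>V\<in>?D. x \<in> V \<and> V \<subseteq> U" if U: "openin (OmT Om (Suc t)) U" "x \<in> U" for U x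
  proof -
    from rect_open_basis[OF U] obtain A B where AB: "openin (OmT Om t) A" "openin (Om (Suc t)) B"
      "x \<in> rect Om t A B" "rect Om t A B \<subseteq> U" .
    obtain A' where "A' \<in> \<B>" "restrict x {1..t} \<in> A'" "A' \<subseteq> A"
      using AB spec[OF spec[OF B(3), of A], of "restrict x {1..t}"] by (auto simp: rect_def)
    moreover obtain B' where "B' \<in> \<C>" "x (Suc t) \<in> B'" "B' \<subseteq> B"
      using AB spec[OF spec[OF C(3), of B], of "x (Suc t)"] by (auto simp: rect_def)
    ultimately show ?thesis using AB by (intro bexI[of _ "rect Om t A' B'"]) (auto simp: rect_def)
  qed
  moreover have "countable ?D" "\<forall>V\<in>?D. openin (OmT Om (Suc t)) V"
    using B C by (auto intro: openin_rect)
  ultimately show ?case unfolding second_countable_def by blast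
qed

lemma rect_sets:
  assumes "A \<in> sets (OmM Om t)" "B \<in> sets (borel_of (Om (Suc t)))"
  shows "rect Om t A B \<in> sets (OmM Om (Suc t))"
proof -
  note [measurable] = measurable_OmM_restrict[of t "Suc t" Om] measurable_OmM_coordinate[of "Suc t" "Suc t" Om] assms
  show ?thesis unfolding rect_def by measurable
qed

text \<open>Second countability makes every open set a countable union of open rectangles. The Borel
  structure of the path space is thus a product structure, on which measurability of concatenation
  can be tested.\<close>

lemma sets_OmM_Suc:
  assumes "\<forall>i\<in>{1..Suc t}. second_countable (Om i)"
  shows "sets (OmM Om (Suc t)) = sigma_sets (space (OmM Om (Suc t))) (rects Om t)"
proof
  show "sigma_sets (space (OmM Om (Suc t))) (rects Om t) \<subseteq> sets (OmM Om (Suc t))"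
    by (rule sets.sigma_sets_subset) (auto simp: rects_def intro: rect_sets)
  have 1: "second_countable (OmT Om t)"
    by (rule second_countable_OmT) (meson assms atLeastAtMost_iff le_SucI)
  have 2: "second_countable (Om (Suc t))"
    by (rule bspec[OF assms]) simp
  obtain \<B> where B: "countable \<B>" "\<forall>V\<in>\<B>. openin (OmT Om t) V"
      "\<forall>U x. openin (OmT Om t) U \<and> x \<in> U \<longrightarrow> (\<exists>V\<in>\<B>. x \<in> V \<and> V \<subseteq> U)"
    by (rule second_countableE[OF 1])
  obtain \<C> where C: "countable \<C>" "\<forall>V\<in>\<C>. openin (Om (Suc t)) V"
      "\<forall>U x. openin (Om (Suc t)) U \<and> x \<in> U \<longrightarrow> (\<exists>V\<in>\<C>. x \<in> V \<and> V \<subseteq> U)"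
    by (rule second_countableE[OF 2])
  have "U \<in> sigma_sets (space (OmM Om (Suc t))) (rects Om t)" if U: "openin (OmT Om (Suc t)) U" for U
  proof -
    let ?D = "{p \<in> \<B> \<times> \<C>. rect Om t (fst p) (snd p) \<subseteq> U}"
    have "U = (\<Union>p\<in>?D. rect Om t (fst p) (snd p))"
    proof safe
      fix x assume "x \<in> U"
      from rect_open_basis[OF U this] obtain A B where AB: "openin (OmT Om t) A" "openin (Om (Suc t)) B"
        "x \<in> rect Om t A B" "rect Om t A B \<subseteq> U" .
      obtain A' where "A' \<in> \<B>" "restrict x {1..t} \<in> A'" "A' \<subseteq> A"
        using AB spec[OF spec[OF B(3), of A], of "restrict x {1..t}"] by (auto simp: rect_def)
      moreover obtain B' where "B' \<in> \<C>" "x (Suc t) \<in> B'" "B' \<subseteq> B"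
        using AB spec[OF spec[OF C(3), of B], of "x (Suc t)"] by (auto simp: rect_def)
      ultimately have "(A', B') \<in> ?D" "x \<in> rect Om t A' B'" using AB by (auto simp: rect_def)
      then show "x \<in> (\<Union>p\<in>?D. rect Om t (fst p) (snd p))" by force
    qed auto
    moreover have "(\<Union>p\<in>?D. rect Om t (fst p) (snd p)) \<in> sigma_sets (space (OmM Om (Suc t))) (rects Om t)"
    proof (rule sigma_sets_UNION)
      show "countable ((\<lambda>p. rect Om t (fst p) (snd p)) ` ?D)" using B C by auto
      fix b assume "b \<in> (\<lambda>p. rect Om t (fst p) (snd p)) ` ?D"
      then obtain p where "p \<in> ?D" "b = rect Om t (fst p) (snd p)" by blast
      with B C have "b \<in> rects Om t" unfolding rects_def OmM_def
        by (auto intro!: exI[of _ "fst p"] exI[of _ "snd p"] openin_sets_borel_of)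
      then show "b \<in> sigma_sets (space (OmM Om (Suc t))) (rects Om t)" by auto
    qed
    ultimately show ?thesis by simp
  qed
  then show "sets (OmM Om (Suc t)) \<subseteq> sigma_sets (space (OmM Om (Suc t))) (rects Om t)"
    unfolding OmM_def sets_borel_of space_borel_of by (intro sigma_sets_mono) auto
qed

lemma measurable_OmM_extend:
  assumes "\<forall>i\<in>{1..Suc t}. second_countable (Om i)"
    and f: "f \<in> N \<rightarrow>\<^sub>M OmM Om t" and g: "g \<in> N \<rightarrow>\<^sub>M borel_of (Om (Suc t))"
  shows "(\<lambda>x. (f x)(Suc t := g x)) \<in> N \<rightarrow>\<^sub>M OmM Om (Suc t)"
proof (rule measurable_sigma_sets[OF sets_OmM_Suc[OF assms(1)]])
  show "rects Om t \<subseteq> Pow (space (OmM Om (Suc t)))" by (auto simp: rects_def rect_def)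
  show "(\<lambda>x. (f x)(Suc t := g x)) \<in> space N \<rightarrow> space (OmM Om (Suc t))"
    using measurable_space[OF f] measurable_space[OF g] OmM_extend(1) by fastforce
  fix y assume "y \<in> rects Om t"
  then obtain A B where AB: "y = rect Om t A B" "A \<in> sets (OmM Om t)" "B \<in> sets (borel_of (Om (Suc t)))"
    by (auto simp: rects_def)
  have "(\<lambda>x. (f x)(Suc t := g x)) -` y \<inter> space N = (f -` A \<inter> space N) \<inter> (g -` B \<inter> space N)"
  proof (intro set_eqI iffI)
    fix x
    note E = OmM_extend[of "f x" Om t "g x"]
    show "x \<in> (f -` A \<inter> space N) \<inter> (g -` B \<inter> space N)"
      if "x \<in> (\<lambda>x. (f x)(Suc t := g x)) -` y \<inter> space N"
      using that measurable_space[OF f, of x] measurable_space[OF g, of x] E by (simp add: AB rect_def)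
    show "x \<in> (\<lambda>x. (f x)(Suc t := g x)) -` y \<inter> space N"
      if "x \<in> (f -` A \<inter> space N) \<inter> (g -` B \<inter> space N)"
      using that measurable_space[OF f, of x] measurable_space[OF g, of x] E by (simp add: AB rect_def)
  qed
  then show "(\<lambda>x. (f x)(Suc t := g x)) -` y \<inter> space N \<in> sets N"
    using AB f g by (auto intro!: sets.Int measurable_sets)
qed

subsection \<open>Measurable selection from continuous images\<close>

text \<open>These are the analytic subsets of Baire space. A closed domain in place of the whole
  space admits the empty set and spares surjections between Baire spaces in the constructions for
  unions and intersections.\<close>

definition closed_image :: "(nat \<Rightarrow> nat) set \<Rightarrow> bool" where
  "closed_image B \<longleftrightarrow> (\<exists>C (h :: (nat \<Rightarrow> nat) \<Rightarrow> nat \<Rightarrow> nat). closed C \<and> continuous_on C h \<and> h ` C = B)"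

lemma closed_imp_closed_image: "closed B \<Longrightarrow> closed_image B"
  unfolding closed_image_def by (intro exI[of _ B] exI[of _ "\<lambda>x. x"]) auto

lemma euclidean_nat_discrete: "euclidean = discrete_topology (UNIV :: nat set)"
  by (simp add: topology_eq discrete_topology_class.open_discrete)

lemma metrizable_baire: "metrizable_space (euclidean :: (nat \<Rightarrow> nat) topology)"
  unfolding euclidean_product_topology[symmetric] metrizable_space_product_topology
  by (simp add: euclidean_nat_discrete metrizable_space_discrete_topology)

lemma baire_tendsto:
  fixes s :: "nat \<Rightarrow> nat \<Rightarrow> nat"
  assumes "\<And>i. eventually (\<lambda>j. s j i = l i) sequentially"
  shows "s \<longlonglongrightarrow> l"
proof -
  have "limitin (product_topology (\<lambda>i. euclidean) UNIV) s l sequentially"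
    unfolding limitin_componentwise using assms by (auto intro: tendsto_eventually)
  then show ?thesis by (simp add: euclidean_product_topology)
qed

lemma open_baire_coordinate: "open {\<sigma> :: nat \<Rightarrow> nat. \<sigma> i \<in> A}"
proof -
  have "open ((\<lambda>\<sigma> :: nat \<Rightarrow> nat. \<sigma> i) -` A)"
    by (rule open_vimage) (auto intro: continuous_on_product_coordinates discrete_topology_class.open_discrete)
  then show ?thesis by (simp add: vimage_def)
qed

lemma closed_baire_coordinate: "closed {\<sigma> :: nat \<Rightarrow> nat. \<sigma> i \<in> A}"
  using open_baire_coordinate[of i "- A"] by (simp add: closed_def Collect_neg_eq)

lemma closed_baire_cylinder: "closed {\<sigma> :: nat \<Rightarrow> nat. \<forall>i<k. \<sigma> i \<in> A i}"
proof -
  have "closed (\<Inter>i\<in>{..<k}. {\<sigma> :: nat \<Rightarrow> nat. \<sigma> i \<in> A i})"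
    by (intro closed_INT ballI closed_baire_coordinate)
  also have "(\<Inter>i\<in>{..<k}. {\<sigma> :: nat \<Rightarrow> nat. \<sigma> i \<in> A i}) = {\<sigma>. \<forall>i<k. \<sigma> i \<in> A i}" by auto
  finally show ?thesis .
qed

lemma continuous_on_baire_reindex: "continuous_on S (\<lambda>\<sigma> :: nat \<Rightarrow> nat. \<lambda>k. \<sigma> (r k))"
  by (intro continuous_on_coordinatewise_then_product)
    (rule continuous_on_subset[OF continuous_on_product_coordinates subset_UNIV])

text \<open>Coordinate 0 of a sequence names the index n, and its tail is a point of the domain
  belonging to n. The pieces with fixed coordinate 0 are open, so continuity may be checked on each
  of them.\<close>

lemma closed_image_UN:
  assumes "\<And>n :: nat. closed_image (B n)"
  shows "closed_image (\<Union>n. B n)"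
proof -
  have "\<forall>n. \<exists>C (h :: (nat \<Rightarrow> nat) \<Rightarrow> nat \<Rightarrow> nat). closed C \<and> continuous_on C h \<and> h ` C = B n"
    using assms unfolding closed_image_def by blast
  then have "\<exists>C (h :: nat \<Rightarrow> (nat \<Rightarrow> nat) \<Rightarrow> nat \<Rightarrow> nat). \<forall>n. closed (C n) \<and> continuous_on (C n) (h n) \<and> h n ` C n = B n"
    unfolding choice_iff .
  then obtain C and h :: "nat \<Rightarrow> (nat \<Rightarrow> nat) \<Rightarrow> nat \<Rightarrow> nat"
    where Ch: "\<And>n. closed (C n)" "\<And>n. continuous_on (C n) (h n)" "\<And>n. h n ` C n = B n"
    by blast
  define tl :: "(nat \<Rightarrow> nat) \<Rightarrow> nat \<Rightarrow> nat" where "tl = (\<lambda>\<sigma> k. \<sigma> (Suc k))"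
  define D where "D = {\<sigma>. tl \<sigma> \<in> C (\<sigma> 0)}"
  define g where "g = (\<lambda>\<sigma>. h (\<sigma> 0) (tl \<sigma>))"
  have ctl: "continuous_on S tl" for S unfolding tl_def by (rule continuous_on_baire_reindex)
  have "D = (\<Inter>n. {\<sigma>. \<sigma> 0 \<in> - {n}} \<union> tl -` C n)" by (auto simp: D_def)
  moreover have "closed \<dots>"
    by (intro closed_INT ballI closed_Un closed_baire_coordinate closed_vimage Ch(1) ctl)
  ultimately have D: "closed D" by simp
  have "continuous_map (top_of_set D) euclidean g"
  proof (rule pasting_lemma[where I=UNIV and T="\<lambda>n. D \<inter> {\<sigma>. \<sigma> 0 \<in> {n}}" and f="\<lambda>n \<sigma>. h n (tl \<sigma>)"])
    show "openin (top_of_set D) (D \<inter> {\<sigma>. \<sigma> 0 \<in> {n}})" for n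
      by (intro openin_open_Int open_baire_coordinate)
    fix n
    have "continuous_on (D \<inter> {\<sigma>. \<sigma> 0 \<in> {n}}) (\<lambda>\<sigma>. h n (tl \<sigma>))"
      by (rule continuous_on_compose2[OF Ch(2) ctl]) (auto simp: D_def)
    then show "continuous_map (subtopology (top_of_set D) (D \<inter> {\<sigma>. \<sigma> 0 \<in> {n}})) euclidean (\<lambda>\<sigma>. h n (tl \<sigma>))"
      by (simp add: subtopology_subtopology)
  qed (auto simp: g_def)
  then have "continuous_on D g" by simp
  moreover have "g ` D = (\<Union>n. B n)"
  proof safe
    fix \<sigma> assume "\<sigma> \<in> D"
    then have "g \<sigma> \<in> B (\<sigma> 0)" unfolding g_def Ch(3)[symmetric] by (auto simp: D_def)
    then show "g \<sigma> \<in> (\<Union>n. B n)" by blast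
  next
    fix b n assume "b \<in> B n"
    then have "b \<in> h n ` C n" using Ch(3)[of n] by simp
    then obtain c where c: "c \<in> C n" "h n c = b" by blast
    have *: "tl (case_nat n c) = c" by (simp add: tl_def)
    show "b \<in> g ` D" using c * by (intro image_eqI[of _ _ "case_nat n c"]) (auto simp: D_def g_def)
  qed
  ultimately show ?thesis using D unfolding closed_image_def by blast
qed

text \<open>One sequence codes, through the pairing function, a point of every domain at once. Those
  codes whose images all agree form a closed set, since the diagonal is closed.\<close>

lemma closed_image_INT:
  assumes "\<And>n :: nat. closed_image (B n)"
  shows "closed_image (\<Inter>n. B n)"
proof -
  have "\<forall>n. \<exists>C (h :: (nat \<Rightarrow> nat) \<Rightarrow> nat \<Rightarrow> nat). closed C \<and> continuous_on C h \<and> h ` C = B n"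
    using assms unfolding closed_image_def by blast
  then have "\<exists>C (h :: nat \<Rightarrow> (nat \<Rightarrow> nat) \<Rightarrow> nat \<Rightarrow> nat). \<forall>n. closed (C n) \<and> continuous_on (C n) (h n) \<and> h n ` C n = B n"
    unfolding choice_iff .
  then obtain C and h :: "nat \<Rightarrow> (nat \<Rightarrow> nat) \<Rightarrow> nat \<Rightarrow> nat"
    where Ch: "\<And>n. closed (C n)" "\<And>n. continuous_on (C n) (h n)" "\<And>n. h n ` C n = B n"
    by blast
  define row :: "nat \<Rightarrow> (nat \<Rightarrow> nat) \<Rightarrow> nat \<Rightarrow> nat" where "row = (\<lambda>n \<sigma> k. \<sigma> (prod_encode (n, k)))"
  \<comment> \<open>Including the condition on row 0 keeps both maps of the comparison continuous on
    the same closed set.\<close>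
  define E where "E n = row n -` C n \<inter> row 0 -` C 0" for n
  define D where "D = (\<Inter>n. E n \<inter> {\<sigma>. h n (row n \<sigma>) = h 0 (row 0 \<sigma>)})"
  have crow: "continuous_on S (row n)" for S n unfolding row_def by (rule continuous_on_baire_reindex)
  have E: "closed (E n)" for n
    using closed_Int[OF closed_vimage[OF Ch(1)[of n] crow[of UNIV n]] closed_vimage[OF Ch(1)[of 0] crow[of UNIV 0]]]
    unfolding E_def .
  have "closed (E n \<inter> {\<sigma>. h n (row n \<sigma>) = h 0 (row 0 \<sigma>)})" for n
  proof -
    let ?g = "\<lambda>i \<sigma>. (h n (row n \<sigma>) i, h 0 (row 0 \<sigma>) i)"
    have 1: "continuous_on (E n) (\<lambda>\<sigma>. h n (row n \<sigma>))"
      by (rule continuous_on_compose2[OF Ch(2) crow]) (simp add: E_def image_subset_iff)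
    have 2: "continuous_on (E n) (\<lambda>\<sigma>. h 0 (row 0 \<sigma>))"
      by (rule continuous_on_compose2[OF Ch(2) crow]) (simp add: E_def image_subset_iff)
    have g: "continuous_on (E n) (?g i)" for i
      by (rule continuous_on_Pair; rule continuous_on_product_then_coordinatewise) (rule 1 2)+
    have "closed (E n \<inter> ?g i -` {y. \<exists>x. y = (x, x)})" for i
      by (rule continuous_closed_preimage[OF g E closed_diagonal])
    then have "closed (\<Inter>i. E n \<inter> ?g i -` {y. \<exists>x. y = (x, x)})"
      by (intro closed_INT ballI)
    also have "(\<Inter>i. E n \<inter> ?g i -` {y. \<exists>x. y = (x, x)}) = E n \<inter> {\<sigma>. h n (row n \<sigma>) = h 0 (row 0 \<sigma>)}"
      by (auto simp: fun_eq_iff)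
    finally show ?thesis .
  qed
  then have D: "closed D" unfolding D_def by (intro closed_INT ballI)
  have "continuous_on D (\<lambda>\<sigma>. h 0 (row 0 \<sigma>))"
    by (rule continuous_on_compose2[OF Ch(2) crow]) (auto simp: D_def E_def)
  moreover have "(\<lambda>\<sigma>. h 0 (row 0 \<sigma>)) ` D = (\<Inter>n. B n)"
  proof safe
    fix \<sigma> n assume "\<sigma> \<in> D"
    then have "\<sigma> \<in> E n \<inter> {\<sigma>. h n (row n \<sigma>) = h 0 (row 0 \<sigma>)}" unfolding D_def by blast
    then have "h n (row n \<sigma>) = h 0 (row 0 \<sigma>)" "row n \<sigma> \<in> C n" by (simp_all add: E_def)
    moreover from this(2) have "h n (row n \<sigma>) \<in> B n" unfolding Ch(3)[symmetric] by (rule imageI)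
    ultimately show "h 0 (row 0 \<sigma>) \<in> B n" by (simp only:)
  next
    fix b assume "b \<in> (\<Inter>n. B n)"
    then have b: "b \<in> h n ` C n" for n unfolding Ch(3) by simp
    have "\<exists>c. c \<in> C n \<and> h n c = b" for n using b[of n] by (auto simp only: image_iff)
    then have "\<forall>n. \<exists>c. c \<in> C n \<and> h n c = b" by (rule allI)
    then have "\<exists>c. \<forall>n. c n \<in> C n \<and> h n (c n) = b" unfolding choice_iff .
    then obtain c where "\<forall>n. c n \<in> C n \<and> h n (c n) = b" ..
    then have c: "\<And>n. c n \<in> C n" "\<And>n. h n (c n) = b" by simp_all
    define \<sigma> where "\<sigma> = (\<lambda>m. case prod_decode m of (n, k) \<Rightarrow> c n k)"
    have "row n \<sigma> = c n" for n by (simp add: row_def \<sigma>_def)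
    with c have "\<sigma> \<in> D" "b = h 0 (row 0 \<sigma>)" by (simp_all add: D_def E_def)
    then show "b \<in> (\<lambda>\<sigma>. h 0 (row 0 \<sigma>)) ` D" by (intro image_eqI)
  qed
  ultimately show ?thesis using D unfolding closed_image_def
    by (intro exI[of _ D] exI[of _ "\<lambda>\<sigma>. h 0 (row 0 \<sigma>)"] conjI)
qed

text \<open>Images are not stable under complements, so the induction carries a set together with
  its complement; unions and intersections then exchange roles. In the base case the open complement
  is a countable union of closed sets.\<close>

lemma borel_imp_closed_image:
  assumes "B \<in> sets (borel :: (nat \<Rightarrow> nat) measure)"
  shows "closed_image B"
proof -
  have "B \<in> sigma_sets UNIV (Collect (closed :: (nat \<Rightarrow> nat) set \<Rightarrow> bool))"
    using assms by (subst (asm) borel_eq_closed) simp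
  then have "closed_image B \<and> closed_image (- B)"
  proof (induction rule: sigma_sets.induct)
    case (Basic a)
    then have "closed a" by simp
    have "fsigma_in euclidean (- a)"
      using \<open>closed a\<close> by (intro open_imp_fsigma_in metrizable_baire) auto
    then obtain C where "(\<forall>n. closedin euclidean (C n)) \<and> (\<forall>n. C n \<subseteq> C (Suc n)) \<and> \<Union> (range C) = - a"
      unfolding fsigma_in_ascending ..
    then have C: "\<And>n. closed (C n)" "\<Union> (range C) = - a" by (auto simp del: Union_iff)
    have "closed_image (\<Union>n. C n)" by (intro closed_image_UN closed_imp_closed_image C)
    with C \<open>closed a\<close> show ?case by (simp add: closed_imp_closed_image)
  next
    case Empty
    show ?case by (auto intro: closed_imp_closed_image)
  next
    case (Compl a)
    then show ?case by (simp add: Compl_eq_Diff_UNIV[symmetric])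
  next
    case (Union a)
    then show ?case by (auto intro!: closed_image_UN closed_image_INT)
  qed
  then show ?thesis by simp
qed

text \<open>Compactness of the full box makes finitely many bounds enough: points outside W that
  obey more and more of the bounds would accumulate at a point of the box.\<close>

lemma baire_box_neighbourhood:
  fixes C W :: "(nat \<Rightarrow> nat) set"
  assumes C: "closed C" and W: "open W" "{\<sigma> \<in> C. \<forall>i. \<sigma> i \<le> n i} \<subseteq> W"
  shows "\<exists>k. {\<sigma> \<in> C. \<forall>i<k. \<sigma> i \<le> n i} \<subseteq> W"
proof (rule ccontr)
  assume "\<not> ?thesis"
  then have "\<forall>k. \<exists>\<sigma>. \<sigma> \<in> C \<and> (\<forall>i<k. \<sigma> i \<le> n i) \<and> \<sigma> \<notin> W" by blast
  then obtain s where s: "\<And>k. s k \<in> C" "\<And>k i. i < k \<Longrightarrow> s k i \<le> n i" "\<And>k. s k \<notin> W" by metis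
  \<comment> \<open>Truncation moves \<open>s k\<close> into the compact box and alters it only from
    coordinate k on, so coordinatewise limits of the truncations are limits of the original
    points.\<close>
  define \<tau> where "\<tau> = (\<lambda>k i. min (s k i) (n i))"
  have "compactin (product_topology (\<lambda>i. euclidean) UNIV) (\<Pi>\<^sub>E i\<in>UNIV. {..n i})"
    unfolding compactin_PiE by (simp add: finite_imp_compact)
  then have "compact (\<Pi>\<^sub>E i\<in>UNIV. {..n i})" by (simp add: euclidean_product_topology)
  moreover have "\<forall>k. \<tau> k \<in> (\<Pi>\<^sub>E i\<in>UNIV. {..n i})" by (auto simp: \<tau>_def)
  ultimately obtain l r where l: "l \<in> (\<Pi>\<^sub>E i\<in>UNIV. {..n i})" "strict_mono r" "(\<tau> \<circ> r) \<longlonglongrightarrow> l"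
    by (metis compact_imp_seq_compact seq_compactE)
  have lim: "(\<lambda>j. s (r j)) \<longlonglongrightarrow> l"
  proof (rule baire_tendsto)
    fix i
    have "eventually (\<lambda>j. (\<tau> \<circ> r) j \<in> {\<sigma>. \<sigma> i \<in> {l i}}) sequentially"
      using l(3) open_baire_coordinate by (rule topological_tendstoD) simp
    moreover have "eventually (\<lambda>j. i < j) sequentially" by (rule eventually_gt_at_top)
    ultimately show "eventually (\<lambda>j. s (r j) i = l i) sequentially"
    proof eventually_elim
      case (elim j)
      have "i < r j" using elim(2) seq_suble[OF l(2), of j] by linarith
      with s(2) elim(1) show ?case by (simp add: \<tau>_def min_def split: if_splits)
    qed
  qed
  have "l \<in> C" by (rule closed_sequentially[OF C _ lim]) (rule s(1))
  with l(1) have "l \<in> {\<sigma> \<in> C. \<forall>i. \<sigma> i \<le> n i}" by (simp add: PiE_iff)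
  then have "l \<in> W" by (rule subsetD[OF W(2)])
  then have "eventually (\<lambda>j. s (r j) \<in> W) sequentially"
    by (rule topological_tendstoD[OF lim W(1)])
  with s(3) show False by simp
qed

lemma baire_box_compact:
  assumes "closed C"
  shows "compact {\<sigma> \<in> C. \<forall>i. \<sigma> i \<le> (n i :: nat)}"
proof -
  have "compactin (product_topology (\<lambda>i. euclidean) UNIV) (\<Pi>\<^sub>E i\<in>UNIV. {..n i})"
    unfolding compactin_PiE by (simp add: finite_imp_compact)
  then have "compact (\<Pi>\<^sub>E i\<in>UNIV. {..n i})" by (simp add: euclidean_product_topology)
  then have "compact (C \<inter> (\<Pi>\<^sub>E i\<in>UNIV. {..n i}))" using assms by (rule closed_Int_compact[rotated])
  also have "C \<inter> (\<Pi>\<^sub>E i\<in>UNIV. {..n i}) = {\<sigma> \<in> C. \<forall>i. \<sigma> i \<le> n i}" by (auto simp: PiE_iff)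
  finally show ?thesis .
qed

text \<open>The image of the box is compact, so a point outside it has a neighbourhood disjoint from
  some open V containing that image. By \<open>baire_box_neighbourhood\<close> finitely many bounds
  already force images into V, and their closure misses the point.\<close>

lemma image_box_eq_closures:
  fixes C :: "(nat \<Rightarrow> nat) set"
  assumes X: "Hausdorff_space X" and C: "closed C"
    and F: "continuous_map (top_of_set C) X F"
  shows "(\<Inter>k. X closure_of (F ` {\<sigma> \<in> C. \<forall>i<k. \<sigma> i \<le> n i})) \<subseteq> F ` {\<sigma> \<in> C. \<forall>i. \<sigma> i \<le> (n i :: nat)}"
    (is "?L \<subseteq> F ` ?K")
proof
  fix w assume w: "w \<in> ?L"
  then have wX: "w \<in> topspace X" using closure_of_subset_topspace by fastforce
  show "w \<in> F ` ?K"
  proof (rule ccontr)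
    assume "w \<notin> F ` ?K"
    have "compactin (top_of_set C) ?K" using baire_box_compact[OF C, of n] by (auto simp: compactin_subtopology)
    then have "compactin X (F ` ?K)" using F by (rule image_compactin)
    moreover have "compactin X {w}" using wX by simp
    ultimately obtain U V where UV: "openin X U" "openin X V" "{w} \<subseteq> U" "F ` ?K \<subseteq> V" "disjnt U V"
      using Hausdorff_space_compact_separation[OF X, of "{w}" "F ` ?K"] \<open>w \<notin> F ` ?K\<close> by auto
    have "openin (top_of_set C) {\<sigma> \<in> C. F \<sigma> \<in> V}"
      using F UV(2) by (auto simp: continuous_map_def)
    then obtain W where W: "open W" "{\<sigma> \<in> C. F \<sigma> \<in> V} = C \<inter> W" by (auto simp: openin_open)
    then have "?K \<subseteq> W" using UV(4) by blast
    from baire_box_neighbourhood[OF C W(1) this] obtain k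
      where k: "{\<sigma> \<in> C. \<forall>i<k. \<sigma> i \<le> n i} \<subseteq> W" ..
    then have V: "F ` {\<sigma> \<in> C. \<forall>i<k. \<sigma> i \<le> n i} \<subseteq> V" using W(2) by blast
    have "w \<in> X closure_of (F ` {\<sigma> \<in> C. \<forall>i<k. \<sigma> i \<le> n i})" using w by (rule INT_D) simp
    then have "\<forall>T. w \<in> T \<and> openin X T \<longrightarrow> (\<exists>y. y \<in> F ` {\<sigma> \<in> C. \<forall>i<k. \<sigma> i \<le> n i} \<and> y \<in> T)"
      unfolding in_closure_of by (rule conjunct2)
    from spec[OF this, of U] UV(1,3) obtain y
      where "y \<in> F ` {\<sigma> \<in> C. \<forall>i<k. \<sigma> i \<le> n i}" "y \<in> U" by auto
    from subsetD[OF V this(1)] this(2) have "y \<in> U \<inter> V" by simp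
    with UV(5) show False unfolding disjnt_def by simp
  qed
qed

text \<open>Capacitability: coordinates are bounded one after the other, each bound so large that
  the outer measure of the image stays above a. The closures of these images decrease to a set
  inside the image of the resulting compact box.\<close>

lemma closed_image_inner_approx:
  fixes C :: "(nat \<Rightarrow> nat) set"
  assumes X: "Hausdorff_space X" and C: "closed C"
    and F: "continuous_map (top_of_set C) X F"
    and P: "P \<in> probs (borel_of X)" and a: "a < outer_measure_of P (F ` C)"
  shows "\<exists>E\<in>sets P. E \<subseteq> F ` C \<and> a \<le> emeasure P E"
proof -
  note P' = probsD[OF P]
  interpret prob_space P by (rule P')
  have FC: "F ` C \<subseteq> topspace X" using F by (auto simp: continuous_map_def)
  define pre where "pre n k = {\<sigma> \<in> C. \<forall>i<k. \<sigma> i \<le> n i}" for n :: "nat \<Rightarrow> nat" and k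
  have preC: "pre n k \<subseteq> C" for n k by (auto simp: pre_def)
  have "\<exists>f. \<forall>k. a < outer_measure_of P (F ` pre (f k) k) \<and> (\<exists>j. f (Suc k) = (f k)(k := j))"
  proof (rule dependent_nat_choice)
    show "\<exists>n. a < outer_measure_of P (F ` pre n 0)" using a by (simp add: pre_def)
  next
    fix n k assume n: "a < outer_measure_of P (F ` pre n k)"
    \<comment> \<open>Outer measure is continuous along increasing sets, even nonmeasurable ones, so
      a finite bound for coordinate k loses arbitrarily little.\<close>
    have "(SUP j. outer_measure_of P (F ` pre (n(k := j)) (Suc k)))
        = outer_measure_of P (\<Union>j. F ` pre (n(k := j)) (Suc k))"
    proof (rule SUP_outer_measure_of_incseq)
      show "F ` pre (n(k := j)) (Suc k) \<subseteq> space P" for j using FC preC P' by fastforce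
      show "incseq (\<lambda>j. F ` pre (n(k := j)) (Suc k))"
        by (intro incseq_SucI image_mono) (auto simp: pre_def less_Suc_eq)
    qed
    also have "(\<Union>j. F ` pre (n(k := j)) (Suc k)) = F ` pre n k"
      by (fastforce simp: pre_def less_Suc_eq)
    finally have "a < (SUP j. outer_measure_of P (F ` pre (n(k := j)) (Suc k)))" using n by (simp only:)
    then obtain j where "a < outer_measure_of P (F ` pre (n(k := j)) (Suc k))"
      unfolding less_SUP_iff by blast
    then show "\<exists>y. a < outer_measure_of P (F ` pre y (Suc k)) \<and> (\<exists>j. y = n(k := j))" by blast
  qed
  then obtain f where f: "\<And>k. a < outer_measure_of P (F ` pre (f k) k)" "\<And>k. \<exists>j. f (Suc k) = (f k)(k := j)"
    by blast
  \<comment> \<open>Stage i + 1 fixes the bound of coordinate i for good, so this diagonal collects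
    all of them.\<close>
  define n where "n = (\<lambda>i. f (Suc i) i)"
  have fn: "f k i = n i" if "i < k" for i k
    using that
  proof (induction k)
    case (Suc k)
    show ?case
    proof (cases "i = k")
      case False
      then have "i < k" using Suc by simp
      with Suc.IH f(2)[of k] show ?thesis by auto
    qed (simp add: n_def)
  qed simp
  have pre_eq: "pre (f k) k = pre n k" for k using fn by (auto simp: pre_def)
  let ?K = "{\<sigma> \<in> C. \<forall>i. \<sigma> i \<le> n i}"
  define A where "A k = X closure_of (F ` pre n k)" for k
  have A: "A k \<in> sets P" for k
    unfolding A_def P'(1) by (intro closedin_sets_borel_of closedin_closure_of)
  have "decseq A"
    unfolding A_def by (intro decseq_SucI closure_of_mono image_mono) (auto simp: pre_def)
  have "a \<le> emeasure P (A k)" for k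
  proof -
    have "a \<le> outer_measure_of P (F ` pre n k)" using f(1)[of k] pre_eq[of k] by simp
    also have "F ` pre n k \<subseteq> A k"
      unfolding A_def using FC preC by (intro closure_of_subset) fast
    then have "outer_measure_of P (F ` pre n k) \<le> outer_measure_of P (A k)" by (rule outer_measure_of_mono)
    finally show ?thesis using A by simp
  qed
  then have "a \<le> (INF k. emeasure P (A k))" by (intro INF_greatest)
  also have "\<dots> = emeasure P (\<Inter>k. A k)"
    by (rule INF_emeasure_decseq) (use A \<open>decseq A\<close> in auto)
  finally have 1: "a \<le> emeasure P (\<Inter>k. A k)" .
  have 2: "(\<Inter>k. A k) \<subseteq> F ` ?K"
    unfolding A_def pre_def by (rule image_box_eq_closures[OF X C F])
  have 3: "F ` ?K \<subseteq> F ` C" by (rule image_mono) auto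
  have "(\<Inter>k. A k) \<in> sets P" using A by auto
  from this conjI[OF subset_trans[OF 2 3] 1] show ?thesis by (rule bexI[rotated])
qed

text \<open>Inner approximation makes the supremum over measurable subsets reach the outer measure.
  A countable union attaining it and a measurable hull then differ by a null set, which traps the
  image.\<close>

lemma closed_image_universal:
  fixes C :: "(nat \<Rightarrow> nat) set"
  assumes X: "Hausdorff_space X" and C: "closed C"
    and F: "continuous_map (top_of_set C) X F"
  shows "F ` C \<in> sets (universal (borel_of X))"
proof (rule sets_universalI)
  have FC: "F ` C \<subseteq> topspace X" using F by (auto simp: continuous_map_def)
  then show "F ` C \<subseteq> space (borel_of X)" by simp
  fix P assume P: "P \<in> probs (borel_of X)"
  note P' = probsD[OF P]
  interpret prob_space P by (rule P')
  obtain B where B: "B \<in> sets P" "F ` C \<subseteq> B" "outer_measure_of P (F ` C) = emeasure P B"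
    using outer_measure_of_attain[of "F ` C" P] FC P' by auto
  let ?S = "emeasure P ` {E \<in> sets P. E \<subseteq> F ` C}"
  have "?S \<noteq> {}" by auto
  from ennreal_Sup_countable_SUP[OF this] obtain g :: "nat \<Rightarrow> ennreal"
    where g: "range g \<subseteq> ?S" "Sup ?S = (SUP i. g i)" by blast
  then have "\<forall>i. \<exists>E. E \<in> sets P \<and> E \<subseteq> F ` C \<and> g i = emeasure P E" by blast
  then obtain E where E: "\<And>i. E i \<in> sets P" "\<And>i. E i \<subseteq> F ` C" "\<And>i. g i = emeasure P (E i)" by metis
  let ?E = "\<Union>i. E i"
  have [simp]: "?E \<in> sets P" using E by auto
  have "emeasure P B \<le> Sup ?S"
  proof (rule dense_le)
    fix a assume "a < emeasure P B"
    then have "a < outer_measure_of P (F ` C)" by (simp only: B(3))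
    from closed_image_inner_approx[OF X C F P this] obtain D
      where "D \<in> sets P" "D \<subseteq> F ` C \<and> a \<le> emeasure P D" ..
    then show "a \<le> Sup ?S" by (intro SUP_upper2[of D]) simp_all
  qed
  also have "\<dots> \<le> emeasure P ?E"
    unfolding g(2) by (intro SUP_least) (auto simp: E(3) intro!: emeasure_mono)
  finally have le: "emeasure P B \<le> emeasure P ?E" .
  have EF: "?E \<subseteq> F ` C" by (rule UN_least) (rule E(2))
  then have EB: "?E \<subseteq> B" using B(2) by (rule subset_trans)
  have "emeasure P (B - ?E) = emeasure P B - emeasure P ?E"
    by (rule emeasure_Diff) (use B EB in \<open>simp_all add: emeasure_eq_measure\<close>)
  also have "\<dots> = 0" using le by (simp add: diff_eq_0_iff_ennreal emeasure_eq_measure)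
  finally have 1: "B - ?E \<in> null_sets P" using B by (intro null_setsI) auto
  have 2: "F ` C = ?E \<union> (F ` C - ?E)" using EF by (intro equalityI) simp_all
  have 3: "F ` C - ?E \<subseteq> B - ?E" using B(2) by (intro Diff_mono) simp_all
  show "F ` C \<in> sets (completion P)" by (rule sets_completionI[OF 2 3 1 \<open>?E \<in> sets P\<close>])
qed

section \<open>The lexicographic selector\<close>

primrec lexmin :: "('x \<Rightarrow> (nat \<Rightarrow> nat) \<Rightarrow> nat \<Rightarrow> bool) \<Rightarrow> 'x \<Rightarrow> nat \<Rightarrow> nat \<Rightarrow> nat" where
  "lexmin A w 0 = (\<lambda>_. 0)"
| "lexmin A w (Suc k) = (lexmin A w k)(k := LEAST j. A w ((lexmin A w k)(k := j)) (Suc k))"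

text \<open>The selector is the lexicographically least point of the fibre: fibres are closed, so the
  limit of the greedily chosen prefixes lies in the fibre.\<close>
lemma closed_image_selection:
  fixes C :: "(nat \<Rightarrow> nat) set"
  assumes X: "Hausdorff_space X" and C: "closed C"
    and F: "continuous_map (top_of_set C) X F"
  obtains m where "m \<in> universal (borel_of X) \<rightarrow>\<^sub>M borel" "\<And>w. w \<in> F ` C \<Longrightarrow> m w \<in> C \<and> F (m w) = w"
proof -
  \<comment> \<open>Meaning that the first k coordinates of p extend to a point of the fibre over w.
    With this predicate \<open>lexmin\<close> gives every coordinate its least extendable
    value.\<close>
  define A where "A w p k \<longleftrightarrow> w \<in> F ` {\<sigma> \<in> C. \<forall>i<k. \<sigma> i = p i}" for w and p :: "nat \<Rightarrow> nat" and k
  define m where "m w k = lexmin A w (Suc k) k" for w k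
  have lex: "lexmin A w k i = m w i" if "i < k" for w k i
    using that by (induction k) (auto simp: m_def less_Suc_eq)
  have A_cong: "A w p k \<longleftrightarrow> A w q k" if "\<And>i. i < k \<Longrightarrow> p i = q i" for w p q k
    using that unfolding A_def by simp
  have A_step: "\<exists>j. A w (p(k := j)) (Suc k)" if "A w p k" for w p k
  proof -
    from that obtain \<sigma> where "\<sigma> \<in> C" "\<forall>i<k. \<sigma> i = p i" "w = F \<sigma>" by (auto simp: A_def)
    then show ?thesis unfolding A_def by (intro exI[of _ "\<sigma> k"] image_eqI[of _ _ \<sigma>]) (auto simp: less_Suc_eq)
  qed
  have A_lex: "A w (lexmin A w k) k" if "w \<in> F ` C" for w k
  proof (induction k)
    case 0
    then show ?case using that by (simp add: A_def)
  next
    case (Suc k)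
    show ?case using LeastI_ex[OF A_step[OF Suc]] by (simp only: lexmin.simps)
  qed
  have sel: "m w \<in> C \<and> F (m w) = w" if w: "w \<in> F ` C" for w
  proof -
    have "\<exists>\<sigma>. \<sigma> \<in> C \<and> F \<sigma> = w \<and> (\<forall>i<k. \<sigma> i = m w i)" for k
    proof -
      from A_lex[OF w, of k] obtain \<sigma> where "w = F \<sigma>" "\<sigma> \<in> {\<sigma> \<in> C. \<forall>i<k. \<sigma> i = lexmin A w k i}"
        unfolding A_def[of w "lexmin A w k" k] by (rule imageE)
      then show ?thesis using lex[of _ k w] by (intro exI[of _ \<sigma>]) simp
    qed
    then have "\<forall>k. \<exists>\<sigma>. \<sigma> \<in> C \<and> F \<sigma> = w \<and> (\<forall>i<k. \<sigma> i = m w i)" by (rule allI)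
    then have "\<exists>s. \<forall>k. s k \<in> C \<and> F (s k) = w \<and> (\<forall>i<k. s k i = m w i)" unfolding choice_iff .
    then obtain s where "\<forall>k. s k \<in> C \<and> F (s k) = w \<and> (\<forall>i<k. s k i = m w i)" ..
    then have s: "\<And>k. s k \<in> C" "\<And>k. F (s k) = w" "\<And>k i. i < k \<Longrightarrow> s k i = m w i" by simp_all
    have lim: "s \<longlonglongrightarrow> m w"
      by (rule baire_tendsto, rule eventually_mono[OF eventually_gt_at_top]) (rule s(3))
    have "closedin (top_of_set C) {\<sigma> \<in> topspace (top_of_set C). F \<sigma> \<in> {w}}"
      using w F by (intro closedin_continuous_map_preimage[OF F] closedin_Hausdorff_sing_eq[OF X, THEN iffD2])
        (auto simp: continuous_map_def)
    then have "closed {\<sigma> \<in> C. F \<sigma> = w}" using C by (simp add: closedin_closed_eq)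
    from closed_sequentially[OF this _ lim] s have "m w \<in> {\<sigma> \<in> C. F \<sigma> = w}" by simp
    then show ?thesis by simp
  qed
  let ?M = "universal (borel_of X)"
  \<comment> \<open>Fixing a prefix cuts out a smaller closed domain, so the points whose fibre
    admits that prefix form again a continuous image of a closed set.\<close>
  have A_meas: "{w \<in> space ?M. A w p k} \<in> sets ?M" for p k
  proof -
    let ?C = "C \<inter> {\<sigma>. \<forall>i<k. \<sigma> i \<in> {p i}}"
    have "closed ?C" by (intro closed_Int C closed_baire_cylinder)
    moreover have "continuous_map (top_of_set ?C) X F"
      using continuous_map_from_subtopology[OF F, of "{\<sigma>. \<forall>i<k. \<sigma> i \<in> {p i}}"] by (simp add: subtopology_subtopology)
    ultimately have "F ` ?C \<in> sets ?M" by (rule closed_image_universal[OF X])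
    moreover have "F ` ?C \<subseteq> space ?M" using F by (auto simp: continuous_map_def)
    moreover have "F ` {\<sigma> \<in> C. \<forall>i<k. \<sigma> i = p i} = F ` ?C" by (rule arg_cong) auto
    ultimately have "{w \<in> space ?M. A w p k} = F ` ?C" unfolding A_def by (intro equalityI subsetI) auto
    then show ?thesis using \<open>F ` ?C \<in> sets ?M\<close> by (simp only:)
  qed
  have m_meas: "(\<lambda>w. m w k) \<in> ?M \<rightarrow>\<^sub>M count_space UNIV" for k
  proof (induction k rule: less_induct)
    case (less k)
    have m_eq: "m w k = (LEAST j. A w ((m w)(k := j)) (Suc k))" for w
    proof -
      have "A w ((lexmin A w k)(k := j)) (Suc k) \<longleftrightarrow> A w ((m w)(k := j)) (Suc k)" for j
        by (rule A_cong) (auto simp: lex less_Suc_eq)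
      then show ?thesis by (simp add: m_def)
    qed
    have "Measurable.pred ?M (\<lambda>w. A w ((m w)(k := j)) (Suc k))" for j
    proof -
      \<comment> \<open>The prefix of \<open>m w\<close> depends on w. Splitting over the countably
        many lists of length k reduces each piece to one fixed prefix, to which
        \<open>A_meas\<close> applies.\<close>
      define q where "q xs = (\<lambda>i. if i < k then xs ! i else j)" for xs :: "nat list"
      have "A w ((m w)(k := j)) (Suc k) \<longleftrightarrow>
          (\<exists>xs. length xs = k \<and> (\<forall>i<k. m w i = xs ! i) \<and> A w (q xs) (Suc k))" for w
      proof
        assume a: "A w ((m w)(k := j)) (Suc k)"
        have "A w (q (map (m w) [0..<k])) (Suc k)"
          using a by (subst A_cong[where q="(m w)(k := j)"]) (auto simp: q_def less_Suc_eq)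
        then show "\<exists>xs. length xs = k \<and> (\<forall>i<k. m w i = xs ! i) \<and> A w (q xs) (Suc k)"
          by (intro exI[of _ "map (m w) [0..<k]"]) auto
      next
        assume "\<exists>xs. length xs = k \<and> (\<forall>i<k. m w i = xs ! i) \<and> A w (q xs) (Suc k)"
        then obtain xs where xs: "length xs = k" "\<forall>i<k. m w i = xs ! i" "A w (q xs) (Suc k)" by blast
        then show "A w ((m w)(k := j)) (Suc k)"
          by (subst A_cong[where q="q xs"]) (auto simp: q_def less_Suc_eq)
      qed
      moreover have "Measurable.pred ?M (\<lambda>w. \<exists>xs. length xs = k \<and> (\<forall>i<k. m w i = xs ! i) \<and> A w (q xs) (Suc k))"
      proof (intro pred_intros_countable)
        fix xs
        have "Measurable.pred ?M (\<lambda>w. m w i = xs ! i)" if "i \<in> {..<k}" for i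
          using less[of i] that by (intro pred_eq_const1) auto
        then have [measurable]: "Measurable.pred ?M (\<lambda>w. \<forall>i\<in>{..<k}. m w i = xs ! i)"
          by (intro pred_intros_finite) auto
        have [measurable]: "Measurable.pred ?M (\<lambda>w. A w (q xs) (Suc k))"
          unfolding pred_def by (rule A_meas)
        have "Measurable.pred ?M (\<lambda>w. length xs = k \<and> (\<forall>i\<in>{..<k}. m w i = xs ! i) \<and> A w (q xs) (Suc k))"
          by measurable
        then show "Measurable.pred ?M (\<lambda>w. length xs = k \<and> (\<forall>i<k. m w i = xs ! i) \<and> A w (q xs) (Suc k))"
          unfolding Ball_def lessThan_iff .
      qed
      ultimately show ?thesis by (simp only:)
    qed
    then show ?case unfolding m_eq by measurable
  qed
  have "m \<in> ?M \<rightarrow>\<^sub>M borel"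
  proof (rule measurable_coordinatewise_then_product)
    fix k
    have "(\<lambda>n :: nat. n) \<in> count_space UNIV \<rightarrow>\<^sub>M borel" by simp
    from measurable_compose[OF m_meas this] show "(\<lambda>w. m w k) \<in> ?M \<rightarrow>\<^sub>M borel" by simp
  qed
  with sel show ?thesis by (intro that) auto
qed

text \<open>A Borel domain is itself the image of a closed set under some h. Selecting for the
  composite of f and h and pushing the choice forward by h gives a selector with values in
  B.\<close>

theorem borel_image_selection:
  assumes X: "Hausdorff_space X" and f: "continuous_map baire_space X f"
    and B: "B \<in> sets (borel :: (nat \<Rightarrow> nat) measure)"
  obtains s where "f ` B \<in> sets (universal (borel_of X))"
    "s \<in> universal (borel_of X) \<rightarrow>\<^sub>M borel" "\<And>w. w \<in> f ` B \<Longrightarrow> s w \<in> B \<and> f (s w) = w"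
proof -
  have baire: "baire_space = euclidean"
    unfolding baire_space_def
    by (simp add: euclidean_product_topology[symmetric] euclidean_nat_discrete)
  obtain C and h :: "(nat \<Rightarrow> nat) \<Rightarrow> nat \<Rightarrow> nat" where C: "closed C" "continuous_on C h" "h ` C = B"
    using borel_imp_closed_image[OF B] by (auto simp: closed_image_def)
  have "continuous_map (top_of_set C) X (f \<circ> h)"
    using C(2) f unfolding baire by (intro continuous_map_compose) auto
  note sel = closed_image_universal[OF X C(1) this] closed_image_selection[OF X C(1) this]
  obtain m where m: "m \<in> universal (borel_of X) \<rightarrow>\<^sub>M borel"
    "\<And>w. w \<in> (f \<circ> h) ` C \<Longrightarrow> m w \<in> C \<and> (f \<circ> h) (m w) = w"
    using sel(2) by blast
  \<comment> \<open>Continuity of h is known on C only; a constant off the closed set C gives a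
    Borel map on the whole space.\<close>
  define h' where "h' \<sigma> = (if \<sigma> \<in> C then h \<sigma> else (\<lambda>_. 0))" for \<sigma>
  have "h' \<in> borel \<rightarrow>\<^sub>M borel"
    unfolding h'_def using C by (intro borel_measurable_continuous_on_if) auto
  show ?thesis
  proof (rule that)
    show "f ` B \<in> sets (universal (borel_of X))" using sel(1) unfolding image_comp[symmetric] C(3) .
    show "(\<lambda>w. h' (m w)) \<in> universal (borel_of X) \<rightarrow>\<^sub>M borel"
      using m(1) \<open>h' \<in> borel \<rightarrow>\<^sub>M borel\<close> by (rule measurable_compose)
    fix w assume "w \<in> f ` B"
    then have "w \<in> (f \<circ> h) ` C" unfolding image_comp[symmetric] C(3) .
    from m(2)[OF this] show "h' (m w) \<in> B \<and> f (h' (m w)) = w" using C(3) by (auto simp: h'_def)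
  qed
qed

lemma baire_space_eq: "baire_space = euclidean"
  unfolding baire_space_def
  by (simp add: euclidean_product_topology[symmetric] euclidean_nat_discrete)

subsection \<open>Measurable kernels from the weak topology\<close>

lemma topspace_weak_top: "topspace (weak_top X) = probs (borel_of X)"
proof
  show "topspace (weak_top X) \<subseteq> probs (borel_of X)" by (auto simp: weak_top_def)
  \<comment> \<open>The zero function with the open set \<open>UNIV\<close> exhibits the whole set
    of probabilities as a generator of the topology.\<close>
  have "probs (borel_of X) = {P \<in> probs (borel_of X). (\<integral>w. (0::real) \<partial>P) \<in> UNIV}" by simp
  then have "probs (borel_of X) \<in> {{P \<in> probs (borel_of X). (\<integral>w. f w \<partial>P) \<in> U} | f U.
        continuous_map X euclideanreal f \<and> bounded (f ` topspace X) \<and> open U}"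
    by (intro CollectI exI[of _ "\<lambda>_. 0"] exI[of _ UNIV]) (auto simp: bounded_iff)
  then show "probs (borel_of X) \<subseteq> topspace (weak_top X)"
    unfolding weak_top_def topology_generated_by_topspace by (rule Union_upper)
qed

lemma weak_top_integral_measurable:
  assumes p: "continuous_map baire_space (weak_top X) p"
    and g: "continuous_map X euclideanreal g" "bounded (g ` topspace X)"
  shows "(\<lambda>\<sigma>. \<integral>w. g w \<partial>p \<sigma>) \<in> borel_measurable borel"
proof (rule borel_measurableI)
  fix U :: "real set" assume U: "open U"
  let ?B = "{P \<in> probs (borel_of X). (\<integral>w. g w \<partial>P) \<in> U}"
  have "openin (weak_top X) ?B"
    unfolding weak_top_def by (rule topology_generated_by_Basis) (use g U in blast)
  with p have "openin baire_space {\<sigma> \<in> topspace baire_space. p \<sigma> \<in> ?B}"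
    by (rule openin_continuous_map_preimage)
  moreover have "p \<sigma> \<in> probs (borel_of X)" for \<sigma>
    using p by (auto simp: continuous_map_def topspace_weak_top baire_space_eq)
  ultimately have "open {\<sigma>. (\<integral>w. g w \<partial>p \<sigma>) \<in> U}" by (simp add: baire_space_eq)
  then show "(\<lambda>\<sigma>. \<integral>w. g w \<partial>p \<sigma>) -` U \<inter> space borel \<in> sets borel" by (simp add: vimage_def)
qed

text \<open>A closed set in a metrizable space is a decreasing intersection of open sets; Urysohn
  functions between the set and the complements of these open sets converge to its
  indicator.\<close>

lemma closedin_approx_continuous:
  assumes X: "metrizable_space X" and A: "closedin X A"
  obtains g :: "nat \<Rightarrow> 'a \<Rightarrow> real" where "\<And>n. continuous_map X euclideanreal (g n)"
    "\<And>n x. x \<in> topspace X \<Longrightarrow> g n x \<in> {0..1}"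
    "\<And>x. x \<in> topspace X \<Longrightarrow> (\<lambda>n. g n x) \<longlonglongrightarrow> indicator A x"
proof -
  obtain U where U: "\<And>n. openin X (U n)" "\<And>n. U (Suc n) \<subseteq> U n" "\<Inter>(range U) = A"
    using closed_imp_gdelta_in[OF X A] unfolding gdelta_in_descending by auto
  have "\<exists>f :: 'a \<Rightarrow> real. continuous_map X euclideanreal f \<and> (\<forall>x\<in>topspace X. f x \<in> {0..1}) \<and>
      (\<forall>x\<in>topspace X - U n. f x = 0) \<and> (\<forall>x\<in>A. f x = 1)" for n
  proof -
    have "disjnt (topspace X - U n) A" using U(3) by (auto simp: disjnt_def)
    moreover have "closedin X (topspace X - U n)" using U(1) by auto
    ultimately obtain f :: "'a \<Rightarrow> real" where f: "continuous_map X (top_of_set {0..1}) f"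
      "f ` (topspace X - U n) \<subseteq> {0}" "f ` A \<subseteq> {1}"
      using Urysohn_lemma[OF metrizable_imp_normal_space[OF X] _ A, of "topspace X - U n" 0 1] by auto
    then show ?thesis
      by (intro exI[of _ f]) (auto simp: continuous_map_in_subtopology image_subset_iff Pi_iff)
  qed
  then have "\<exists>f. \<forall>n. continuous_map X euclideanreal (f n) \<and> (\<forall>x\<in>topspace X. f n x \<in> {0..1::real}) \<and>
      (\<forall>x\<in>topspace X - U n. f n x = 0) \<and> (\<forall>x\<in>A. f n x = 1)" by (intro choice allI)
  then obtain g where g: "\<forall>n. continuous_map X euclideanreal (g n) \<and> (\<forall>x\<in>topspace X. g n x \<in> {0..1::real}) \<and>
      (\<forall>x\<in>topspace X - U n. g n x = 0) \<and> (\<forall>x\<in>A. g n x = 1)" ..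
  show ?thesis
  proof (rule that[of g])
    fix x assume x: "x \<in> topspace X"
    show "(\<lambda>n. g n x) \<longlonglongrightarrow> indicator A x"
    proof (cases "x \<in> A")
      case True
      with g show ?thesis by simp
    next
      case False
      then obtain N where N: "x \<notin> U N" using U(3) by auto
      have "x \<notin> U n" if "n \<ge> N" for n
        using N lift_Suc_antimono_le[of U, OF U(2) that] by auto
      then have "eventually (\<lambda>n. g n x = 0) sequentially"
        using g x by (intro eventually_sequentiallyI[of N]) simp
      with False show ?thesis by (simp add: tendsto_eventually)
    qed
  qed (use g in simp_all)
qed

text \<open>The weak topology controls integrals of bounded continuous functions. Limits of these
  give the masses of closed sets, and closed sets generate the Borel sets and are stable under
  intersection.\<close>

lemma weak_top_kernel_measurable:
  assumes X: "metrizable_space X" and p: "continuous_map baire_space (weak_top X) p"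
  shows "p \<in> borel \<rightarrow>\<^sub>M subprob_algebra (borel_of X)"
proof -
  have pp: "p \<sigma> \<in> probs (borel_of X)" for \<sigma>
    using p by (auto simp: continuous_map_def topspace_weak_top baire_space_eq)
  note pp' = probsD[OF pp]
  have closed: "(\<lambda>\<sigma>. emeasure (p \<sigma>) A) \<in> borel_measurable borel" if A: "closedin X A" for A
  proof -
    obtain g :: "nat \<Rightarrow> 'a \<Rightarrow> real" where g: "\<And>n. continuous_map X euclideanreal (g n)"
      "\<And>n x. x \<in> topspace X \<Longrightarrow> g n x \<in> {0..1}"
      "\<And>x. x \<in> topspace X \<Longrightarrow> (\<lambda>n. g n x) \<longlonglongrightarrow> indicator A x"
      using closedin_approx_continuous[OF X A] by blast
    have A': "A \<in> sets (p \<sigma>)" for \<sigma> using closedin_sets_borel_of[OF A] pp'(1) by simp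
    have "(\<lambda>\<sigma>. measure (p \<sigma>) A) \<in> borel_measurable borel"
    proof (rule borel_measurable_LIMSEQ_real)
      fix n
      have "bounded (g n ` topspace X)" using g(2)[of _ n] by (intro boundedI[of _ 1]) force
      with p g(1) show "(\<lambda>\<sigma>. \<integral>w. g n w \<partial>p \<sigma>) \<in> borel_measurable borel"
        by (rule weak_top_integral_measurable)
    next
      fix \<sigma>
      interpret prob_space "p \<sigma>" by (rule pp')
      have "(\<lambda>n. \<integral>w. g n w \<partial>p \<sigma>) \<longlonglongrightarrow> (\<integral>w. indicator A w \<partial>p \<sigma>)"
      proof (rule integral_dominated_convergence)
        show "g n \<in> borel_measurable (p \<sigma>)" for n
          using continuous_map_borel_measurable[OF g(1)] pp'(1) by (simp cong: measurable_cong_sets)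
        show "AE x in p \<sigma>. norm (g n x) \<le> 1" for n
          using g(2)[of _ n] pp'(2) by (intro AE_I2) auto
        show "AE x in p \<sigma>. (\<lambda>n. g n x) \<longlonglongrightarrow> indicator A x"
          using g(3) pp'(2) by (intro AE_I2) auto
      qed (use A' in auto)
      then show "(\<lambda>n. \<integral>w. g n w \<partial>p \<sigma>) \<longlonglongrightarrow> measure (p \<sigma>) A" using A' by simp
    qed
    moreover have "emeasure (p \<sigma>) A = ennreal (measure (p \<sigma>) A)" for \<sigma>
      by (rule finite_measure.emeasure_eq_measure) (rule prob_space.finite_measure[OF pp'(3)])
    ultimately show ?thesis by simp
  qed
  show ?thesis
  proof (rule measurable_subprob_algebra_generated[where G="{A. closedin X A}" and \<Omega>="topspace X"])
    show "sets (borel_of X) = sigma_sets (topspace X) {A. closedin X A}"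
    proof
      show "sigma_sets (topspace X) {A. closedin X A} \<subseteq> sets (borel_of X)"
        using sets.sigma_sets_subset[of "{A. closedin X A}" "borel_of X"] by (auto intro: closedin_sets_borel_of)
      have "U \<in> sigma_sets (topspace X) {A. closedin X A}" if "openin X U" for U
      proof -
        have "topspace X - (topspace X - U) \<in> sigma_sets (topspace X) {A. closedin X A}"
          using that by (intro sigma_sets.Compl sigma_sets.Basic) auto
        then show ?thesis using openin_subset[OF that] by (simp add: double_diff)
      qed
      then show "sets (borel_of X) \<subseteq> sigma_sets (topspace X) {A. closedin X A}"
        unfolding sets_borel_of by (intro sigma_sets_mono) auto
    qed
    show "Int_stable {A. closedin X A}" by (auto simp: Int_stable_def)
    show "{A. closedin X A} \<subseteq> Pow (topspace X)" by (auto dest: closedin_subset)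
    show "subprob_space (p \<sigma>)" for \<sigma> by (rule prob_space_imp_subprob_space[OF pp'(3)])
    show "sets (p \<sigma>) = sets (borel_of X)" for \<sigma> by (rule pp'(1))
  qed (auto intro: closed)
qed

lemma is_kernel_measurable:
  assumes "is_kernel Om t q"
  shows "q \<in> universal (OmM Om t) \<rightarrow>\<^sub>M subprob_algebra (borel_of (Om (Suc t)))"
proof (rule measurable_subprob_algebra)
  fix w assume "w \<in> space (universal (OmM Om t))"
  then have "q w \<in> probs (borel_of (Om (Suc t)))" using assms by (simp add: is_kernel_def)
  note probsD[OF this]
  then show "subprob_space (q w)" "sets (q w) = sets (borel_of (Om (Suc t)))"
    by (simp_all add: prob_space_imp_subprob_space)
qed (use assms in \<open>auto simp: is_kernel_def univ_meas_iff\<close>)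

lemma kernel_extend_measurable:
  assumes sc: "\<forall>i\<in>{1..Suc t}. second_countable (Om i)"
    and f: "f \<in> N \<rightarrow>\<^sub>M OmM Om t" and k: "k \<in> N \<rightarrow>\<^sub>M subprob_algebra (borel_of (Om (Suc t)))"
  shows "(\<lambda>x. distr (k x) (OmM Om (Suc t)) (\<lambda>y. (f x)(Suc t := y))) \<in> N \<rightarrow>\<^sub>M subprob_algebra (OmM Om (Suc t))"
proof (rule measurable_distr2[OF _ k])
  have "(\<lambda>z. (f (fst z))(Suc t := snd z)) \<in> N \<Otimes>\<^sub>M borel_of (Om (Suc t)) \<rightarrow>\<^sub>M OmM Om (Suc t)"
    by (rule measurable_OmM_extend[OF sc measurable_compose[OF measurable_fst f] measurable_snd])
  then show "(\<lambda>(x, y). (f x)(Suc t := y)) \<in> N \<Otimes>\<^sub>M borel_of (Om (Suc t)) \<rightarrow>\<^sub>M OmM Om (Suc t)"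
    by (simp add: case_prod_beta')
qed

lemma measurable_fun_upd_section:
  assumes sc: "\<forall>i\<in>{1..Suc t}. second_countable (Om i)" and w: "w \<in> space (OmM Om t)"
  shows "(\<lambda>y. w(Suc t := y)) \<in> borel_of (Om (Suc t)) \<rightarrow>\<^sub>M OmM Om (Suc t)"
  using measurable_OmM_extend[OF sc measurable_const[OF w] measurable_ident_sets[OF refl]] .

lemma emeasure_distr_section:
  assumes sc: "\<forall>i\<in>{1..Suc t}. second_countable (Om i)" and w: "w \<in> space (OmM Om t)"
    and Q: "sets Q = sets (borel_of (Om (Suc t)))" and E: "E \<in> sets (OmM Om (Suc t))"
  shows "emeasure (distr Q (OmM Om (Suc t)) (\<lambda>y. w(Suc t := y))) E
    = emeasure Q {y \<in> topspace (Om (Suc t)). w(Suc t := y) \<in> E}"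
proof -
  have "(\<lambda>y. w(Suc t := y)) \<in> Q \<rightarrow>\<^sub>M OmM Om (Suc t)"
    using measurable_fun_upd_section[OF sc w] Q by (simp cong: measurable_cong_sets)
  then have "emeasure (distr Q (OmM Om (Suc t)) (\<lambda>y. w(Suc t := y))) E
    = emeasure Q ((\<lambda>y. w(Suc t := y)) -` E \<inter> space Q)" using E by (rule emeasure_distr)
  also have "(\<lambda>y. w(Suc t := y)) -` E \<inter> space Q = {y \<in> topspace (Om (Suc t)). w(Suc t := y) \<in> E}"
    using sets_eq_imp_space_eq[OF Q] by auto
  finally show ?thesis .
qed

definition charged :: "(nat \<Rightarrow> 'a topology) \<Rightarrow> nat \<Rightarrow> (nat \<Rightarrow> 'a) \<Rightarrow> (nat \<Rightarrow> 'a) set \<Rightarrow> 'a measure \<Rightarrow> bool" where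
  "charged Om t w E Q \<longleftrightarrow> emeasure Q {y \<in> topspace (Om (Suc t)). w(Suc t := y) \<in> E} > 0"

text \<open>The graph is a continuous image of Baire space, with components \<open>\<omega>\<close>
  for the path and \<open>p\<close> for the model. Codes whose model charges the section of E form a
  Borel set, and its image under \<open>\<omega>\<close> is the set of paths with a charging model.
  A selector of codes, followed by \<open>p\<close>, is the kernel.\<close>

lemma charging_kernel_exists:
  fixes Om :: "nat \<Rightarrow> 'a topology"
  assumes pol: "\<forall>i\<in>{1..Suc t}. Polish_space (Om i)"
    and QR: "\<forall>w\<in>space (OmM Om t). QR w \<noteq> {} \<and> QR w \<subseteq> probs (borel_of (Om (Suc t)))"
    and ne: "space (OmM Om t) \<noteq> {}"
    and an: "analytic_in (prod_topology (OmT Om t) (weak_top (Om (Suc t)))) {(w, P). w \<in> topspace (OmT Om t) \<and> P \<in> QR w}"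
    and E: "E \<in> sets (OmM Om (Suc t))"
  shows "{w \<in> space (OmM Om t). \<exists>P\<in>QR w. charged Om t w E P} \<in> sets (universal (OmM Om t))"
    "\<exists>q. is_kernel Om t q \<and> (\<forall>w\<in>space (OmM Om t). q w \<in> QR w \<and>
      (\<forall>P\<in>QR w. charged Om t w E P \<longrightarrow> charged Om t w E (q w)))"
proof -
  let ?G = "{(w, P). w \<in> topspace (OmT Om t) \<and> P \<in> QR w}"
  have sc: "\<forall>i\<in>{1..Suc t}. second_countable (Om i)" using pol Polish_space_second_countable by blast
  have sp: "space (OmM Om t) = topspace (OmT Om t)" by (simp add: OmM_def)
  have "?G \<noteq> {}" using ne QR unfolding sp by blast
  with an obtain f where f: "continuous_map baire_space (prod_topology (OmT Om t) (weak_top (Om (Suc t)))) f"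
    "f ` topspace baire_space = ?G" unfolding analytic_in_def by blast
  have tb: "topspace baire_space = UNIV" by (simp add: baire_space_eq)
  define \<omega> where "\<omega> = fst \<circ> f"
  define p where "p = snd \<circ> f"
  have c\<omega>: "continuous_map baire_space (OmT Om t) \<omega>" and cp: "continuous_map baire_space (weak_top (Om (Suc t))) p"
    using f(1) unfolding \<omega>_def p_def by (auto simp: continuous_map_pairwise)
  have graph: "\<omega> \<sigma> \<in> space (OmM Om t)" "p \<sigma> \<in> QR (\<omega> \<sigma>)" for \<sigma>
  proof -
    have "f \<sigma> \<in> f ` topspace baire_space" by (rule imageI) (simp add: tb)
    then have "f \<sigma> \<in> ?G" unfolding f(2) .
    then show "\<omega> \<sigma> \<in> space (OmM Om t)" "p \<sigma> \<in> QR (\<omega> \<sigma>)" unfolding sp \<omega>_def p_def by auto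
  qed
  have surj: "\<exists>\<sigma>. \<omega> \<sigma> = w \<and> p \<sigma> = P" if "w \<in> space (OmM Om t)" "P \<in> QR w" for w P
  proof -
    have "(w, P) \<in> f ` topspace baire_space" unfolding f(2) using that sp by simp
    then obtain \<sigma> where e: "(w, P) = f \<sigma>" by (rule imageE)
    have "\<omega> \<sigma> = w \<and> p \<sigma> = P" unfolding \<omega>_def p_def comp_def e[symmetric] by simp
    then show ?thesis by (rule exI[of _ \<sigma>])
  qed
  have "metrizable_space (Om (Suc t))" using pol by (intro Polish_space_metrizable) auto
  note pm = weak_top_kernel_measurable[OF this cp]
  have \<omega>m: "\<omega> \<in> borel \<rightarrow>\<^sub>M OmM Om t"
    using continuous_map_measurable_borel_of[OF c\<omega>] by (simp add: baire_space_eq borel_of_euclidean OmM_def)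
  have pprob: "p \<sigma> \<in> probs (borel_of (Om (Suc t)))" for \<sigma> using graph[of \<sigma>] QR by blast
  define B where "B = {\<sigma>. emeasure (distr (p \<sigma>) (OmM Om (Suc t)) (\<lambda>y. (\<omega> \<sigma>)(Suc t := y))) E > 0}"
  have "(\<lambda>\<sigma>. emeasure (distr (p \<sigma>) (OmM Om (Suc t)) (\<lambda>y. (\<omega> \<sigma>)(Suc t := y))) E) \<in> borel_measurable borel"
    by (rule measurable_emeasure_kernel[OF kernel_extend_measurable[OF sc \<omega>m pm] E])
  then have B: "B \<in> sets borel" unfolding B_def by measurable
  have B_iff: "\<sigma> \<in> B \<longleftrightarrow> charged Om t (\<omega> \<sigma>) E (p \<sigma>)" for \<sigma>
    unfolding B_def charged_def
    using emeasure_distr_section[OF sc graph(1) probsD(1)[OF pprob] E, of \<sigma> \<sigma>] by simp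
  have haus: "Hausdorff_space (OmT Om t)"
    unfolding OmT_def Hausdorff_space_product_topology
    using pol by (intro disjI2 ballI metrizable_imp_Hausdorff_space Polish_space_metrizable) auto
  obtain s where s: "\<omega> ` B \<in> sets (universal (OmM Om t))" "s \<in> universal (OmM Om t) \<rightarrow>\<^sub>M borel"
    "\<And>w. w \<in> \<omega> ` B \<Longrightarrow> s w \<in> B \<and> \<omega> (s w) = w"
    using borel_image_selection[OF haus c\<omega> B] unfolding OmM_def by blast
  obtain s0 where s0: "s0 \<in> universal (OmM Om t) \<rightarrow>\<^sub>M borel" "\<And>w. w \<in> \<omega> ` UNIV \<Longrightarrow> \<omega> (s0 w) = w"
    using borel_image_selection[OF haus c\<omega>, of UNIV] unfolding OmM_def by (metis sets.top space_borel)
  have onto: "w \<in> \<omega> ` UNIV" if "w \<in> space (OmM Om t)" for w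
    using QR that surj by blast
  have hit: "{w \<in> space (OmM Om t). \<exists>P\<in>QR w. charged Om t w E P} = \<omega> ` B"
  proof (intro equalityI subsetI)
    fix w assume "w \<in> {w \<in> space (OmM Om t). \<exists>P\<in>QR w. charged Om t w E P}"
    then obtain P where wP: "w \<in> space (OmM Om t)" "P \<in> QR w" "charged Om t w E P" by blast
    from surj[OF wP(1,2)] obtain \<sigma> where "\<omega> \<sigma> = w" "p \<sigma> = P" by blast
    with wP(3) B_iff[of \<sigma>] show "w \<in> \<omega> ` B" by blast
  next
    fix w assume "w \<in> \<omega> ` B"
    then obtain \<sigma> where "w = \<omega> \<sigma>" "\<sigma> \<in> B" by blast
    then show "w \<in> {w \<in> space (OmM Om t). \<exists>P\<in>QR w. charged Om t w E P}"
      using B_iff[of \<sigma>] graph[of \<sigma>] by auto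
  qed
  \<comment> \<open>On paths where some model charges E the code is taken from B; on the others any
    code above the path will do, since the kernel must still take values in
    \<open>QR\<close>.\<close>
  define r where "r w = (if w \<in> \<omega> ` B then s w else s0 w)" for w
  have rm: "r \<in> universal (OmM Om t) \<rightarrow>\<^sub>M borel"
    unfolding r_def using s(2) s0(1) sets.Int[OF s(1) sets.top] by (rule measurable_If_set)
  have \<omega>r: "\<omega> (r w) = w" if "w \<in> space (OmM Om t)" for w
    using s(3)[of w] s0(2)[OF onto[OF that]] by (simp add: r_def)
  show "{w \<in> space (OmM Om t). \<exists>P\<in>QR w. charged Om t w E P} \<in> sets (universal (OmM Om t))"
    unfolding hit by (rule s(1))
  show "\<exists>q. is_kernel Om t q \<and> (\<forall>w\<in>space (OmM Om t). q w \<in> QR w \<and>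
      (\<forall>P\<in>QR w. charged Om t w E P \<longrightarrow> charged Om t w E (q w)))"
  proof (intro exI[of _ "p \<circ> r"] conjI ballI impI)
    show "(p \<circ> r) w \<in> QR w" if "w \<in> space (OmM Om t)" for w
      using graph(2)[of "r w"] \<omega>r[OF that] by simp
    have "(\<lambda>w. emeasure ((p \<circ> r) w) A) \<in> borel_measurable (universal (OmM Om t))"
      if "A \<in> sets (borel_of (Om (Suc t)))" for A
      using measurable_emeasure_kernel[OF measurable_compose[OF rm pm] that] by simp
    then show "is_kernel Om t (p \<circ> r)"
      unfolding is_kernel_def univ_meas_iff using pprob by simp
    fix w P assume wP: "w \<in> space (OmM Om t)" "P \<in> QR w" "charged Om t w E P"
    then have w: "w \<in> \<omega> ` B" unfolding hit[symmetric] by blast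
    note sw = conjunct1[OF s(3)[OF w]] conjunct2[OF s(3)[OF w]]
    from w have "(p \<circ> r) w = p (s w)" by (simp only: comp_apply r_def if_True)
    with sw(1)[unfolded B_iff[of "s w"] sw(2)] show "charged Om t w E ((p \<circ> r) w)" by (simp only:)
  qed
qed

subsection \<open>Products with kernels\<close>

text \<open>Recognising the product as a monadic bind gives access to the theory of kernels. The
  base measure is completed because a kernel is only universally measurable in the path.\<close>

lemma kprod_eq_bind:
  assumes sc: "\<forall>i\<in>{1..Suc t}. second_countable (Om i)"
    and P: "P \<in> probs (OmM Om t)" and q: "is_kernel Om t q"
  shows "(\<lambda>w. distr (q w) (OmM Om (Suc t)) (\<lambda>y. w(Suc t := y))) \<in> completion P \<rightarrow>\<^sub>M subprob_algebra (OmM Om (Suc t))"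
    "kprod Om t P q = completion P \<bind> (\<lambda>w. distr (q w) (OmM Om (Suc t)) (\<lambda>y. w(Suc t := y)))"
    "kprod Om t P q \<in> probs (OmM Om (Suc t))"
proof -
  note P' = probsD[OF P]
  have qw: "q w \<in> probs (borel_of (Om (Suc t)))" if "w \<in> space (OmM Om t)" for w
    using q that by (simp add: is_kernel_def)
  let ?K = "\<lambda>w. distr (q w) (OmM Om (Suc t)) (\<lambda>y. w(Suc t := y))"
  have qm: "q \<in> completion P \<rightarrow>\<^sub>M subprob_algebra (borel_of (Om (Suc t)))"
    by (rule measurable_univ_completion[OF is_kernel_measurable[OF q] P])
  have "(\<lambda>w. w) \<in> completion P \<rightarrow>\<^sub>M OmM Om t"
    by (intro measurable_completion measurable_ident_sets P')
  from kernel_extend_measurable[OF sc this qm]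
  show K: "?K \<in> completion P \<rightarrow>\<^sub>M subprob_algebra (OmM Om (Suc t))" .
  have ne: "space (completion P) \<noteq> {}" using prob_space.not_empty[OF P'(3)] by simp
  have sets: "sets (completion P \<bind> ?K) = sets (OmM Om (Suc t))" by (rule sets_bind[OF sets_kernel[OF K] ne])
  note space = sets_eq_imp_space_eq[OF sets]
  have em: "(\<integral>\<^sup>+ w. (\<integral>\<^sup>+ y. indicator A (w(Suc t := y)) \<partial>(q w)) \<partial>(completion P)) = emeasure (completion P \<bind> ?K) A"
    if A: "A \<in> sets (OmM Om (Suc t))" for A
  proof -
    have "(\<integral>\<^sup>+ y. indicator A (w(Suc t := y)) \<partial>(q w)) = emeasure (?K w) A"
      if "w \<in> space (completion P)" for w
    proof -
      have w: "w \<in> space (OmM Om t)" using that P'(2) by simp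
      have "(\<lambda>y. w(Suc t := y)) \<in> q w \<rightarrow>\<^sub>M OmM Om (Suc t)"
        using measurable_fun_upd_section[OF sc w] probsD(1)[OF qw[OF w]] by (simp cong: measurable_cong_sets)
      from nn_integral_distr[OF this, of "indicator A"] A show ?thesis by simp
    qed
    then have "(\<integral>\<^sup>+ w. (\<integral>\<^sup>+ y. indicator A (w(Suc t := y)) \<partial>(q w)) \<partial>(completion P)) = (\<integral>\<^sup>+ w. emeasure (?K w) A \<partial>completion P)"
      by (rule nn_integral_cong)
    also have "\<dots> = emeasure (completion P \<bind> ?K) A" by (rule emeasure_bind[OF ne K A, symmetric])
    finally show ?thesis .
  qed
  have "kprod Om t P q = measure_of (space (OmM Om (Suc t))) (sets (OmM Om (Suc t))) (emeasure (completion P \<bind> ?K))"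
    unfolding kprod_def
  proof (rule measure_of_eq)
    show "sets (OmM Om (Suc t)) \<subseteq> Pow (space (OmM Om (Suc t)))" by (rule sets.space_closed)
    fix A assume "A \<in> sigma_sets (space (OmM Om (Suc t))) (sets (OmM Om (Suc t)))"
    then have "A \<in> sets (OmM Om (Suc t))" by (simp only: sets.sigma_sets_eq)
    then show "(\<integral>\<^sup>+ w. (\<integral>\<^sup>+ y. indicator A (w(Suc t := y)) \<partial>(q w)) \<partial>(completion P)) = emeasure (completion P \<bind> ?K) A"
      by (rule em)
  qed
  also have "\<dots> = completion P \<bind> ?K"
    unfolding sets[symmetric] space[symmetric] by (rule measure_of_of_measure)
  finally show eq: "kprod Om t P q = completion P \<bind> ?K" .
  have "prob_space (completion P \<bind> ?K)"
  proof (rule prob_spaceI)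
    have "emeasure (completion P \<bind> ?K) (space (OmM Om (Suc t))) = (\<integral>\<^sup>+ w. emeasure (?K w) (space (OmM Om (Suc t))) \<partial>completion P)"
      by (rule emeasure_bind[OF ne K]) simp
    also have "\<dots> = (\<integral>\<^sup>+ w. 1 \<partial>completion P)"
    proof (rule nn_integral_cong)
      fix w assume "w \<in> space (completion P)"
      then have w: "w \<in> space (OmM Om t)" using P'(2) by simp
      have "(\<lambda>y. w(Suc t := y)) \<in> q w \<rightarrow>\<^sub>M OmM Om (Suc t)"
        using measurable_fun_upd_section[OF sc w] probsD(1)[OF qw[OF w]] by (simp cong: measurable_cong_sets)
      then have "prob_space (?K w)" by (rule prob_space.prob_space_distr[OF probsD(3)[OF qw[OF w]]])
      from prob_space.emeasure_space_1[OF this] show "emeasure (?K w) (space (OmM Om (Suc t))) = 1" by simp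
    qed
    also have "\<dots> = 1" using prob_space.emeasure_space_1[OF prob_space.prob_space_completion[OF P'(3)]] by simp
    finally show "emeasure (completion P \<bind> ?K) (space (completion P \<bind> ?K)) = 1" unfolding space .
  qed
  then show "kprod Om t P q \<in> probs (OmM Om (Suc t))" unfolding eq probs_def using sets by simp
qed

lemma AE_kprod:
  assumes sc: "\<forall>i\<in>{1..Suc t}. second_countable (Om i)"
    and P: "P \<in> probs (OmM Om t)" and q: "is_kernel Om t q"
    and Q: "Measurable.pred (OmM Om (Suc t)) Q"
  shows "(AE v in kprod Om t P q. Q v) \<longleftrightarrow> (AE w in P. AE y in q w. Q (w(Suc t := y)))"
proof -
  have "(AE v in kprod Om t P q. Q v) \<longleftrightarrow>
      (AE w in completion P. AE v in distr (q w) (OmM Om (Suc t)) (\<lambda>y. w(Suc t := y)). Q v)"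
    unfolding kprod_eq_bind(2)[OF sc P q] by (rule AE_bind[OF kprod_eq_bind(1)[OF sc P q] Q])
  also have "\<dots> \<longleftrightarrow> (AE w in completion P. AE y in q w. Q (w(Suc t := y)))"
  proof (rule AE_cong)
    fix w assume "w \<in> space (completion P)"
    then have w: "w \<in> space (OmM Om t)" using probsD(2)[OF P] by simp
    then have qw: "q w \<in> probs (borel_of (Om (Suc t)))" using q by (simp add: is_kernel_def)
    have "(\<lambda>y. w(Suc t := y)) \<in> q w \<rightarrow>\<^sub>M OmM Om (Suc t)"
      using measurable_fun_upd_section[OF sc w] probsD(1)[OF qw] by (simp cong: measurable_cong_sets)
    then show "(AE v in distr (q w) (OmM Om (Suc t)) (\<lambda>y. w(Suc t := y)). Q v) \<longleftrightarrow> (AE y in q w. Q (w(Suc t := y)))"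
      by (rule AE_distr_iff) (use Q in \<open>simp add: pred_def\<close>)
  qed
  finally show ?thesis by (simp only: AE_completion_iff)
qed

text \<open>The Fubini criterion for Borel predicates extends to universally measurable ones: a
  Borel part of the exceptional set is tested by sections, and what remains is null by
  construction.\<close>

lemma AE_kprodI:
  assumes sc: "\<forall>i\<in>{1..Suc t}. second_countable (Om i)"
    and P: "P \<in> probs (OmM Om t)" and q: "is_kernel Om t q"
    and Q: "{v \<in> space (OmM Om (Suc t)). \<not> Q v} \<in> sets (universal (OmM Om (Suc t)))"
    and AE: "AE w in P. AE y in q w. Q (w(Suc t := y))"
  shows "AE v in kprod Om t P q. Q v"
proof -
  note kp = kprod_eq_bind(3)[OF sc P q]
  obtain B N where B: "B \<in> sets (OmM Om (Suc t))" "B \<subseteq> {v \<in> space (OmM Om (Suc t)). \<not> Q v}"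
    "N \<in> null_sets (kprod Om t P q)" "{v \<in> space (OmM Om (Suc t)). \<not> Q v} - B \<subseteq> N"
    by (rule univ_inner_approx[OF Q kp])
  have m: "Measurable.pred (OmM Om (Suc t)) (\<lambda>v. v \<notin> B)" using B(1) by measurable
  have "AE w in P. AE y in q w. w(Suc t := y) \<notin> B"
    using AE by (rule eventually_mono) (erule eventually_mono, use B(2) in blast)
  then have "AE v in kprod Om t P q. v \<notin> B" by (rule AE_kprod[OF sc P q m, THEN iffD2])
  moreover have "AE v in kprod Om t P q. v \<notin> N" using B(3) by (rule AE_not_in)
  moreover have "AE v in kprod Om t P q. v \<in> space (OmM Om (Suc t))"
    using probsD(2)[OF kp] by (intro AE_I2) simp
  ultimately show ?thesis by eventually_elim (use B(4) in blast)
qed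

lemma distr_kprod_restrict:
  assumes sc: "\<forall>i\<in>{1..Suc t}. second_countable (Om i)"
    and P: "P \<in> probs (OmM Om t)" and q: "is_kernel Om t q"
  shows "distr (kprod Om t P q) (OmM Om t) (\<lambda>v. restrict v {1..t}) = P"
proof (rule measure_eqI)
  note P' = probsD[OF P]
  note kp = kprod_eq_bind(3)[OF sc P q]
  show "sets (distr (kprod Om t P q) (OmM Om t) (\<lambda>v. restrict v {1..t})) = sets P" using P' by simp
  fix A assume "A \<in> sets (distr (kprod Om t P q) (OmM Om t) (\<lambda>v. restrict v {1..t}))"
  then have A: "A \<in> sets (OmM Om t)" by simp
  have rm: "(\<lambda>v. restrict v {1..t}) \<in> kprod Om t P q \<rightarrow>\<^sub>M OmM Om t"
    using measurable_OmM_restrict[of t "Suc t" Om] probsD(1)[OF kp] by (simp cong: measurable_cong_sets)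
  let ?E = "{v \<in> space (OmM Om (Suc t)). restrict v {1..t} \<in> A}"
  have E: "?E \<in> sets (OmM Om (Suc t))"
    using rect_sets[OF A, of "topspace (Om (Suc t))"] measurable_sets[OF measurable_OmM_restrict[of t "Suc t" Om] A]
    by (simp add: vimage_def Int_def conj_commute)
  have "emeasure (distr (kprod Om t P q) (OmM Om t) (\<lambda>v. restrict v {1..t})) A = emeasure (kprod Om t P q) ?E"
    using emeasure_distr[OF rm A] probsD(2)[OF kp] by (simp add: vimage_def Int_def conj_commute)
  also have "\<dots> = (\<integral>\<^sup>+ w. emeasure (distr (q w) (OmM Om (Suc t)) (\<lambda>y. w(Suc t := y))) ?E \<partial>completion P)"
    unfolding kprod_eq_bind(2)[OF sc P q]
    by (rule emeasure_bind[OF _ kprod_eq_bind(1)[OF sc P q] E]) (use prob_space.not_empty[OF P'(3)] in simp)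
  also have "\<dots> = (\<integral>\<^sup>+ w. indicator A w \<partial>completion P)"
  proof (rule nn_integral_cong)
    fix w assume "w \<in> space (completion P)"
    then have w: "w \<in> space (OmM Om t)" using P'(2) by simp
    then have qw: "q w \<in> probs (borel_of (Om (Suc t)))" using q by (simp add: is_kernel_def)
    have "emeasure (distr (q w) (OmM Om (Suc t)) (\<lambda>y. w(Suc t := y))) ?E
        = emeasure (q w) {y \<in> topspace (Om (Suc t)). w(Suc t := y) \<in> ?E}"
      by (rule emeasure_distr_section[OF sc w probsD(1)[OF qw] E])
    also have "{y \<in> topspace (Om (Suc t)). w(Suc t := y) \<in> ?E} = (if w \<in> A then space (q w) else {})"
      using OmM_extend[OF w] probsD(2)[OF qw] by (simp add: Collect_conv_if2 cong: conj_cong)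
    also have "emeasure (q w) \<dots> = indicator A w"
      using prob_space.emeasure_space_1[OF probsD(3)[OF qw]] by (simp add: indicator_def)
    finally show "emeasure (distr (q w) (OmM Om (Suc t)) (\<lambda>y. w(Suc t := y))) ?E = indicator A w" .
  qed
  also have "\<dots> = emeasure P A" using A P'(1) by (simp add: nn_integral_completion)
  finally show "emeasure (distr (kprod Om t P q) (OmM Om t) (\<lambda>v. restrict v {1..t})) A = emeasure P A" .
qed

section \<open>Marginals and extensions of models\<close>

lemma QQ_subset_probs:
  "\<forall>i\<in>{1..t}. second_countable (Om i) \<Longrightarrow> QQ Om QR t \<subseteq> probs (OmM Om t)"
proof (induction t)
  case 0
  have "(\<lambda>_. undefined) \<in> space (OmM Om 0)" by (simp add: space_OmM)
  then show ?case by (simp add: probs_def prob_space_return)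
next
  case (Suc t)
  have "QQ Om QR t \<subseteq> probs (OmM Om t)" by (rule Suc.IH) (use Suc.prems in force)
  then show ?case using kprod_eq_bind(3)[OF Suc.prems] by force
qed

lemma QQ_marginal:
  assumes "\<forall>i\<in>{1..t}. second_countable (Om i)" "s \<le> t" "P \<in> QQ Om QR t"
  shows "distr P (OmM Om s) (\<lambda>v. restrict v {1..s}) \<in> QQ Om QR s"
  using assms
proof (induction t arbitrary: P)
  case 0
  then have P: "P = return (OmM Om 0) (\<lambda>_. undefined)" and [simp]: "s = 0" by auto
  have "distr P (OmM Om 0) (\<lambda>v. restrict v {1..0}) = distr P (OmM Om 0) (\<lambda>v. \<lambda>_. undefined)"
    by (rule distr_cong) (simp_all add: fun_eq_iff)
  also have "\<dots> = return (OmM Om 0) (\<lambda>_. undefined)" unfolding P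
    by (rule distr_return) (auto simp: space_OmM)
  finally show ?case by (simp only: \<open>s = 0\<close> QQ.simps singleton_iff)
next
  case (Suc t)
  have PS: "P \<in> probs (OmM Om (Suc t))" using QQ_subset_probs[OF Suc.prems(1)] Suc.prems(3) by blast
  show ?case
  proof (cases "s = Suc t")
    case True
    have "distr P (OmM Om s) (\<lambda>v. restrict v {1..s}) = distr P P (\<lambda>v. v)"
    proof (rule distr_cong)
      show "restrict v {1..s} = v" if "v \<in> space P" for v
        using that OmM_restrict(2)[of v Om "Suc t"] probsD(2)[OF PS] True by simp
    qed (use probsD[OF PS] True in simp_all)
    also have "distr P P (\<lambda>v. v) = P" by (rule distr_id2) simp
    finally show ?thesis using Suc.prems(3) unfolding True by (simp only:)
  next
    case False
    then have "s \<le> t" using Suc.prems by simp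
    obtain P0 q where P0: "P = kprod Om t P0 q" "P0 \<in> QQ Om QR t" "is_kernel Om t q"
      using Suc.prems(3) by auto
    have sct: "\<forall>i\<in>{1..t}. second_countable (Om i)" using Suc.prems(1) by force
    have P0p: "P0 \<in> probs (OmM Om t)" using P0 QQ_subset_probs[OF sct] by blast
    have rm: "(\<lambda>v. restrict v {1..t}) \<in> P \<rightarrow>\<^sub>M OmM Om t"
      using measurable_OmM_restrict[of t "Suc t" Om] probsD(1)[OF PS] by (simp cong: measurable_cong_sets)
    have "distr P0 (OmM Om s) (\<lambda>v. restrict v {1..s}) \<in> QQ Om QR s"
      by (rule Suc.IH[OF sct \<open>s \<le> t\<close> P0(2)])
    also have "distr P0 (OmM Om s) (\<lambda>v. restrict v {1..s})
      = distr (distr P (OmM Om t) (\<lambda>v. restrict v {1..t})) (OmM Om s) (\<lambda>v. restrict v {1..s})"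
      unfolding P0(1) distr_kprod_restrict[OF Suc.prems(1) P0p P0(3)] ..
    also have "\<dots> = distr P (OmM Om s) ((\<lambda>v. restrict v {1..s}) \<circ> (\<lambda>v. restrict v {1..t}))"
      by (rule distr_distr[OF measurable_OmM_restrict[OF \<open>s \<le> t\<close>] rm])
    also have "(\<lambda>v. restrict v {1..s}) \<circ> (\<lambda>v. restrict v {1..t}) = (\<lambda>v. restrict v {1..s})"
      by (rule ext) (simp only: comp_apply restrict_restrict_le[OF \<open>s \<le> t\<close>])
    finally show ?thesis .
  qed
qed

text \<open>Appending kernels with values in the model sets keeps the marginal at t. This lets
  quasi-sure statements about horizon T be read off at earlier times.\<close>

lemma QQ_extension:
  assumes sc: "\<forall>i\<in>{1..T}. second_countable (Om i)"
    and ker: "\<And>t. t < T \<Longrightarrow> \<exists>q. is_kernel Om t q \<and> (\<forall>w\<in>space (OmM Om t). q w \<in> QR (Suc t) w)"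
    and P: "P \<in> QQ Om QR t" and "t \<le> T"
  shows "\<exists>P'\<in>QQ Om QR T. distr P' (OmM Om t) (\<lambda>v. restrict v {1..t}) = P"
  using \<open>t \<le> T\<close>
proof (induction rule: dec_induct)
  case base
  have PS: "P \<in> probs (OmM Om t)" using QQ_subset_probs[of t Om QR] P sc \<open>t \<le> T\<close> by force
  have "distr P (OmM Om t) (\<lambda>v. restrict v {1..t}) = distr P P (\<lambda>v. v)"
  proof (rule distr_cong)
    show "restrict v {1..t} = v" if "v \<in> space P" for v
      using that OmM_restrict(2)[of v Om t] probsD(2)[OF PS] by simp
  qed (use probsD[OF PS] in simp_all)
  also have "distr P P (\<lambda>v. v) = P" by (rule distr_id2) simp
  finally show ?case using P by (rule bexI)
next
  case (step n)
  then obtain P' where P': "P' \<in> QQ Om QR n" "distr P' (OmM Om t) (\<lambda>v. restrict v {1..t}) = P" by blast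
  obtain q where q: "is_kernel Om n q" "\<forall>w\<in>space (OmM Om n). q w \<in> QR (Suc n) w" using ker[OF step(2)] by blast
  have scn: "\<forall>i\<in>{1..Suc n}. second_countable (Om i)" using sc step(2) by force
  have P'p: "P' \<in> probs (OmM Om n)" using P'(1) QQ_subset_probs[of n Om QR] scn by force
  let ?P = "kprod Om n P' q"
  have "AE w in completion P'. q w \<in> QR (Suc n) w" using q(2) probsD(2)[OF P'p] by (intro AE_I2) simp
  then have "?P \<in> QQ Om QR (Suc n)" using P'(1) q(1) by auto
  moreover have "distr ?P (OmM Om t) (\<lambda>v. restrict v {1..t}) = P"
  proof -
    have rm: "(\<lambda>v. restrict v {1..n}) \<in> ?P \<rightarrow>\<^sub>M OmM Om n"
      using measurable_OmM_restrict[of n "Suc n" Om] probsD(1)[OF kprod_eq_bind(3)[OF scn P'p q(1)]]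
      by (simp cong: measurable_cong_sets)
    have "P = distr (distr ?P (OmM Om n) (\<lambda>v. restrict v {1..n})) (OmM Om t) (\<lambda>v. restrict v {1..t})"
      unfolding distr_kprod_restrict[OF scn P'p q(1)] P'(2) ..
    also have "\<dots> = distr ?P (OmM Om t) ((\<lambda>v. restrict v {1..t}) \<circ> (\<lambda>v. restrict v {1..n}))"
      by (rule distr_distr[OF measurable_OmM_restrict[OF step(1)] rm])
    also have "(\<lambda>v. restrict v {1..t}) \<circ> (\<lambda>v. restrict v {1..n}) = (\<lambda>v. restrict v {1..t})"
      by (rule ext) (simp only: comp_apply restrict_restrict_le[OF step(1)])
    finally show ?thesis by (rule sym)
  qed
  ultimately show ?case by blast
qed

text \<open>Change of variables for an integrand that is only universally measurable: it agrees
  almost surely, under the image law, with a measurable one.\<close>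

lemma nn_integral_distr_universal:
  fixes X :: "'b \<Rightarrow> ennreal"
  assumes f: "f \<in> P \<rightarrow>\<^sub>M M" and P: "prob_space P" and X: "X \<in> borel_measurable (universal M)"
  shows "(\<integral>\<^sup>+ v. X (f v) \<partial>P) = (\<integral>\<^sup>+ w. X w \<partial>(distr P M f))"
proof -
  let ?D = "distr P M f"
  have D: "?D \<in> probs M" using prob_space.prob_space_distr[OF P f] by (simp add: probs_def)
  obtain X' where X': "X' \<in> borel_measurable ?D" "AE w in ?D. X w = X' w"
    using completion_ex_borel_measurable[OF measurable_univ_completion[OF X D]] by blast
  have "(\<integral>\<^sup>+ v. X (f v) \<partial>P) = (\<integral>\<^sup>+ v. X' (f v) \<partial>P)"
    by (rule nn_integral_cong_AE) (rule AE_distrD[OF f X'(2)])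
  also have "\<dots> = (\<integral>\<^sup>+ w. X' w \<partial>?D)" using X'(1) by (intro nn_integral_distr[symmetric] f) simp
  also have "\<dots> = (\<integral>\<^sup>+ w. X w \<partial>?D)" using X'(2) by (intro nn_integral_cong_AE) (auto elim!: eventually_mono)
  finally show ?thesis .
qed

subsection \<open>The market\<close>

text \<open>Balls of radius 1/(n+1) around the points of a countable dense set. Centre and radius
  share one index, so a single number names a ball, and the centres double as a dense set of
  positions.\<close>

lemma rational_balls_exist:
  "\<exists>(c :: nat \<Rightarrow> 'a::euclidean_space) r. (\<forall>k. r k > 0) \<and> (\<forall>x e. e > 0 \<longrightarrow> (\<exists>k. r k < e \<and> dist x (c k) < r k))"
proof -
  obtain D :: "'a set" where D: "countable D" "\<And>X. open X \<Longrightarrow> X \<noteq> {} \<Longrightarrow> \<exists>d\<in>D. d \<in> X"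
    using countable_dense_exists by blast
  have "D \<noteq> {}" using D(2)[of UNIV] by auto
  define c where "c k = from_nat_into D (fst (prod_decode k))" for k
  define r where "r k = 1 / real (Suc (snd (prod_decode k)))" for k
  have "\<exists>k. r k < e \<and> dist x (c k) < r k" if "e > 0" for x and e :: real
  proof -
    obtain n where n: "1 / real (Suc n) < e" using nat_approx_posE[of e] \<open>e > 0\<close> by metis
    have "ball x (1 / real (Suc n)) \<noteq> {}" by simp
    then obtain d where d: "d \<in> D" "d \<in> ball x (1 / real (Suc n))" using D(2)[of "ball x (1 / real (Suc n))"] by auto
    obtain m where m: "from_nat_into D m = d" using from_nat_into_surj[OF D(1) d(1)] by blast
    show ?thesis
      using n d m by (intro exI[of _ "prod_encode (m, n)"]) (simp add: c_def r_def)
  qed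
  moreover have "r k > 0" for k by (simp add: r_def)
  ultimately show ?thesis by blast
qed

lemma emeasure_eq_0_if_AE_not_in:
  assumes "N \<in> sets P" "AE y in P. y \<notin> N"
  shows "emeasure P N = 0"
  using AE_iff_measurable[OF assms(1), of "\<lambda>y. y \<notin> N"] assms sets.sets_into_space[OF assms(1)] by auto

lemma V_restrict: "t \<le> s \<Longrightarrow> V S t z phi (restrict w {1..s}) = V S t z phi w"
proof -
  assume "t \<le> s"
  then have "i - 1 \<le> s" "i \<le> s" if "i \<in> {1..t}" for i using that by auto
  then have "restrict (restrict w {1..s}) {1..i - 1} = restrict w {1..i - 1}"
    "restrict (restrict w {1..s}) {1..i} = restrict w {1..i}" if "i \<in> {1..t}" for i
    using that by (simp_all only: restrict_restrict_le)
  then have "(\<Sum>i = 1..t. phi i (restrict (restrict w {1..s}) {1..i - 1}) \<bullet> dS S i (restrict (restrict w {1..s}) {1..i}))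
    = (\<Sum>i = 1..t. phi i (restrict w {1..i - 1}) \<bullet> dS S i (restrict w {1..i}))"
    by (intro sum.cong[OF refl]) (simp only:)
  then show ?thesis unfolding V_def by (simp only:)
qed

lemma V_Suc: "V S (Suc t) z phi w = V S t z phi w + phi (Suc t) (restrict w {1..t}) \<bullet> dS S (Suc t) (restrict w {1..Suc t})"
  by (simp add: V_def)

text \<open>The enumeration of balls is a parameter because the conditional supports and the rounded
  strategies have to refer to the same countable family.\<close>

locale market =
  fixes Om :: "nat \<Rightarrow> 'a topology"
    and QR :: "nat \<Rightarrow> (nat \<Rightarrow> 'a) \<Rightarrow> 'a measure set"
    and S :: "nat \<Rightarrow> (nat \<Rightarrow> 'a) \<Rightarrow> real^'d"
    and T :: nat
    and OmNA :: "nat \<Rightarrow> (nat \<Rightarrow> 'a) set"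
    and alpha :: "nat \<Rightarrow> (nat \<Rightarrow> 'a) \<Rightarrow> real"
    and c :: "nat \<Rightarrow> real^'d" and r :: "nat \<Rightarrow> real"
  assumes T_pos: "T \<ge> 1"
    and polish: "\<forall>t\<in>{1..T}. Polish_space (Om t)"
    and QR_probs: "\<forall>t<T. \<forall>w\<in>topspace (OmT Om t).
        QR (Suc t) w \<noteq> {} \<and> QR (Suc t) w \<subseteq> probs (borel_of (Om (Suc t)))"
    and QR_graph: "\<forall>t<T. analytic_in (prod_topology (OmT Om t) (weak_top (Om (Suc t))))
        {(w, P). w \<in> topspace (OmT Om t) \<and> P \<in> QR (Suc t) w}"
    and S_borel: "\<forall>t\<le>T. S t \<in> borel_measurable (OmM Om t)"
    and no_arbitrage: "\<forall>phi\<in>Phi Om T. qs Om QR T (\<lambda>w. V S T 0 phi w \<ge> 0) \<longrightarrow>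
        qs Om QR T (\<lambda>w. V S T 0 phi w = 0)"
    and NA_full: "\<forall>t<T. full_measure Om QR t (OmNA t)"
    and alpha_meas: "\<forall>t<T. univ_meas (OmM Om t) borel (alpha t) \<and>
        (\<forall>w\<in>space (OmM Om t). alpha t w > 0)"
    and NA_prop: "\<forall>t<T. \<forall>w\<in>OmNA t. subspace (Dset Om QR S t w) \<and>
        (\<forall>h\<in>Dset Om QR S t w - {0}. \<exists>Ph\<in>QR (Suc t) w.
           emeasure Ph {y \<in> topspace (Om (Suc t)).
              ((1 / norm h) *\<^sub>R h) \<bullet> dS S (Suc t) (w(Suc t := y)) < - alpha t w}
           > ennreal (alpha t w))"
    and moments: "\<forall>p>0. (\<forall>t\<in>{1..T}. Wr Om QR t p (dS S t)) \<and>
        (\<forall>t\<in>{1..T - 1}. Wr Om QR t p (\<lambda>w. 1 / alpha t w))"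
    and QQ_nonempty: "QQ Om QR T \<noteq> {}"
    and balls: "r k > 0" "e > 0 \<Longrightarrow> \<exists>k. r k < e \<and> dist x (c k) < r k"
begin

abbreviation "M \<equiv> OmM Om"
abbreviation "Q \<equiv> QQ Om QR"
abbreviation "pre t w \<equiv> restrict w {1..t::nat}"

lemma sc: "t \<le> T \<Longrightarrow> \<forall>i\<in>{1..t}. second_countable (Om i)"
  using polish Polish_space_second_countable by fastforce

lemma Q_probs: "t \<le> T \<Longrightarrow> P \<in> Q t \<Longrightarrow> P \<in> probs (M t)"
  using QQ_subset_probs[OF sc] by blast

lemma pre_meas: "s \<le> t \<Longrightarrow> pre s \<in> M t \<rightarrow>\<^sub>M M s"
  by (rule measurable_OmM_restrict)

lemma pre_umeas: "s \<le> t \<Longrightarrow> pre s \<in> universal (M t) \<rightarrow>\<^sub>M universal (M s)"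
  by (rule measurable_univ_univ[OF pre_meas])

lemma pre_meas_Q: "s \<le> t \<Longrightarrow> t \<le> T \<Longrightarrow> P \<in> Q t \<Longrightarrow> pre s \<in> P \<rightarrow>\<^sub>M M s"
  using pre_meas[of s t] probsD(1)[OF Q_probs, of t P] by (simp cong: measurable_cong_sets)

lemma Q_marginal: "s \<le> t \<Longrightarrow> t \<le> T \<Longrightarrow> P \<in> Q t \<Longrightarrow> distr P (M s) (pre s) \<in> Q s"
  by (rule QQ_marginal[OF sc])

lemma Q_marginal_AE:
  assumes "s \<le> t" "t \<le> T" "P \<in> Q t" "\<And>P. P \<in> Q s \<Longrightarrow> AE w in P. R w"
  shows "AE w in P. R (pre s w)"
  by (rule AE_distrD[OF pre_meas_Q[OF assms(1-3)]]) (rule assms(4)[OF Q_marginal[OF assms(1-3)]])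

lemma space_M_nonempty: assumes "t \<le> T" shows "space (M t) \<noteq> {}"
proof -
  obtain P where "P \<in> Q T" using QQ_nonempty by blast
  then have "distr P (M t) (pre t) \<in> probs (M t)" using Q_probs[OF assms] Q_marginal[OF assms order_refl] by blast
  from prob_space.not_empty[OF probsD(3)[OF this]] show ?thesis by simp
qed

lemma qs_iff: "t \<le> T \<Longrightarrow> qs Om QR t R \<longleftrightarrow> (\<forall>P\<in>Q t. AE w in P. R w)"
  by (rule qs_iff_AE[OF QQ_subset_probs[OF sc]])

lemma QRD:
  assumes "t < T" "w \<in> space (M t)"
  shows "QR (Suc t) w \<noteq> {}" "P \<in> QR (Suc t) w \<Longrightarrow> P \<in> probs (borel_of (Om (Suc t)))"
  using QR_probs assms by (auto simp: OmM_def)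

lemma dS_borel: "t < T \<Longrightarrow> dS S (Suc t) \<in> borel_measurable (M (Suc t))"
proof -
  assume t: "t < T"
  then have [measurable]: "S (Suc t) \<in> borel_measurable (M (Suc t))" "S t \<in> borel_measurable (M t)"
    using S_borel by auto
  have [measurable]: "pre t \<in> M (Suc t) \<rightarrow>\<^sub>M M t" by (rule pre_meas) simp
  have "(\<lambda>w. S (Suc t) w - S t (pre t w)) \<in> borel_measurable (M (Suc t))" by measurable
  then show ?thesis by (simp add: dS_def[abs_def])
qed

section \<open>The conditional quasi-sure support of the increments\<close>

definition E :: "nat \<Rightarrow> nat \<Rightarrow> (nat \<Rightarrow> 'a) set" where
  "E t k = {v \<in> space (M (Suc t)). dS S (Suc t) v \<in> ball (c k) (r k)}"

definition Z :: "nat \<Rightarrow> nat \<Rightarrow> (nat \<Rightarrow> 'a) set" where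
  "Z t k = {w \<in> space (M t). \<exists>P\<in>QR (Suc t) w. charged Om t w (E t k) P}"

text \<open>The conditional quasi-sure support of the increment, seen only through which of the countably
  many balls are charged: this keeps it universally measurable without any set-valued analysis.\<close>
definition supp :: "nat \<Rightarrow> (nat \<Rightarrow> 'a) \<Rightarrow> (real^'d) set" where
  "supp t w = {x. \<forall>k. x \<in> ball (c k) (r k) \<longrightarrow> w \<in> Z t k}"

lemma E_sets: "t < T \<Longrightarrow> E t k \<in> sets (M (Suc t))"
  unfolding E_def using measurable_sets[OF dS_borel, of t "ball (c k) (r k)"]
  by (simp add: vimage_def Int_def conj_commute)

lemma charging_kernel:
  assumes "t < T"
  shows "Z t k \<in> sets (universal (M t))"
    "\<exists>q. is_kernel Om t q \<and> (\<forall>w\<in>space (M t). q w \<in> QR (Suc t) w) \<and> (\<forall>w\<in>Z t k. charged Om t w (E t k) (q w))"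
proof -
  have p: "\<forall>i\<in>{1..Suc t}. Polish_space (Om i)" using polish assms by auto
  have qr: "\<forall>w\<in>space (M t). QR (Suc t) w \<noteq> {} \<and> QR (Suc t) w \<subseteq> probs (borel_of (Om (Suc t)))"
    using QRD[OF assms] by blast
  have an: "analytic_in (prod_topology (OmT Om t) (weak_top (Om (Suc t)))) {(w, P). w \<in> topspace (OmT Om t) \<and> P \<in> QR (Suc t) w}"
    using QR_graph assms by blast
  note ex = charging_kernel_exists[OF p qr space_M_nonempty[OF less_imp_le[OF assms]] an E_sets[OF assms, of k]]
  show "Z t k \<in> sets (universal (M t))" unfolding Z_def by (rule ex(1))
  obtain q where q: "is_kernel Om t q \<and> (\<forall>w\<in>space (M t). q w \<in> QR (Suc t) w \<and>
      (\<forall>P\<in>QR (Suc t) w. charged Om t w (E t k) P \<longrightarrow> charged Om t w (E t k) (q w)))" using ex(2) ..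
  have "charged Om t w (E t k) (q w)" if "w \<in> Z t k" for w
    using that q unfolding Z_def by blast
  with q show "\<exists>q. is_kernel Om t q \<and> (\<forall>w\<in>space (M t). q w \<in> QR (Suc t) w) \<and> (\<forall>w\<in>Z t k. charged Om t w (E t k) (q w))"
    by (intro exI[of _ q] conjI ballI) simp_all
qed

lemmas Z_sets = charging_kernel(1)

lemma Q_extension:
  assumes "t \<le> T" "P \<in> Q t"
  shows "\<exists>P'\<in>Q T. distr P' (M t) (pre t) = P"
proof (rule QQ_extension[OF sc[OF order_refl] _ assms(2,1)])
  fix s assume "s < T"
  from charging_kernel(2)[OF this, of 0] show "\<exists>q. is_kernel Om s q \<and> (\<forall>w\<in>space (M s). q w \<in> QR (Suc s) w)"
    by blast
qed

text \<open>P is the marginal of a model at horizon T. A Borel part of the failure set is null for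
  that model by hypothesis, hence null for P.\<close>

lemma Q_AE_extension:
  assumes t: "t \<le> T" and P: "P \<in> Q t" and R: "{w \<in> space (M t). R w} \<in> sets (universal (M t))"
    and AE: "\<And>P. P \<in> Q T \<Longrightarrow> AE w in P. R (pre t w)"
  shows "AE w in P. R w"
proof -
  obtain P' where P': "P' \<in> Q T" "distr P' (M t) (pre t) = P" using Q_extension[OF t P] by blast
  note PP = Q_probs[OF t P]
  have eq: "{w \<in> space (M t). \<not> R w} = space (universal (M t)) - {w \<in> space (M t). R w}" by auto
  have "{w \<in> space (M t). \<not> R w} \<in> sets (universal (M t))" unfolding eq by (rule sets.compl_sets[OF R])
  then obtain B N where B: "B \<in> sets (M t)" "B \<subseteq> {w \<in> space (M t). \<not> R w}" "N \<in> null_sets P"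
    "{w \<in> space (M t). \<not> R w} - B \<subseteq> N"
    using PP by (rule univ_inner_approx)
  have "AE w in P'. pre t w \<notin> B"
    using AE[OF P'(1)] by (rule eventually_mono) (use B(2) in blast)
  moreover have "{w \<in> space (M t). w \<notin> B} \<in> sets (M t)" using B(1) by measurable
  ultimately have "AE w in distr P' (M t) (pre t). w \<notin> B"
    using AE_distr_iff[OF pre_meas_Q[OF t order_refl P'(1)], of "\<lambda>w. w \<notin> B"] by (simp only:)
  then have "AE w in P. w \<notin> B" unfolding P'(2) .
  moreover have "AE w in P. w \<notin> N" using B(3) by (rule AE_not_in)
  moreover have "AE w in P. w \<in> space (M t)" using probsD(2)[OF PP] by (intro AE_I2) simp
  ultimately show ?thesis by eventually_elim (use B(4) in blast)
qed

text \<open>An increment outside the support lies in one of countably many uncharged balls, and each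
  of these is null under every model at w.\<close>

lemma supp_full:
  assumes t: "t < T" and w: "w \<in> space (M t)" and P: "P \<in> QR (Suc t) w"
  shows "AE y in P. dS S (Suc t) (w(Suc t := y)) \<in> supp t w"
proof -
  note P' = probsD[OF QRD(2)[OF t w P]]
  have "AE y in P. w \<notin> Z t k \<longrightarrow> dS S (Suc t) (w(Suc t := y)) \<notin> ball (c k) (r k)" for k
  proof (cases "w \<in> Z t k")
    case False
    let ?N = "{y \<in> topspace (Om (Suc t)). w(Suc t := y) \<in> E t k}"
    have "\<not> charged Om t w (E t k) P" using False w P unfolding Z_def by blast
    then have "emeasure P ?N = 0" unfolding charged_def by simp
    moreover have "?N \<in> sets P"
      using measurable_sets[OF measurable_fun_upd_section[OF sc w] E_sets[OF t]] t P'(1)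
      by (simp add: vimage_def Int_def conj_commute)
    ultimately have "?N \<in> null_sets P" by (rule null_setsI)
    from AE_not_in[OF this] have "AE y in P. y \<notin> ?N" .
    then show ?thesis
    proof (rule AE_mp, intro AE_I2 impI)
      fix y assume "y \<in> space P" "y \<notin> ?N"
      then show "dS S (Suc t) (w(Suc t := y)) \<notin> ball (c k) (r k)"
        using P'(2) OmM_extend(1)[OF w, of y] by (simp add: E_def)
    qed
  qed simp
  then have "AE y in P. \<forall>k. w \<notin> Z t k \<longrightarrow> dS S (Suc t) (w(Suc t := y)) \<notin> ball (c k) (r k)"
    unfolding AE_all_countable by blast
  then show ?thesis by (rule eventually_mono) (unfold supp_def, blast)
qed

text \<open>A point outside a closed set A of full measure has a small ball around it that misses A.
  If the point belonged to the support, some model would charge this ball and have total mass above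
  one.\<close>

lemma supp_Dset:
  assumes t: "t < T" and w: "w \<in> space (M t)"
  shows "supp t w \<subseteq> Dset Om QR S t w"
proof -
  have "supp t w \<subseteq> A" if A: "closed A" "\<forall>P\<in>QR (Suc t) w. emeasure P {y \<in> topspace (Om (Suc t)). dS S (Suc t) (w(Suc t := y)) \<in> A} = 1" for A
  proof
    fix x assume x: "x \<in> supp t w"
    show "x \<in> A"
    proof (rule ccontr)
      assume "x \<notin> A"
      then obtain e where e: "e > 0" "ball x e \<subseteq> - A" using A(1) by (meson ComplI openE open_Compl)
      obtain k where k: "r k < e / 2" "dist x (c k) < r k" using balls(2)[of "e/2" x] e by auto
      have "ball (c k) (r k) \<inter> A = {}"
      proof -
        have "ball (c k) (r k) \<subseteq> ball x e"
        proof
          fix y assume "y \<in> ball (c k) (r k)"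
          then have "dist x y < r k + r k" using k(2) dist_triangle[of x y "c k"] by simp
          with k(1) show "y \<in> ball x e" by simp
        qed
        with e(2) show ?thesis by blast
      qed
      have "x \<in> ball (c k) (r k)" using k(2) by (simp add: dist_commute)
      then have "w \<in> Z t k" using x by (simp add: supp_def)
      then obtain P where P: "P \<in> QR (Suc t) w" "charged Om t w (E t k) P" by (auto simp: Z_def)
      note P' = probsD[OF QRD(2)[OF t w P(1)]]
      let ?N = "{y \<in> topspace (Om (Suc t)). w(Suc t := y) \<in> E t k}"
      let ?A = "{y \<in> topspace (Om (Suc t)). dS S (Suc t) (w(Suc t := y)) \<in> A}"
      have N: "?N \<in> sets P"
        using measurable_sets[OF measurable_fun_upd_section[OF sc w] E_sets[OF t]] t P'(1)
        by (simp add: vimage_def Int_def conj_commute)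
      have dis: "?N \<inter> ?A = {}" using \<open>ball (c k) (r k) \<inter> A = {}\<close> by (auto simp: E_def)
      have Am: "?A \<in> sets P"
        by (rule emeasure_neq_0_sets) (use A(2) P(1) in simp)
      have "emeasure P (?N \<union> ?A) = emeasure P ?N + emeasure P ?A" using N Am dis by (intro plus_emeasure[symmetric])
      moreover have "emeasure P (?N \<union> ?A) \<le> 1" by (rule prob_space.measure_le_1[OF P'(3)])
      ultimately have "emeasure P ?N + 1 \<le> 1" using A(2) P(1) by simp
      then have "emeasure P ?N = 0"
        using ennreal_add_left_cancel_le[of 1 "emeasure P ?N" 0] by (simp add: add.commute)
      with P(2) show False unfolding charged_def by simp
    qed
  qed
  then have "supp t w \<subseteq> \<Inter>{A. closed A \<and> (\<forall>P\<in>QR (Suc t) w. emeasure P {y \<in> topspace (Om (Suc t)). dS S (Suc t) (w(Suc t := y)) \<in> A} = 1)}"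
    by blast
  also have "\<dots> \<subseteq> Dset Om QR S t w" unfolding Dset_def by (rule hull_subset)
  finally show ?thesis .
qed

text \<open>Only the component of the strategy in the span of the support matters, and the quantitative
  no-arbitrage condition bounds that component by the current wealth divided by alpha.\<close>
lemma projected_strategy_bound:
  assumes t: "t < T" and wNA: "w \<in> OmNA t" and w: "w \<in> space (M t)"
    and nn: "\<forall>x\<in>supp t w. v + f \<bullet> x \<ge> 0"
  shows "\<exists>h. (\<forall>x\<in>supp t w. h \<bullet> x = f \<bullet> x) \<and> norm h \<le> v / alpha t w"
proof -
  let ?D = "Dset Om QR S t w"
  have D: "subspace ?D" using NA_prop t wNA by blast
  obtain h g where hg: "h \<in> span ?D" "\<And>x. x \<in> span ?D \<Longrightarrow> orthogonal g x" "f = h + g"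
    using orthogonal_subspace_decomp_exists[of ?D f] by metis
  have hD: "h \<in> ?D" using hg(1) D by (simp add: span_eq_iff[THEN iffD2])
  have eq: "h \<bullet> x = f \<bullet> x" if "x \<in> supp t w" for x
  proof -
    have "x \<in> span ?D" using supp_Dset[OF t w] that span_base by blast
    from hg(2)[OF this] hg(3) show ?thesis by (simp add: inner_add_left orthogonal_def)
  qed
  have a: "alpha t w > 0" using alpha_meas t w by blast
  have "norm h * alpha t w \<le> v"
  proof (cases "h = 0")
    \<comment> \<open>The claim reduces to v being nonnegative, for which one point of the support
      is needed; there is one because the support has full measure under any model.\<close>
    case True
    obtain P where P: "P \<in> QR (Suc t) w" using QRD(1)[OF t w] by blast
    note P' = probsD[OF QRD(2)[OF t w P]]
    have "\<exists>y. dS S (Suc t) (w(Suc t := y)) \<in> supp t w"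
    proof (rule ccontr)
      assume "\<not> ?thesis"
      then have "AE y in P. False" using supp_full[OF t w P] by simp
      then show False using prob_space.AE_False[OF P'(3)] by simp
    qed
    then obtain x where x: "x \<in> supp t w" by blast
    with nn eq[OF x] True show ?thesis by auto
  next
    case False
    then obtain P where P: "P \<in> QR (Suc t) w"
      "emeasure P {y \<in> topspace (Om (Suc t)). ((1 / norm h) *\<^sub>R h) \<bullet> dS S (Suc t) (w(Suc t := y)) < - alpha t w} > ennreal (alpha t w)"
      (is "emeasure P ?N > _") using NA_prop t wNA hD by blast
    note P' = probsD[OF QRD(2)[OF t w P(1)]]
    \<comment> \<open>The event has positive mass under P and the support full mass, so some outcome
      lies in both.\<close>
    have "\<exists>y\<in>?N. dS S (Suc t) (w(Suc t := y)) \<in> supp t w"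
    proof (rule ccontr)
      assume neg: "\<not> ?thesis"
      have N: "?N \<in> sets P" by (rule emeasure_neq_0_sets) (use P(2) in auto)
      have "AE y in P. y \<notin> ?N" using supp_full[OF t w P(1)] by (rule eventually_mono) (use neg in blast)
      with N have "emeasure P ?N = 0" by (rule emeasure_eq_0_if_AE_not_in)
      with P(2) show False by simp
    qed
    then obtain y where y: "y \<in> ?N" "dS S (Suc t) (w(Suc t := y)) \<in> supp t w" by blast
    let ?x = "dS S (Suc t) (w(Suc t := y))"
    have "(h \<bullet> ?x) / norm h < - alpha t w" using y(1) by simp
    then have "h \<bullet> ?x < - alpha t w * norm h" using False by (simp add: field_simps)
    moreover have "v + h \<bullet> ?x \<ge> 0" using nn y(2) eq[OF y(2)] by simp
    ultimately show ?thesis by (simp add: mult.commute)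
  qed
  then have "norm h \<le> v / alpha t w" using a by (simp add: field_simps)
  with eq show ?thesis by blast
qed

lemma increment_in_supp:
  assumes t: "t < T" and P: "P \<in> Q (Suc t)"
  shows "AE v in P. dS S (Suc t) v \<in> supp t (pre t v)"
proof -
  obtain P0 q where P0: "P = kprod Om t P0 q" "P0 \<in> Q t" "is_kernel Om t q" "AE w in completion P0. q w \<in> QR (Suc t) w"
    using P by auto
  have tT: "t \<le> T" "Suc t \<le> T" using t by auto
  note PP = Q_probs[OF tT(1) P0(2)]
  let ?M = "universal (M (Suc t))"
  have [measurable]: "Measurable.pred ?M (\<lambda>v. dS S (Suc t) v \<in> ball (c k) (r k))" for k
    by (rule pred_sets2[OF _ measurable_imp_univ[OF dS_borel[OF t]]]) simp
  have [measurable]: "Measurable.pred ?M (\<lambda>v. pre t v \<in> Z t k)" for k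
    by (rule pred_sets2[OF Z_sets[OF t] pre_umeas]) simp
  have "{v \<in> space ?M. \<not> (\<forall>k. dS S (Suc t) v \<in> ball (c k) (r k) \<longrightarrow> pre t v \<in> Z t k)} \<in> sets ?M" by measurable
  then have meas: "{v \<in> space (M (Suc t)). dS S (Suc t) v \<notin> supp t (pre t v)} \<in> sets ?M" by (simp add: supp_def)
  have "AE w in P0. w \<in> space (M t)" using probsD(2)[OF PP] by (intro AE_I2) simp
  moreover have "AE w in P0. q w \<in> QR (Suc t) w" using P0(4) by (simp only: AE_completion_iff)
  ultimately have "AE w in P0. AE y in q w. dS S (Suc t) (w(Suc t := y)) \<in> supp t (pre t (w(Suc t := y)))"
  proof eventually_elim
    case (elim w)
    have "AE y in q w. y \<in> topspace (Om (Suc t))"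
      using probsD(2)[OF QRD(2)[OF t elim]] by (intro AE_I2) simp
    with supp_full[OF t elim] show ?case
      by eventually_elim (simp only: OmM_extend(2)[OF elim(1)])
  qed
  from AE_kprodI[OF sc[OF tT(2)] PP P0(3) meas this] show ?thesis unfolding P0(1) .
qed

text \<open>If nonnegativity failed at a point of the support, it would fail on a whole small ball
  charged by some model. The charging kernel turns this into one model over the next period in which
  wealth is negative with positive probability.\<close>

lemma one_step_nonneg:
  assumes t: "t < T" and v: "v \<in> borel_measurable (universal (M t))" and f: "f \<in> borel_measurable (universal (M t))"
    and nn: "\<And>P. P \<in> Q (Suc t) \<Longrightarrow> AE u in P. v (pre t u) + f (pre t u) \<bullet> dS S (Suc t) u \<ge> 0"
    and P: "P \<in> Q t"
  shows "AE w in P. \<forall>x\<in>supp t w. v w + f w \<bullet> x \<ge> 0"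
proof -
  have tT: "t \<le> T" "Suc t \<le> T" using t by auto
  note PP = Q_probs[OF tT(1) P]
  \<comment> \<open>By Cauchy-Schwarz the expression bounds v + f . x from above for every x in ball
    k, so on this set the whole ball gives negative wealth.\<close>
  define N where "N k = {w \<in> space (universal (M t)). w \<in> Z t k \<and> v w + f w \<bullet> c k + norm (f w) * r k < 0}" for k
  have null: "AE w in P. w \<notin> N k" for k
  proof -
    obtain q where "is_kernel Om t q \<and> (\<forall>w\<in>space (M t). q w \<in> QR (Suc t) w) \<and> (\<forall>w\<in>Z t k. charged Om t w (E t k) (q w))"
      using charging_kernel(2)[OF t] ..
    then have q: "is_kernel Om t q" "\<And>w. w \<in> space (M t) \<Longrightarrow> q w \<in> QR (Suc t) w"
      "\<And>w. w \<in> Z t k \<Longrightarrow> charged Om t w (E t k) (q w)" by simp_all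
    note [measurable] = Z_sets[OF t, of k] v f
    have "N k \<in> sets (universal (M t))" unfolding N_def by measurable
    then obtain B N0 where B: "B \<in> sets (M t)" "B \<subseteq> N k" "N0 \<in> null_sets P" "N k - B \<subseteq> N0"
      using PP by (rule univ_inner_approx)
    have "AE w in completion P. q w \<in> QR (Suc t) w" using q(2) probsD(2)[OF PP] by (intro AE_I2) simp
    then have P': "kprod Om t P q \<in> Q (Suc t)" using P q(1) by auto
    have "AE u in kprod Om t P q. u \<in> space (M (Suc t))"
      using probsD(2)[OF Q_probs[OF tT(2) P']] by (intro AE_I2) simp
    with nn[OF P'] have "AE u in kprod Om t P q. \<not> (pre t u \<in> B \<and> u \<in> E t k)"
    proof eventually_elim
      case (elim u)
      show ?case
      proof
        assume u: "pre t u \<in> B \<and> u \<in> E t k"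
        let ?w = "pre t u" and ?x = "dS S (Suc t) u"
        have "v ?w + f ?w \<bullet> c k + norm (f ?w) * r k < 0" using u B(2) by (auto simp: N_def)
        moreover have "f ?w \<bullet> (?x - c k) \<le> norm (f ?w) * r k"
        proof -
          have "norm (?x - c k) \<le> r k" using u by (simp add: E_def dist_norm norm_minus_commute)
          then have "norm (f ?w) * norm (?x - c k) \<le> norm (f ?w) * r k" by (intro mult_left_mono) auto
          with norm_cauchy_schwarz[of "f ?w" "?x - c k"] show ?thesis by linarith
        qed
        ultimately have "v ?w + f ?w \<bullet> ?x < 0" by (simp add: inner_diff_right)
        with elim(1) show False by simp
      qed
    qed
    moreover have "Measurable.pred (M (Suc t)) (\<lambda>u. \<not> (pre t u \<in> B \<and> u \<in> E t k))"
    proof (intro pred_intros_logic)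
      show "Measurable.pred (M (Suc t)) (\<lambda>u. pre t u \<in> B)" by (rule pred_sets2[OF B(1) pre_meas]) simp
      show "Measurable.pred (M (Suc t)) (\<lambda>u. u \<in> E t k)" by (rule pred_sets2[OF E_sets[OF t] measurable_ident_sets[OF refl]])
    qed
    ultimately have "AE w in P. AE y in q w. \<not> (pre t (w(Suc t := y)) \<in> B \<and> w(Suc t := y) \<in> E t k)"
      by (intro AE_kprod[OF sc[OF tT(2)] PP q(1), THEN iffD1])
    moreover have "AE w in P. w \<in> space (M t)" using probsD(2)[OF PP] by (intro AE_I2) simp
    ultimately have "AE w in P. w \<notin> B"
    proof eventually_elim
      case (elim w)
      note qw = probsD[OF QRD(2)[OF t elim(2) q(2)[OF elim(2)]]]
      show ?case
      proof
        assume wB: "w \<in> B"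
        have "charged Om t w (E t k) (q w)" using wB B(2) q(3) by (auto simp: N_def)
        then have pos: "emeasure (q w) {y \<in> topspace (Om (Suc t)). w(Suc t := y) \<in> E t k} > 0" (is "emeasure _ ?Y > 0")
          by (simp add: charged_def)
        have "?Y \<in> sets (q w)" by (rule emeasure_neq_0_sets) (use pos in auto)
        moreover have "AE y in q w. y \<notin> ?Y"
          using elim(1)
        proof (rule eventually_mono, intro notI)
          fix y assume "\<not> (pre t (w(Suc t := y)) \<in> B \<and> w(Suc t := y) \<in> E t k)" "y \<in> ?Y"
          then show False using OmM_extend(2)[OF elim(2), of y] wB by simp
        qed
        ultimately have "emeasure (q w) ?Y = 0" by (rule emeasure_eq_0_if_AE_not_in)
        with pos show False by simp
      qed
    qed
    moreover have "AE w in P. w \<notin> N0" using B(3) by (rule AE_not_in)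
    ultimately show ?thesis by eventually_elim (use B(4) in blast)
  qed
  then have "AE w in P. \<forall>k. w \<notin> N k" unfolding AE_all_countable by blast
  moreover have "AE w in P. w \<in> space (M t)" using probsD(2)[OF PP] by (intro AE_I2) simp
  ultimately show ?thesis
  proof eventually_elim
    case (elim w)
    show ?case
    proof (intro ballI, rule ccontr)
      fix x assume x: "x \<in> supp t w" and "\<not> v w + f w \<bullet> x \<ge> 0"
      then have neg: "v w + f w \<bullet> x < 0" by simp
      \<comment> \<open>Passing to the centre and then to the worst point of the ball costs at most
        twice \<open>norm (f w) * r k\<close>, which this choice keeps below the deficit. The
        summand 1 covers f = 0.\<close>
      define e where "e = - (v w + f w \<bullet> x) / (2 * (norm (f w) + 1))"
      have "e > 0" using neg by (auto simp: e_def intro!: divide_pos_pos add_nonneg_pos)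
      then obtain k where k: "r k < e" "dist x (c k) < r k" using balls(2) by blast
      have "w \<in> Z t k" using x k(2) by (auto simp: supp_def dist_commute)
      moreover have "v w + f w \<bullet> c k + norm (f w) * r k < 0"
      proof -
        have "f w \<bullet> (c k - x) \<le> norm (f w) * norm (c k - x)" by (rule norm_cauchy_schwarz)
        also have "\<dots> \<le> norm (f w) * r k" using k(2) by (intro mult_left_mono) (auto simp: dist_norm norm_minus_commute)
        finally have "f w \<bullet> c k \<le> f w \<bullet> x + norm (f w) * r k" by (simp add: inner_diff_right)
        moreover have "2 * (norm (f w) * r k) < - (v w + f w \<bullet> x)"
        proof -
          have "2 * (norm (f w) * r k) \<le> 2 * ((norm (f w) + 1) * r k)" using balls(1)[of k] by (simp add: algebra_simps)
          also have "\<dots> < 2 * ((norm (f w) + 1) * e)" using k(1) by (simp add: add_nonneg_pos)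
          also have "\<dots> = - (v w + f w \<bullet> x)"
            unfolding e_def by (simp add: field_simps add_nonneg_eq_0_iff)
          finally show ?thesis .
        qed
        ultimately show ?thesis by linarith
      qed
      ultimately have "w \<in> N k" using elim(2) by (simp add: N_def)
      with elim(1) show False by blast
    qed
  qed
qed

section \<open>Measurability and nonnegativity of wealth\<close>

lemma PhiD:
  assumes "phi \<in> Phi Om T" "t < T"
  shows "phi (Suc t) \<in> borel_measurable (universal (M t))"
proof -
  have "\<forall>t\<in>{1..T}. phi t \<in> borel_measurable (universal (M (t - 1)))"
    using assms(1) by (simp add: Phi_def univ_meas_iff)
  from bspec[OF this, of "Suc t"] assms(2) show ?thesis by simp
qed

lemma V_umeas:
  assumes phi: "phi \<in> Phi Om T" and "t \<le> s" "s \<le> T"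
  shows "V S t z phi \<in> borel_measurable (universal (M s))"
  using \<open>t \<le> s\<close>
proof (induction t)
  case 0
  then show ?case by (simp add: V_def[abs_def])
next
  case (Suc t)
  then have [measurable]: "V S t z phi \<in> borel_measurable (universal (M s))" by simp
  have t: "t < T" using Suc.prems assms(3) by simp
  have [measurable]: "(\<lambda>w. phi (Suc t) (pre t w)) \<in> borel_measurable (universal (M s))"
    by (rule measurable_compose[OF pre_umeas PhiD[OF phi t]]) (use Suc.prems in simp)
  have [measurable]: "(\<lambda>w. dS S (Suc t) (pre (Suc t) w)) \<in> borel_measurable (universal (M s))"
    by (rule measurable_compose[OF pre_umeas measurable_imp_univ[OF dS_borel[OF t]]]) (use Suc.prems in simp)
  show ?case unfolding V_Suc[abs_def] by measurable
qed

text \<open>Following the strategy after t only where wealth at t is negative costs nothing and ends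
  with a strictly positive gain there, since final wealth is nonnegative. Absence of arbitrage makes
  that event null.\<close>

lemma V_intermediate_nonneg:
  assumes phi: "phi \<in> Phi Om T" and nn: "\<And>P. P \<in> Q T \<Longrightarrow> AE w in P. V S T z phi w \<ge> 0"
    and t: "t \<le> T" and P: "P \<in> Q T"
  shows "AE w in P. V S t z phi w \<ge> 0"
proof -
  define psi where "psi s w = (if t < s \<and> V S t z phi w < 0 then phi s w else 0)" for s w
  have psi_Phi: "psi \<in> Phi Om T"
    unfolding Phi_def univ_meas_iff
  proof (intro CollectI ballI)
    fix s assume s: "s \<in> {1..T}"
    then obtain s' where s': "s = Suc s'" "s' < T" by (cases s) auto
    show "psi s \<in> borel_measurable (universal (M (s - 1)))"
    proof (cases "t < s")
      case True
      note [measurable] = PhiD[OF phi s'(2)]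
      have [measurable]: "V S t z phi \<in> borel_measurable (universal (M s'))"
        by (rule V_umeas[OF phi]) (use True s' in auto)
      have "(\<lambda>w. if V S t z phi w < 0 then phi (Suc s') w else 0) \<in> borel_measurable (universal (M s'))"
        by measurable
      then show ?thesis using True s' by (simp add: psi_def[abs_def])
    next
      case False
      then show ?thesis by (simp add: psi_def[abs_def])
    qed
  qed
  have V_psi: "V S u 0 psi w = (if V S t z phi w < 0 then V S u z phi w - V S t z phi w else 0)" if "t \<le> u" for u w
    using that
  proof (induction u rule: dec_induct)
    case base
    have "(\<Sum>s = 1..t. psi s (restrict w {1..s - 1}) \<bullet> dS S s (restrict w {1..s})) = 0"
      by (rule sum.neutral) (auto simp: psi_def)
    then show ?case by (simp add: V_def)
  next
    case (step u)
    have "V S t z phi (pre u w) = V S t z phi w" by (rule V_restrict[OF step(1)])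
    with step show ?case by (simp add: V_Suc psi_def)
  qed
  have "AE w in P. 0 \<le> V S T 0 psi w" if "P \<in> Q T" for P
    using nn[OF that] by eventually_elim (simp add: V_psi[OF t])
  then have "qs Om QR T (\<lambda>w. V S T 0 psi w \<ge> 0)" unfolding qs_iff[OF order_refl] by blast
  then have "qs Om QR T (\<lambda>w. V S T 0 psi w = 0)" using no_arbitrage psi_Phi by blast
  then have "AE w in P. V S T 0 psi w = 0" unfolding qs_iff[OF order_refl] using P by blast
  with nn[OF P] show ?thesis by eventually_elim (auto simp: V_psi[OF t] split: if_splits)
qed

text \<open>The position has a short representative with the same gains on the conditional support.
  Existence is asserted separately at each path; measurability of the representative in the path is
  not claimed.\<close>

definition hedgeable :: "nat \<Rightarrow> real \<Rightarrow> (nat \<Rightarrow> (nat \<Rightarrow> 'a) \<Rightarrow> real^'d) \<Rightarrow> (nat \<Rightarrow> 'a) \<Rightarrow> bool" where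
  "hedgeable t z phi w \<longleftrightarrow>
    (\<exists>h. (\<forall>x\<in>supp t w. h \<bullet> x = phi (Suc t) w \<bullet> x) \<and> norm h \<le> V S t z phi w / alpha t w)"

lemma hedgeable_AE:
  assumes phi: "phi \<in> Phi Om T" and nn: "\<And>P. P \<in> Q T \<Longrightarrow> AE w in P. V S T z phi w \<ge> 0"
    and t: "t < T" and P: "P \<in> Q t"
  shows "AE w in P. hedgeable t z phi w"
proof -
  have tT: "t \<le> T" "Suc t \<le> T" using t by auto
  have step: "AE u in P. V S t z phi (pre t u) + phi (Suc t) (pre t u) \<bullet> dS S (Suc t) u \<ge> 0"
    if P: "P \<in> Q (Suc t)" for P
  proof -
    have [measurable]: "V S (Suc t) z phi \<in> borel_measurable (universal (M (Suc t)))"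
      by (rule V_umeas[OF phi order_refl tT(2)])
    have "{w \<in> space (universal (M (Suc t))). V S (Suc t) z phi w \<ge> 0} \<in> sets (universal (M (Suc t)))" by measurable
    then have meas: "{w \<in> space (M (Suc t)). V S (Suc t) z phi w \<ge> 0} \<in> sets (universal (M (Suc t)))" by simp
    \<comment> \<open>Nonnegativity at intermediate times is known under models at horizon T;
      extension of models brings it down to models at t + 1.\<close>
    have "AE w in P. V S (Suc t) z phi w \<ge> 0"
    proof (rule Q_AE_extension[OF tT(2) P meas])
      fix P assume "P \<in> Q T"
      from V_intermediate_nonneg[OF phi nn tT(2) this] show "AE w in P. V S (Suc t) z phi (pre (Suc t) w) \<ge> 0"
        by (simp only: V_restrict[OF order_refl])
    qed
    moreover have "AE w in P. w \<in> space (M (Suc t))"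
      using probsD(2)[OF Q_probs[OF tT(2) P]] by (intro AE_I2) simp
    ultimately show ?thesis
    proof eventually_elim
      case (elim w)
      from elim(1) show ?case
        unfolding V_Suc V_restrict[OF order_refl] OmM_restrict(2)[OF elim(2)] .
    qed
  qed
  have "AE w in P. \<forall>x\<in>supp t w. V S t z phi w + phi (Suc t) w \<bullet> x \<ge> 0"
    by (rule one_step_nonneg[OF t V_umeas[OF phi order_refl tT(1)] PhiD[OF phi t] step P])
  moreover have "AE w in P. w \<in> OmNA t"
  proof -
    have fm: "OmNA t \<subseteq> space (M t)" "polar Om QR t (space (M t) - OmNA t)"
      using NA_full t by (auto simp: full_measure_def)
    have "space (M t) - OmNA t = {w \<in> space (M t). w \<notin> OmNA t}" by auto
    with fm(2) have "qs Om QR t (\<lambda>w. w \<in> OmNA t)" by (simp add: qs_def)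
    with P show ?thesis unfolding qs_iff[OF tT(1)] by blast
  qed
  moreover have "AE w in P. w \<in> space (M t)" using probsD(2)[OF Q_probs[OF tT(1) P]] by (intro AE_I2) simp
  ultimately show ?thesis
    by eventually_elim (unfold hedgeable_def, rule projected_strategy_bound[OF t])
qed

end

subsection \<open>Wealth bounds\<close>

text \<open>The largest factor dominates all others, and its power is one of the summands. This
  takes the place of Hoelder's inequality in the moment bounds.\<close>

lemma prod_le_sum_powers:
  fixes x :: "'i \<Rightarrow> real"
  assumes "finite I" "I \<noteq> {}" "\<And>i. i \<in> I \<Longrightarrow> x i \<ge> 0"
  shows "prod x I \<le> (\<Sum>i\<in>I. x i ^ card I)"
proof -
  have "Max (x ` I) \<in> x ` I" using assms by (intro Max_in) auto
  then obtain j where j: "j \<in> I" "x j = Max (x ` I)" by auto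
  have "prod x I \<le> (\<Prod>i\<in>I. x j)"
    using assms by (intro prod_mono) (auto simp: j(2))
  also have "\<dots> = x j ^ card I" by simp
  also have "\<dots> \<le> (\<Sum>i\<in>I. x i ^ card I)"
    using assms j(1) by (intro member_le_sum) auto
  finally show ?thesis .
qed

lemma one_plus_power_le:
  fixes a :: real
  assumes "a \<ge> 0"
  shows "(1 + a) ^ m \<le> 2 ^ m * (1 + a ^ m)"
proof (cases "a \<le> 1")
  case True
  have "(1 + a) ^ m \<le> 2 ^ m" using assms True by (intro power_mono) auto
  also have "\<dots> \<le> 2 ^ m * (1 + a ^ m)" using assms by simp
  finally show ?thesis .
next
  case False
  have "(1 + a) ^ m \<le> (2 * a) ^ m" using assms False by (intro power_mono) auto
  also have "\<dots> = 2 ^ m * a ^ m" by (simp add: power_mult_distrib)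
  also have "\<dots> \<le> 2 ^ m * (1 + a ^ m)" by simp
  finally show ?thesis .
qed

context market
begin

lemma alpha_pos: "t < T \<Longrightarrow> w \<in> space (M t) \<Longrightarrow> alpha t w > 0"
  using alpha_meas by blast

lemma pre_space: "w \<in> space (M s) \<Longrightarrow> t \<le> s \<Longrightarrow> pre t w \<in> space (M t)"
  by (rule OmM_restrict(1))

definition growth :: "nat \<Rightarrow> (nat \<Rightarrow> 'a) \<Rightarrow> real" where
  "growth t v = (\<Prod>s = 1..t. 1 + norm (dS S s (pre s v)) / alpha (s - 1) (pre (s - 1) v))"

lemma growth_Suc: "growth (Suc t) v = growth t v * (1 + norm (dS S (Suc t) (pre (Suc t) v)) / alpha t (pre t v))"
  by (simp add: growth_def)

lemma growth_restrict: "t \<le> s \<Longrightarrow> growth t (pre s v) = growth t v"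
proof -
  assume "t \<le> s"
  then have "i - 1 \<le> s" "i \<le> s" if "i \<in> {1..t}" for i using that by auto
  then have "restrict (restrict v {1..s}) {1..i - 1} = restrict v {1..i - 1}"
    "restrict (restrict v {1..s}) {1..i} = restrict v {1..i}" if "i \<in> {1..t}" for i
    using that by (simp_all only: restrict_restrict_le)
  then show ?thesis unfolding growth_def by (intro prod.cong[OF refl]) (simp only:)
qed

lemma alpha_umeas: "t < T \<Longrightarrow> alpha t \<in> borel_measurable (universal (M t))"
  using alpha_meas unfolding univ_meas_iff by blast

lemma growth_umeas:
  assumes "t \<le> s" "s \<le> T"
  shows "growth t \<in> borel_measurable (universal (M s))"
  using assms(1)
proof (induction t)
  case 0
  then show ?case by (simp add: growth_def[abs_def])
next
  case (Suc t)
  then have [measurable]: "growth t \<in> borel_measurable (universal (M s))" by simp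
  have t: "t < T" using Suc.prems assms(2) by simp
  have [measurable]: "(\<lambda>w. alpha t (pre t w)) \<in> borel_measurable (universal (M s))"
    by (rule measurable_compose[OF pre_umeas alpha_umeas[OF t]]) (use Suc.prems in simp)
  have [measurable]: "(\<lambda>w. dS S (Suc t) (pre (Suc t) w)) \<in> borel_measurable (universal (M s))"
    by (rule measurable_compose[OF pre_umeas measurable_imp_univ[OF dS_borel[OF t]]]) (use Suc.prems in simp)
  show ?case unfolding growth_Suc[abs_def] by measurable
qed

lemma AE_space: "P \<in> Q T \<Longrightarrow> AE v in P. v \<in> space (M T)"
  using probsD(2)[OF Q_probs[OF order_refl]] by (intro AE_I2) simp

lemma increments_in_supp_AE:
  assumes P: "P \<in> Q T"
  shows "AE v in P. \<forall>t<T. dS S (Suc t) (pre (Suc t) v) \<in> supp t (pre t v)"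
proof -
  have "AE v in P. t < T \<longrightarrow> dS S (Suc t) (pre (Suc t) v) \<in> supp t (pre t v)" for t
  proof (cases "t < T")
    case True
    then have "AE v in P. dS S (Suc t) (pre (Suc t) v) \<in> supp t (pre t (pre (Suc t) v))"
      by (intro Q_marginal_AE[OF _ order_refl P] increment_in_supp) auto
    then have "AE v in P. dS S (Suc t) (pre (Suc t) v) \<in> supp t (pre t v)"
      by (simp only: restrict_restrict_le[OF le_SucI[OF order_refl]])
    then show ?thesis by (rule eventually_mono) simp
  qed simp
  then show ?thesis unfolding AE_all_countable by blast
qed

lemma hedgeable_path_AE:
  assumes phi: "phi \<in> Phi Om T" and nn: "\<And>P. P \<in> Q T \<Longrightarrow> AE w in P. V S T z phi w \<ge> 0" and P: "P \<in> Q T"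
  shows "AE v in P. \<forall>t<T. hedgeable t z phi (pre t v)"
proof -
  have "AE v in P. t < T \<longrightarrow> hedgeable t z phi (pre t v)" for t
  proof (cases "t < T")
    case True
    then have "AE v in P. hedgeable t z phi (pre t v)"
      by (intro Q_marginal_AE[OF _ order_refl P] hedgeable_AE[OF phi nn]) auto
    then show ?thesis by (rule eventually_mono) simp
  qed simp
  then show ?thesis unfolding AE_all_countable by blast
qed

lemma initial_wealth_nonneg:
  assumes phi: "phi \<in> Phi Om T" and nn: "\<And>P. P \<in> Q T \<Longrightarrow> AE w in P. V S T z phi w \<ge> 0"
  shows "z \<ge> 0"
proof -
  obtain P where P: "P \<in> Q T" using QQ_nonempty by blast
  have "AE w in P. V S 0 z phi w \<ge> 0" by (rule V_intermediate_nonneg[OF phi nn le0 P])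
  then have "AE w in P. z \<ge> 0" by (simp add: V_def)
  then show ?thesis using prob_space.AE_const[OF probsD(3)[OF Q_probs[OF order_refl P]]] by simp
qed

text \<open>On the support the position earns as much as its short representative, so Cauchy-Schwarz
  bounds one period's gain by the current wealth times the increment over
  \<open>alpha\<close>.\<close>

lemma wealth_le_growth:
  assumes phi: "phi \<in> Phi Om T" and nn: "\<And>P. P \<in> Q T \<Longrightarrow> AE w in P. V S T z phi w \<ge> 0" and P: "P \<in> Q T"
  shows "AE v in P. \<forall>t\<le>T. V S t z phi v \<le> z * growth t v"
proof -
  have hp: "AE v in P. \<forall>t<T. hedgeable t z phi (pre t v)" by (rule hedgeable_path_AE[OF phi nn P])
  from hp increments_in_supp_AE[OF P] AE_space[OF P] show ?thesis
  proof eventually_elim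
  case (elim v)
  show ?case
  proof (intro allI impI)
    fix t assume "t \<le> T"
    then show "V S t z phi v \<le> z * growth t v"
    proof (induction t)
      case 0
      then show ?case by (simp add: V_def growth_def)
    next
      case (Suc t)
      then have t: "t < T" and IH: "V S t z phi v \<le> z * growth t v" by auto
      let ?w = "pre t v" and ?x = "dS S (Suc t) (pre (Suc t) v)"
      have "hedgeable t z phi ?w" using elim(1) t by blast
      then obtain h where h: "\<forall>x\<in>supp t ?w. h \<bullet> x = phi (Suc t) ?w \<bullet> x" "norm h \<le> V S t z phi v / alpha t ?w"
        unfolding hedgeable_def V_restrict[OF order_refl] by blast
      have "?x \<in> supp t ?w" using elim(2) t by blast
      then have "phi (Suc t) ?w \<bullet> ?x = h \<bullet> ?x" using h(1) by simp
      also have "\<dots> \<le> norm h * norm ?x" by (rule norm_cauchy_schwarz)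
      also have "\<dots> \<le> V S t z phi v / alpha t ?w * norm ?x" using h(2) by (intro mult_right_mono) auto
      finally have "V S (Suc t) z phi v \<le> V S t z phi v * (1 + norm ?x / alpha t ?w)"
        unfolding V_Suc by (simp add: algebra_simps)
      also have "\<dots> \<le> z * growth t v * (1 + norm ?x / alpha t ?w)"
        using IH alpha_pos[OF t pre_space[OF elim(3) less_imp_le[OF t]]] by (intro mult_right_mono) auto
      finally show ?case unfolding growth_Suc by (simp add: mult.assoc)
    qed
  qed
  qed
qed

text \<open>The moment hypotheses concern models at time t. Marginals of models at horizon T are
  such models, so the same bound serves at T.\<close>

lemma moment_marginal:
  fixes X :: "(nat \<Rightarrow> 'a) \<Rightarrow> 'b::{real_normed_vector, second_countable_topology}"
  assumes t: "t \<le> T" and X: "Wr Om QR t (real m) X" and m: "m > 0"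
  shows "\<exists>K<\<infinity>. \<forall>P\<in>Q T. (\<integral>\<^sup>+ v. ennreal (norm (X (pre t v)) ^ m) \<partial>P) \<le> K"
proof (intro exI[of _ "SUP P\<in>Q t. \<integral>\<^sup>+ w. ennreal (norm (X w) powr real m) \<partial>(completion P)"] conjI ballI)
  show "(SUP P\<in>Q t. \<integral>\<^sup>+ w. ennreal (norm (X w) powr real m) \<partial>(completion P)) < \<infinity>"
    using X by (simp add: Wr_def)
  fix P assume P: "P \<in> Q T"
  have Xm [measurable]: "X \<in> borel_measurable (universal (M t))" using X by (simp add: Wr_def univ_meas_iff)
  have eq: "norm (X w) ^ m = norm (X w) powr real m" for w
    using m by (cases "X w = 0") (simp_all add: powr_realpow)
  have "(\<integral>\<^sup>+ v. ennreal (norm (X (pre t v)) ^ m) \<partial>P) = (\<integral>\<^sup>+ w. ennreal (norm (X w) ^ m) \<partial>(distr P (M t) (pre t)))"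
    by (rule nn_integral_distr_universal[OF pre_meas_Q[OF t order_refl P] probsD(3)[OF Q_probs[OF order_refl P]]]) measurable
  also have "\<dots> = (\<integral>\<^sup>+ w. ennreal (norm (X w) powr real m) \<partial>(completion (distr P (M t) (pre t))))"
    unfolding nn_integral_completion eq ..
  also have "\<dots> \<le> (SUP P\<in>Q t. \<integral>\<^sup>+ w. ennreal (norm (X w) powr real m) \<partial>(completion P))"
    by (rule SUP_upper[OF Q_marginal[OF t order_refl P]])
  finally show "(\<integral>\<^sup>+ v. ennreal (norm (X (pre t v)) ^ m) \<partial>P) \<le> (SUP P\<in>Q t. \<integral>\<^sup>+ w. ennreal (norm (X w) powr real m) \<partial>(completion P))" .
qed

text \<open>Increments and reciprocals of \<open>alpha\<close> are separated because their moments
  are controlled separately. The T factors produce T-th powers of products of two terms, and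
  splitting a product into squares doubles the exponent to 2T.\<close>

lemma growth_le_sum_powers:
  assumes v: "v \<in> space (M T)"
  shows "growth T v \<le> (\<Sum>s = 1..T. 2 ^ (2 * T) * (1 + norm (dS S s (pre s v)) ^ (2 * T))
    + 2 ^ (2 * T) * (1 + norm (1 / alpha (s - 1) (pre (s - 1) v)) ^ (2 * T)))"
proof -
  define a where "a s = norm (dS S s (pre s v))" for s
  define b where "b s = norm (1 / alpha (s - 1) (pre (s - 1) v))" for s
  have b: "b s = 1 / alpha (s - 1) (pre (s - 1) v)" if "s \<in> {1..T}" for s
  proof -
    have "alpha (s - 1) (pre (s - 1) v) > 0"
      using that by (intro alpha_pos pre_space[OF v]) auto
    then show ?thesis by (simp add: b_def)
  qed
  have ab: "a s \<ge> 0" "b s \<ge> 0" for s by (simp_all add: a_def b_def)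
  have "growth T v = (\<Prod>s = 1..T. 1 + a s * b s)"
    unfolding growth_def by (intro prod.cong[OF refl]) (simp only: b, simp add: a_def)
  also have "\<dots> \<le> (\<Prod>s = 1..T. (1 + a s) * (1 + b s))"
    using ab by (intro prod_mono) (auto simp: algebra_simps)
  also have "\<dots> \<le> (\<Sum>s = 1..T. ((1 + a s) * (1 + b s)) ^ card {1..T})"
    using T_pos ab by (intro prod_le_sum_powers) auto
  also have "\<dots> \<le> (\<Sum>s = 1..T. 2 ^ (2 * T) * (1 + a s ^ (2 * T)) + 2 ^ (2 * T) * (1 + b s ^ (2 * T)))"
  proof (rule sum_mono)
    fix s
    have "((1 + a s) * (1 + b s)) ^ card {1..T} = (1 + a s) ^ T * (1 + b s) ^ T" by (simp add: power_mult_distrib)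
    also have "\<dots> \<le> ((1 + a s) ^ T)\<^sup>2 + ((1 + b s) ^ T)\<^sup>2"
    proof -
      have "x * y \<le> x\<^sup>2 + y\<^sup>2" if "x \<ge> 0" "y \<ge> 0" for x y :: real
        using sum_squares_ge_zero[of "x - y" 0] mult_nonneg_nonneg[OF that]
        by (simp add: power2_eq_square algebra_simps)
      then show ?thesis using ab[of s] by simp
    qed
    also have "\<dots> = (1 + a s) ^ (2 * T) + (1 + b s) ^ (2 * T)" by (simp add: power_mult[symmetric] mult.commute)
    also have "\<dots> \<le> 2 ^ (2 * T) * (1 + a s ^ (2 * T)) + 2 ^ (2 * T) * (1 + b s ^ (2 * T))"
      by (intro add_mono one_plus_power_le ab)
    finally show "((1 + a s) * (1 + b s)) ^ card {1..T} \<le> 2 ^ (2 * T) * (1 + a s ^ (2 * T)) + 2 ^ (2 * T) * (1 + b s ^ (2 * T))" .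
  qed
  finally show ?thesis unfolding a_def b_def .
qed

lemma growth_moment: "\<exists>C\<ge>0. \<forall>P\<in>Q T. (\<integral>\<^sup>+ v. ennreal (growth T v) \<partial>P) \<le> ennreal C"
proof -
  let ?m = "2 * T"
  have m: "?m > 0" using T_pos by simp
  define A where "A s v = norm (dS S s (pre s v)) ^ ?m" for s v
  define B where "B s v = norm (1 / alpha (s - 1) (pre (s - 1) v)) ^ ?m" for s v
  have "\<exists>K. s \<in> {1..T} \<longrightarrow> K < \<infinity> \<and> (\<forall>P\<in>Q T. (\<integral>\<^sup>+ v. ennreal (A s v) \<partial>P) \<le> K)" for s
  proof (cases "s \<in> {1..T}")
    case True
    have "Wr Om QR s (real ?m) (dS S s)" using moments m True by (metis of_nat_0_less_iff)
    from moment_marginal[OF _ this m] True show ?thesis unfolding A_def by (auto intro: exI)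
  qed auto
  then obtain KA where KA: "\<And>s. s \<in> {1..T} \<Longrightarrow> KA s < \<infinity> \<and> (\<forall>P\<in>Q T. (\<integral>\<^sup>+ v. ennreal (A s v) \<partial>P) \<le> KA s)" by metis
  have "\<exists>K. s \<in> {1..T} \<longrightarrow> K < \<infinity> \<and> (\<forall>P\<in>Q T. (\<integral>\<^sup>+ v. ennreal (B s v) \<partial>P) \<le> K)" for s
  \<comment> \<open>The moment hypothesis on \<open>alpha\<close> starts at time 1. For s = 1 the
    factor is \<open>alpha 0\<close> on the one-point path space, a constant.\<close>
  proof (cases "s \<in> {2..T}")
    case True
    then have "s - 1 \<in> {1..T - 1}" "s - 1 \<le> T" by auto
    then have "Wr Om QR (s - 1) (real ?m) (\<lambda>w. 1 / alpha (s - 1) w)" using moments m by (metis of_nat_0_less_iff)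
    from moment_marginal[OF _ this m] \<open>s - 1 \<le> T\<close> show ?thesis unfolding B_def by (auto intro: exI)
  next
    case False
    have "B s v = norm (1 / alpha 0 (\<lambda>_. undefined)) ^ ?m" if "s = 1" for v
      by (simp add: B_def that fun_eq_iff restrict_def)
    then have "(\<integral>\<^sup>+ v. ennreal (B s v) \<partial>P) = ennreal (norm (1 / alpha 0 (\<lambda>_. undefined)) ^ ?m)" if "s = 1" "P \<in> Q T" for P
      using prob_space.emeasure_space_1[OF probsD(3)[OF Q_probs[OF order_refl that(2)]]] that(1) by simp
    note B1 = this
    show ?thesis
    proof (cases "s = 1")
      case True
      then show ?thesis using B1
        by (intro exI[of _ "ennreal (norm (1 / alpha 0 (\<lambda>_. undefined)) ^ ?m)"] impI conjI ballI) simp_all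
    next
      case False
      with \<open>s \<notin> {2..T}\<close> show ?thesis by auto
    qed
  qed
  then obtain KB where KB: "\<And>s. s \<in> {1..T} \<Longrightarrow> KB s < \<infinity> \<and> (\<forall>P\<in>Q T. (\<integral>\<^sup>+ v. ennreal (B s v) \<partial>P) \<le> KB s)" by metis
  define K where "K = (\<Sum>s = 1..T. ennreal (2 ^ ?m) * (1 + KA s) + ennreal (2 ^ ?m) * (1 + KB s))"
  have "K < \<infinity>" unfolding K_def using KA KB by (auto simp: ennreal_mult_less_top)
  have bound: "(\<integral>\<^sup>+ v. ennreal (growth T v) \<partial>P) \<le> K" if P: "P \<in> Q T" for P
  proof -
    note PP = Q_probs[OF order_refl P]
    \<comment> \<open>The summands are only universally measurable, so linearity of the integral is
      applied under the completion.\<close>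
    interpret C: prob_space "completion P" by (rule prob_space.prob_space_completion[OF probsD(3)[OF PP]])
    have A [measurable]: "A s \<in> borel_measurable (completion P)" if "s \<in> {1..T}" for s
    proof -
      have "(\<lambda>v. dS S s (pre s v)) \<in> borel_measurable (universal (M T))"
        using that dS_borel[of "s - 1"] by (intro measurable_compose[OF pre_umeas measurable_imp_univ]) auto
      from measurable_univ_completion[OF this PP] show ?thesis unfolding A_def by measurable
    qed
    have B [measurable]: "B s \<in> borel_measurable (completion P)" if "s \<in> {1..T}" for s
    proof -
      have "(\<lambda>v. alpha (s - 1) (pre (s - 1) v)) \<in> borel_measurable (universal (M T))"
        using that by (intro measurable_compose[OF pre_umeas alpha_umeas]) auto
      from measurable_univ_completion[OF this PP] show ?thesis unfolding B_def by measurable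
    qed
    have "(\<integral>\<^sup>+ v. ennreal (growth T v) \<partial>P) = (\<integral>\<^sup>+ v. ennreal (growth T v) \<partial>completion P)"
      by (rule nn_integral_completion[symmetric])
    also have "\<dots> \<le> (\<integral>\<^sup>+ v. (\<Sum>s = 1..T. ennreal (2 ^ ?m) * (1 + ennreal (A s v)) + ennreal (2 ^ ?m) * (1 + ennreal (B s v))) \<partial>completion P)"
    proof (rule nn_integral_mono)
      fix v assume "v \<in> space (completion P)"
      then have "v \<in> space (M T)" using probsD(2)[OF PP] by simp
      from growth_le_sum_powers[OF this]
      have "ennreal (growth T v) \<le> ennreal (\<Sum>s = 1..T. 2 ^ ?m * (1 + A s v) + 2 ^ ?m * (1 + B s v))"
        unfolding A_def B_def by (rule ennreal_leI)
      also have "\<dots> = (\<Sum>s = 1..T. ennreal (2 ^ ?m * (1 + A s v) + 2 ^ ?m * (1 + B s v)))"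
        by (intro sum_ennreal[symmetric]) (simp add: A_def B_def)
      also have "\<dots> = (\<Sum>s = 1..T. ennreal (2 ^ ?m) * (1 + ennreal (A s v)) + ennreal (2 ^ ?m) * (1 + ennreal (B s v)))"
      proof (rule sum.cong[OF refl])
        fix s
        have "A s v \<ge> 0" "B s v \<ge> 0" by (simp_all add: A_def B_def)
        then show "ennreal (2 ^ ?m * (1 + A s v) + 2 ^ ?m * (1 + B s v))
          = ennreal (2 ^ ?m) * (1 + ennreal (A s v)) + ennreal (2 ^ ?m) * (1 + ennreal (B s v))"
          by (simp add: ennreal_plus ennreal_mult ennreal_1[symmetric] del: ennreal_1)
      qed
      finally show "ennreal (growth T v) \<le> (\<Sum>s = 1..T. ennreal (2 ^ ?m) * (1 + ennreal (A s v)) + ennreal (2 ^ ?m) * (1 + ennreal (B s v)))" .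
    qed
    also have "\<dots> = (\<Sum>s = 1..T. ennreal (2 ^ ?m) * (1 + (\<integral>\<^sup>+ v. ennreal (A s v) \<partial>completion P))
        + ennreal (2 ^ ?m) * (1 + (\<integral>\<^sup>+ v. ennreal (B s v) \<partial>completion P)))"
    proof (subst nn_integral_sum)
      show "(\<Sum>s = 1..T. \<integral>\<^sup>+ v. ennreal (2 ^ ?m) * (1 + ennreal (A s v)) + ennreal (2 ^ ?m) * (1 + ennreal (B s v)) \<partial>completion P) =
        (\<Sum>s = 1..T. ennreal (2 ^ ?m) * (1 + (\<integral>\<^sup>+ v. ennreal (A s v) \<partial>completion P))
        + ennreal (2 ^ ?m) * (1 + (\<integral>\<^sup>+ v. ennreal (B s v) \<partial>completion P)))"
      proof (rule sum.cong[OF refl])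
        fix s assume s: "s \<in> {1..T}"
        note [measurable] = A[OF s] B[OF s]
        show "(\<integral>\<^sup>+ v. ennreal (2 ^ ?m) * (1 + ennreal (A s v)) + ennreal (2 ^ ?m) * (1 + ennreal (B s v)) \<partial>completion P) =
          ennreal (2 ^ ?m) * (1 + (\<integral>\<^sup>+ v. ennreal (A s v) \<partial>completion P)) + ennreal (2 ^ ?m) * (1 + (\<integral>\<^sup>+ v. ennreal (B s v) \<partial>completion P))"
          using C.emeasure_space_1 by (simp add: nn_integral_add nn_integral_cmult)
      qed
    next
      fix s assume s: "s \<in> {1..T}"
      note [measurable] = A[OF s] B[OF s]
      show "(\<lambda>v. ennreal (2 ^ ?m) * (1 + ennreal (A s v)) + ennreal (2 ^ ?m) * (1 + ennreal (B s v))) \<in> borel_measurable (completion P)"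
        by measurable
    qed
    also have "\<dots> \<le> K"
      unfolding K_def nn_integral_completion using KA KB P
      by (intro sum_mono add_mono mult_left_mono add_left_mono) auto
    finally show ?thesis .
  qed
  show ?thesis
    by (intro exI[of _ "enn2real K"] conjI ballI) (use bound \<open>K < \<infinity>\<close> in \<open>simp_all add: ennreal_enn2real_if\<close>)
qed

text \<open>The order of quantifiers is the point: one constant serves all capitals, all strategies
  with nonnegative final wealth and all models.\<close>

lemma wealth_moment:
  "\<exists>C\<ge>0. \<forall>z phi P. phi \<in> Phi Om T \<longrightarrow> (\<forall>P\<in>Q T. AE w in P. V S T z phi w \<ge> 0) \<longrightarrow> P \<in> Q T \<longrightarrow>
    (\<integral>\<^sup>+ v. ennreal (V S T z phi v) \<partial>P) \<le> ennreal (z * C)"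
proof -
  obtain C where C: "C \<ge> 0" "\<And>P. P \<in> Q T \<Longrightarrow> (\<integral>\<^sup>+ v. ennreal (growth T v) \<partial>P) \<le> ennreal C"
    using growth_moment by blast
  show ?thesis
  proof (intro exI[of _ C] conjI allI impI C(1))
    fix z phi P assume phi: "phi \<in> Phi Om T" and nn': "\<forall>P\<in>Q T. AE w in P. V S T z phi w \<ge> 0" and P: "P \<in> Q T"
    have nn: "\<And>P. P \<in> Q T \<Longrightarrow> AE w in P. V S T z phi w \<ge> 0" using nn' by blast
    have z: "z \<ge> 0" by (rule initial_wealth_nonneg[OF phi nn])
    have [measurable]: "growth T \<in> borel_measurable (completion P)"
      by (rule measurable_univ_completion[OF growth_umeas[OF order_refl order_refl] Q_probs[OF order_refl P]])
    have "(\<integral>\<^sup>+ v. ennreal (V S T z phi v) \<partial>P) \<le> (\<integral>\<^sup>+ v. ennreal (z * growth T v) \<partial>P)"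
      using wealth_le_growth[OF phi nn P]
      by (intro nn_integral_mono_AE) (auto elim!: eventually_mono intro!: ennreal_leI)
    also have "\<dots> = (\<integral>\<^sup>+ v. ennreal z * ennreal (growth T v) \<partial>completion P)"
      using z by (simp add: nn_integral_completion ennreal_mult')
    also have "\<dots> = ennreal z * (\<integral>\<^sup>+ v. ennreal (growth T v) \<partial>completion P)" by (rule nn_integral_cmult) measurable
    also have "\<dots> \<le> ennreal z * ennreal C"
      unfolding nn_integral_completion using C(2)[OF P] by (intro mult_left_mono) auto
    also have "\<dots> = ennreal (z * C)" using z by (simp add: ennreal_mult')
    finally show "(\<integral>\<^sup>+ v. ennreal (V S T z phi v) \<partial>P) \<le> ennreal (z * C)" .
  qed
qed

end

subsection \<open>Measurable selection of cluster points\<close>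

text \<open>The upper limit along the indices where the error is small is a cluster point; it replaces the usual
  measurable random subsequences.\<close>
lemma cluster_selection_real:
  fixes e f :: "nat \<Rightarrow> 'w \<Rightarrow> real"
  assumes [measurable]: "\<And>n. e n \<in> borel_measurable M" "\<And>n. f n \<in> borel_measurable M"
  shows "\<exists>g\<in>borel_measurable M. \<forall>w. (\<forall>k. \<exists>n\<ge>k. e n w < 1 / real (Suc k)) \<longrightarrow> bounded (range (\<lambda>n. f n w)) \<longrightarrow>
    (\<forall>k. \<exists>n\<ge>k. e n w < 1 / real (Suc k) \<and> \<bar>f n w - g w\<bar> < 1 / real (Suc k))"
proof -
  \<comment> \<open>Rejected indices receive infinity, so the infimum runs over the accepted ones.
    Acceptance tightens with k, hence these infima increase, and their supremum is a cluster
    value.\<close>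
  define x where "x k w = (INF n. if k \<le> n \<and> e n w < 1 / real (Suc k) then ereal (f n w) else \<infinity>)" for k w
  define g where "g w = real_of_ereal (SUP k. x k w)" for w
  have "g \<in> borel_measurable M" unfolding g_def x_def by measurable
  moreover have "\<exists>n\<ge>k. e n w < 1 / real (Suc k) \<and> \<bar>f n w - g w\<bar> < 1 / real (Suc k)"
    if e: "\<forall>k. \<exists>n\<ge>k. e n w < 1 / real (Suc k)" and bd: "bounded (range (\<lambda>n. f n w))" for w k
  proof -
    obtain B where B: "\<And>n. \<bar>f n w\<bar> \<le> B" using bd unfolding bounded_iff by auto
    have lower: "x k w \<le> ereal (f n w)" if "k \<le> n" "e n w < 1 / real (Suc k)" for k n
      unfolding x_def using that by (intro INF_lower2[of n]) auto
    have "- ereal B \<le> x k w" for k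
    proof -
      have "- B \<le> f n w" for n using B[of n] by (simp add: abs_le_iff)
      then show ?thesis unfolding x_def by (intro INF_greatest) auto
    qed
    moreover have "x k w \<le> ereal B" for k
    proof -
      obtain n where n: "n \<ge> k" "e n w < 1 / real (Suc k)" using e by blast
      have "ereal (f n w) \<le> ereal B" using B[of n] by (simp add: abs_le_iff)
      with lower[OF n] show ?thesis by (rule order_trans)
    qed
    ultimately have "- ereal B \<le> (SUP k. x k w)" "(SUP k. x k w) \<le> ereal B"
      by (auto intro: SUP_least intro!: SUP_upper2[of 0])
    then have g: "(SUP k. x k w) = ereal (g w)"
      unfolding g_def by (intro ereal_real'[symmetric]) (auto simp: abs_eq_infinity_cases)
    have mono: "x k w \<le> x k' w" if "k \<le> k'" for k k'
    proof -
      have "1 / real (Suc k') \<le> 1 / real (Suc k)" using that by (intro divide_left_mono) auto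
      then show ?thesis unfolding x_def using that by (intro INF_mono') (auto simp: )
    qed
    define d where "d = 1 / real (Suc k)"
    have "d > 0" by (simp add: d_def)
    then have "ereal (g w - d) < (SUP k. x k w)" unfolding g by simp
    then obtain j where j: "ereal (g w - d) < x j w" by (auto simp: less_SUP_iff)
    \<comment> \<open>Beyond j the infima are already within d below the supremum; beyond k the
      accepted indices meet the required tolerance.\<close>
    define K where "K = max j k"
    have K: "ereal (g w - d) < x K w" using j mono[of j K] by (simp add: K_def less_le_trans)
    have "x K w \<le> ereal (g w)" unfolding g[symmetric] by (rule SUP_upper) simp
    also have "\<dots> < ereal (g w + d)" using \<open>d > 0\<close> by simp
    finally have "x K w < ereal (g w + d)" .
    then obtain n where n: "(if K \<le> n \<and> e n w < 1 / real (Suc K) then ereal (f n w) else \<infinity>) < ereal (g w + d)"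
      unfolding x_def INF_less_iff by blast
    then have n': "K \<le> n" "e n w < 1 / real (Suc K)" "f n w < g w + d" by (auto split: if_splits)
    have "1 / real (Suc K) \<le> 1 / real (Suc k)" by (intro divide_left_mono) (auto simp: K_def)
    moreover have "g w - d < f n w" using less_le_trans[OF K lower[OF n'(1,2)]] by simp
    ultimately show ?thesis using n' by (intro exI[of _ n]) (auto simp: K_def d_def abs_less_iff)
  qed
  ultimately show ?thesis by (intro bexI[of _ g] allI impI)
qed

text \<open>Working at index 2k + 1 halves the tolerance, so two errors together stay below the
  tolerance of index k.\<close>

lemma half_tolerance: "1 / real (Suc (2 * k + 1)) = 1 / real (Suc k) / 2"
  by (simp add: field_simps)

text \<open>Coordinates are treated one at a time. The distance of the coordinates already treated
  is merged into the error e', so that the next cluster value is reached along the same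
  indices.\<close>

lemma cluster_selection:
  fixes e :: "nat \<Rightarrow> 'w \<Rightarrow> real" and f :: "nat \<Rightarrow> 'w \<Rightarrow> 'b::euclidean_space"
  assumes e [measurable]: "\<And>n. e n \<in> borel_measurable M" and f [measurable]: "\<And>n. f n \<in> borel_measurable M"
  shows "\<exists>g\<in>borel_measurable M. \<forall>w. (\<forall>k. \<exists>n\<ge>k. e n w < 1 / real (Suc k)) \<longrightarrow> bounded (range (\<lambda>n. f n w)) \<longrightarrow>
    (\<forall>k. \<exists>n\<ge>k. e n w < 1 / real (Suc k) \<and> norm (f n w - g w) < 1 / real (Suc k))"
proof -
  have "\<exists>g. (\<forall>i\<in>I. g i \<in> borel_measurable M) \<and> (\<forall>w. (\<forall>k. \<exists>n\<ge>k. e n w < 1 / real (Suc k)) \<longrightarrow> bounded (range (\<lambda>n. f n w)) \<longrightarrow>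
    (\<forall>k. \<exists>n\<ge>k. e n w < 1 / real (Suc k) \<and> (\<Sum>i\<in>I. \<bar>f n w \<bullet> i - g i w\<bar>) < 1 / real (Suc k)))"
    if "finite I" for I :: "'b set"
    using that
  proof (induction I rule: finite_induct)
    case empty
    then show ?case by simp
  next
    case (insert i I)
    then obtain g where g: "\<And>j. j \<in> I \<Longrightarrow> g j \<in> borel_measurable M"
      "\<And>w k. \<forall>k. \<exists>n\<ge>k. e n w < 1 / real (Suc k) \<Longrightarrow> bounded (range (\<lambda>n. f n w)) \<Longrightarrow>
        \<exists>n\<ge>k. e n w < 1 / real (Suc k) \<and> (\<Sum>i\<in>I. \<bar>f n w \<bullet> i - g i w\<bar>) < 1 / real (Suc k)" by blast
    define e' where "e' n w = max (e n w) (\<Sum>i\<in>I. \<bar>f n w \<bullet> i - g i w\<bar>)" for n w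
    have "(\<lambda>w. \<Sum>i\<in>I. \<bar>f n w \<bullet> i - g i w\<bar>) \<in> borel_measurable M" for n
    proof (rule borel_measurable_sum)
      fix j assume "j \<in> I"
      note [measurable] = g(1)[OF this]
      show "(\<lambda>w. \<bar>f n w \<bullet> j - g j w\<bar>) \<in> borel_measurable M" by measurable
    qed
    then have e': "e' n \<in> borel_measurable M" for n unfolding e'_def by measurable
    have fi: "(\<lambda>w. f n w \<bullet> i) \<in> borel_measurable M" for n by measurable
    obtain gi where gi: "gi \<in> borel_measurable M"
      "\<forall>w. (\<forall>k. \<exists>n\<ge>k. e' n w < 1 / real (Suc k)) \<longrightarrow> bounded (range (\<lambda>n. f n w \<bullet> i)) \<longrightarrow>
       (\<forall>k. \<exists>n\<ge>k. e' n w < 1 / real (Suc k) \<and> \<bar>f n w \<bullet> i - gi w\<bar> < 1 / real (Suc k))"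
      using cluster_selection_real[of e' M "\<lambda>n w. f n w \<bullet> i", OF e' fi] ..
    show ?case
    proof (intro exI[of _ "g(i := gi)"] conjI ballI allI impI)
      show "(g(i := gi)) j \<in> borel_measurable M" if "j \<in> insert i I" for j using that g(1) gi(1) by auto
      fix w k assume ew: "\<forall>k. \<exists>n\<ge>k. e n w < 1 / real (Suc k)" and bd: "bounded (range (\<lambda>n. f n w))"
      have "\<exists>n\<ge>k. e' n w < 1 / real (Suc k)" for k using g(2)[OF ew bd, of k] unfolding e'_def by simp
      moreover have "bounded (range (\<lambda>n. f n w \<bullet> i))"
      proof -
        obtain B where B: "\<And>n. norm (f n w) \<le> B" using bd unfolding bounded_iff by auto
        have "norm (f n w \<bullet> i) \<le> B * norm i" for n
          using Cauchy_Schwarz_ineq2[of "f n w" i] mult_right_mono[OF B[of n], of "norm i"] by simp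
        then show ?thesis unfolding bounded_iff by auto
      qed
      ultimately obtain n where n: "n \<ge> 2 * k + 1" "e' n w < 1 / real (Suc (2 * k + 1))"
        "\<bar>f n w \<bullet> i - gi w\<bar> < 1 / real (Suc (2 * k + 1))" using gi(2) by blast
      have "(\<Sum>j\<in>insert i I. \<bar>f n w \<bullet> j - (g(i := gi)) j w\<bar>) = \<bar>f n w \<bullet> i - gi w\<bar> + (\<Sum>j\<in>I. \<bar>f n w \<bullet> j - g j w\<bar>)"
        using insert.hyps by (auto intro!: sum.cong)
      moreover have "1 / real (Suc k) > 0" by simp
      ultimately show "\<exists>n\<ge>k. e n w < 1 / real (Suc k) \<and> (\<Sum>j\<in>insert i I. \<bar>f n w \<bullet> j - (g(i := gi)) j w\<bar>) < 1 / real (Suc k)"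
        using n unfolding e'_def half_tolerance by (intro exI[of _ n]) (auto simp: field_simps)
    qed
  qed
  from this[OF finite_Basis] obtain g where g: "\<And>j. j \<in> Basis \<Longrightarrow> g j \<in> borel_measurable M"
    "\<And>w k. \<forall>k. \<exists>n\<ge>k. e n w < 1 / real (Suc k) \<Longrightarrow> bounded (range (\<lambda>n. f n w)) \<Longrightarrow>
        \<exists>n\<ge>k. e n w < 1 / real (Suc k) \<and> (\<Sum>i\<in>Basis. \<bar>f n w \<bullet> i - g i w\<bar>) < 1 / real (Suc k)" by blast
  define G where "G w = (\<Sum>i\<in>Basis. g i w *\<^sub>R i)" for w
  have "G \<in> borel_measurable M"
    unfolding G_def by (intro borel_measurable_sum borel_measurable_scaleR g(1) measurable_const) auto
  moreover have "norm (f n w - G w) \<le> (\<Sum>i\<in>Basis. \<bar>f n w \<bullet> i - g i w\<bar>)" for n w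
  proof -
    have "G w \<bullet> i = g i w" if "i \<in> Basis" for i using that by (simp add: G_def)
    then show ?thesis using norm_le_l1[of "f n w - G w"] by (simp add: inner_diff_left)
  qed
  ultimately show ?thesis using g(2) by (intro bexI[of _ G] allI impI) (meson le_less_trans)
qed

subsection \<open>Closedness of the set of superhedged claims\<close>

lemma le_if_le_add_multiples:
  fixes A B K :: real
  assumes "K \<ge> 0" "\<And>e. e > 0 \<Longrightarrow> A \<le> B + e * K"
  shows "A \<le> B"
proof (rule field_le_epsilon)
  fix e :: real assume "e > 0"
  then have "A \<le> B + e / (K + 1) * K" using assms by (intro assms(2)) simp
  also have "e / (K + 1) * K \<le> e" using assms(1) \<open>e > 0\<close> by (simp add: field_simps)
  finally show "A \<le> B + e" by simp
qed

context market
begin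

text \<open>A charged ball cannot be disjoint from a set of full measure. This carries conditions
  stated through charged balls over to points of the support.\<close>

lemma Z_meets_supp:
  assumes t: "t < T" and w: "w \<in> Z t k"
  shows "\<exists>x\<in>supp t w. x \<in> ball (c k) (r k)"
proof -
  obtain P where P: "w \<in> space (M t)" "P \<in> QR (Suc t) w" "charged Om t w (E t k) P" using w by (auto simp: Z_def)
  note P' = probsD[OF QRD(2)[OF t P(1,2)]]
  let ?N = "{y \<in> topspace (Om (Suc t)). w(Suc t := y) \<in> E t k}"
  have pos: "emeasure P ?N > 0" using P(3) by (simp add: charged_def)
  have "\<exists>y\<in>?N. dS S (Suc t) (w(Suc t := y)) \<in> supp t w"
  proof (rule ccontr)
    assume neg: "\<not> ?thesis"
    have "?N \<in> sets P" by (rule emeasure_neq_0_sets) (use pos in auto)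
    moreover have "AE y in P. y \<notin> ?N" using supp_full[OF t P(1,2)] by (rule eventually_mono) (use neg in blast)
    ultimately have "emeasure P ?N = 0" by (rule emeasure_eq_0_if_AE_not_in)
    with pos show False by simp
  qed
  then show ?thesis by (auto simp: E_def)
qed

text \<open>The growth bound on the short representative, enlarged by 1 to leave room for rounding
  to a centre; the absolute value keeps it positive on every path.\<close>

definition radius :: "real \<Rightarrow> nat \<Rightarrow> (nat \<Rightarrow> 'a) \<Rightarrow> real" where
  "radius z t w = \<bar>z * growth t w / alpha t w\<bar> + 1"

text \<open>A countable, hence measurable, form of the condition that the centre \<open>c j\<close>
  and the position differ by at most e times the norm of x on the support. It is tested at centres
  of charged balls; the terms with \<open>r k\<close> pay for the distance to the support.\<close>

definition admissible_index :: "real \<Rightarrow> real \<Rightarrow> ((nat \<Rightarrow> 'a) \<Rightarrow> real^'d) \<Rightarrow> nat \<Rightarrow> (nat \<Rightarrow> 'a) \<Rightarrow> nat \<Rightarrow> bool" where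
  "admissible_index e z f t w j \<longleftrightarrow> norm (c j) \<le> radius z t w \<and>
    (\<forall>k. w \<in> Z t k \<longrightarrow> \<bar>(f w - c j) \<bullet> c k\<bar> \<le> (norm (c k) + r k) * e + norm (f w - c j) * r k)"

text \<open>A bounded replacement of a strategy that is equivalent to it, up to a relative error e,
  on the conditional support. Picking it from a countable dense set keeps it measurable.\<close>
definition reduced :: "real \<Rightarrow> real \<Rightarrow> ((nat \<Rightarrow> 'a) \<Rightarrow> real^'d) \<Rightarrow> nat \<Rightarrow> (nat \<Rightarrow> 'a) \<Rightarrow> real^'d" where
  "reduced e z f t w = (if \<exists>j. admissible_index e z f t w j then c (LEAST j. admissible_index e z f t w j) else 0)"

lemma norm_reduced: "norm (reduced e z f t w) \<le> radius z t w"
proof (cases "\<exists>j. admissible_index e z f t w j")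
  case True
  have "norm (c j) \<le> radius z t w" if "admissible_index e z f t w j" for j
    using that by (simp add: admissible_index_def)
  from this[OF LeastI_ex[OF True]] True show ?thesis by (simp add: reduced_def)
qed (simp add: reduced_def radius_def)

lemma reduced_umeas:
  assumes t: "t < T" and [measurable]: "f \<in> borel_measurable (universal (M t))"
  shows "reduced e z f t \<in> borel_measurable (universal (M t))"
proof -
  note [measurable] = growth_umeas[OF order_refl less_imp_le[OF t]] alpha_umeas[OF t] Z_sets[OF t]
  have [measurable]: "Measurable.pred (universal (M t)) (\<lambda>w. admissible_index e z f t w j)" for j
    unfolding admissible_index_def radius_def by measurable
  have c: "c \<in> count_space UNIV \<rightarrow>\<^sub>M borel" by simp
  have [measurable]: "(\<lambda>w. c (LEAST j. admissible_index e z f t w j)) \<in> borel_measurable (universal (M t))"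
    by (rule measurable_compose[OF _ c]) measurable
  show ?thesis unfolding reduced_def by measurable
qed

text \<open>The centre is taken within min 1 e of the short representative: distance 1 respects the
  radius, distance e the error. Each charged ball contains a point of the support, where position
  and representative agree.\<close>

lemma admissible_index_exists:
  assumes t: "t < T" and w: "w \<in> space (M t)" and h: "hedgeable t z phi w" and V: "V S t z phi w \<le> z * growth t w" and e: "e > 0"
  shows "\<exists>j. admissible_index e z (phi (Suc t)) t w j"
proof -
  let ?f = "phi (Suc t) w"
  obtain h where h: "\<forall>x\<in>supp t w. h \<bullet> x = ?f \<bullet> x" "norm h \<le> V S t z phi w / alpha t w"
    using h by (auto simp: hedgeable_def)
  have "norm h \<le> z * growth t w / alpha t w"
    using h(2) divide_right_mono[OF V, of "alpha t w"] alpha_pos[OF t w] by simp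
  from order_trans[OF this abs_ge_self] have hR: "norm h + 1 \<le> radius z t w"
    unfolding radius_def by (rule add_right_mono)
  obtain j where j: "r j < min 1 e" "dist h (c j) < r j" using balls(2)[of "min 1 e" h] e by auto
  show ?thesis
  proof (intro exI[of _ j], unfold admissible_index_def, intro conjI allI impI)
    have "norm (c j) \<le> norm h + dist h (c j)" by (metis dist_norm norm_minus_commute norm_triangle_sub)
    then show "norm (c j) \<le> radius z t w" using hR j by simp
    fix k assume "w \<in> Z t k"
    then obtain x where x: "x \<in> supp t w" "x \<in> ball (c k) (r k)" using Z_meets_supp[OF t] by blast
    have xk: "norm (c k - x) \<le> r k" using x(2) by (simp add: dist_norm)
    have "(?f - c j) \<bullet> c k = (h - c j) \<bullet> x + (?f - c j) \<bullet> (c k - x)"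
      using h(1) x(1) by (simp add: inner_diff_left inner_diff_right)
    also have "\<bar>\<dots>\<bar> \<le> \<bar>(h - c j) \<bullet> x\<bar> + \<bar>(?f - c j) \<bullet> (c k - x)\<bar>" by (rule abs_triangle_ineq)
    also have "\<dots> \<le> norm (h - c j) * norm x + norm (?f - c j) * norm (c k - x)"
      by (intro add_mono Cauchy_Schwarz_ineq2)
    also have "\<dots> \<le> e * (norm (c k) + r k) + norm (?f - c j) * r k"
    proof (intro add_mono mult_mono)
      show "norm (h - c j) \<le> e" using j by (simp add: dist_norm)
      show "norm x \<le> norm (c k) + r k" using xk norm_triangle_sub[of x "c k"] by (simp add: norm_minus_commute)
    qed (use e xk in auto)
    finally show "\<bar>(?f - c j) \<bullet> c k\<bar> \<le> (norm (c k) + r k) * e + norm (?f - c j) * r k" by (simp add: mult.commute)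
  qed
qed

text \<open>Charged balls shrinking to a point of the support make all terms with the radius vanish,
  which recovers the inequality at the point itself.\<close>

lemma admissible_index_approx:
  assumes adm: "admissible_index e z f t w j" and x: "x \<in> supp t w" and e: "e > 0"
  shows "\<bar>(f w - c j) \<bullet> x\<bar> \<le> norm x * e"
proof -
  let ?n = "norm (f w - c j)"
  have K: "0 \<le> 2 * e + 2 * ?n" using e by simp
  have step: "\<bar>(f w - c j) \<bullet> x\<bar> \<le> norm x * e + d * (2 * e + 2 * ?n)" if d: "d > 0" for d
  proof -
  obtain k where k: "r k < d" "dist x (c k) < r k" using balls(2)[OF d] by blast
  have "w \<in> Z t k" using x k(2) by (auto simp: supp_def dist_commute)
  then have "\<bar>(f w - c j) \<bullet> c k\<bar> \<le> (norm (c k) + r k) * e + ?n * r k" using adm by (simp add: admissible_index_def)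
  moreover have "\<bar>(f w - c j) \<bullet> (x - c k)\<bar> \<le> ?n * r k"
    using Cauchy_Schwarz_ineq2[of "f w - c j" "x - c k"] k(2) mult_left_mono[of "norm (x - c k)" "r k" ?n]
    by (simp add: dist_norm)
  moreover have "(f w - c j) \<bullet> x = (f w - c j) \<bullet> c k + (f w - c j) \<bullet> (x - c k)" by (simp add: inner_diff_right)
  ultimately have "\<bar>(f w - c j) \<bullet> x\<bar> \<le> (norm (c k) + r k) * e + 2 * (?n * r k)" by linarith
  also have "\<dots> \<le> (norm x + 2 * d) * e + 2 * (?n * d)"
  proof -
    have "norm (c k) \<le> norm x + r k" using k(2) norm_triangle_sub[of "c k" x] by (simp add: dist_norm norm_minus_commute)
    then have "(norm (c k) + r k) * e \<le> (norm x + 2 * d) * e" using k(1) e by (intro mult_right_mono) auto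
    moreover have "?n * r k \<le> ?n * d" using k(1) by (intro mult_left_mono) auto
    ultimately show ?thesis by linarith
  qed
  finally show ?thesis by (simp add: algebra_simps)
  qed
  show ?thesis by (rule le_if_le_add_multiples[OF K step])
qed

text \<open>Periods are treated in turn, with the accumulated distance of the earlier ones as the
  error in \<open>cluster_selection\<close>. One index n then works for all periods on a given path;
  it may vary with the path, while the limit position in each period depends on the past only. No
  path is excepted.\<close>

lemma limit_strategy:
  assumes m: "\<And>n s. s < T \<Longrightarrow> rho n (Suc s) \<in> borel_measurable (universal (M s))"
    and bd: "\<And>s w. s < T \<Longrightarrow> bounded (range (\<lambda>n :: nat. rho n (Suc s) w))"
  shows "\<exists>phi :: nat \<Rightarrow> (nat \<Rightarrow> 'a) \<Rightarrow> real^'d. phi \<in> Phi Om T \<and>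
    (\<forall>w. \<forall>k. \<exists>n\<ge>k. (\<Sum>s = 1..T. norm (rho n s (pre (s - 1) w) - phi s (pre (s - 1) w))) < 1 / real (Suc k))"
proof -
  have "\<exists>phi. (\<forall>s<t. phi (Suc s) \<in> borel_measurable (universal (M s))) \<and>
    (\<forall>w. \<forall>k. \<exists>n\<ge>k. (\<Sum>s = 1..t. norm (rho n s (pre (s - 1) w) - phi s (pre (s - 1) w))) < 1 / real (Suc k))" if "t \<le> T" for t
    using that
  proof (induction t)
    case 0
    then show ?case by auto
  next
    case (Suc t)
    then have t: "t < T" by simp
    from Suc.IH[OF less_imp_le[OF t]] obtain phi where phi: "\<And>s. s < t \<Longrightarrow> phi (Suc s) \<in> borel_measurable (universal (M s))"
      "\<And>w k. \<exists>n\<ge>k. (\<Sum>s = 1..t. norm (rho n s (pre (s - 1) w) - phi s (pre (s - 1) w))) < 1 / real (Suc k)" by blast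
    define e where "e n w = (\<Sum>s = 1..t. norm (rho n s (pre (s - 1) w) - phi s (pre (s - 1) w)))" for n w
    have e: "e n \<in> borel_measurable (universal (M t))" for n
      unfolding e_def
    proof (rule borel_measurable_sum)
      fix s assume "s \<in> {1..t}"
      then obtain s' where s': "s = Suc s'" "s' < t" by (cases s) auto
      have "(\<lambda>w. rho n (Suc s') w - phi (Suc s') w) \<in> borel_measurable (universal (M s'))"
        using m[of s' n] phi(1)[OF s'(2)] s'(2) t by (intro borel_measurable_diff) auto
      from measurable_compose[OF pre_umeas[of s' t] this] s'
      have "(\<lambda>w. rho n (Suc s') (pre s' w) - phi (Suc s') (pre s' w)) \<in> borel_measurable (universal (M t))" by simp
      then have "(\<lambda>w. norm (rho n (Suc s') (pre s' w) - phi (Suc s') (pre s' w))) \<in> borel_measurable (universal (M t))"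
        by measurable
      with s' show "(\<lambda>w. norm (rho n s (pre (s - 1) w) - phi s (pre (s - 1) w))) \<in> borel_measurable (universal (M t))" by simp
    qed
    obtain g where g: "g \<in> borel_measurable (universal (M t))"
      "\<forall>w. (\<forall>k. \<exists>n\<ge>k. e n w < 1 / real (Suc k)) \<longrightarrow> bounded (range (\<lambda>n. rho n (Suc t) w)) \<longrightarrow>
       (\<forall>k. \<exists>n\<ge>k. e n w < 1 / real (Suc k) \<and> norm (rho n (Suc t) w - g w) < 1 / real (Suc k))"
      using cluster_selection[of e "universal (M t)" "\<lambda>n. rho n (Suc t)", OF e m[OF t]] ..
    show ?case
    proof (intro exI[of _ "phi(Suc t := g)"] conjI allI impI)
      show "(phi(Suc t := g)) (Suc s) \<in> borel_measurable (universal (M s))" if "s < Suc t" for s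
        using that phi(1) g(1) by (cases "s = t") auto
      fix w k
      have ew: "\<forall>k. \<exists>n\<ge>k. e n (pre t w) < 1 / real (Suc k)" unfolding e_def using phi(2) by blast
      have "\<forall>k. \<exists>n\<ge>k. e n (pre t w) < 1 / real (Suc k) \<and> norm (rho n (Suc t) (pre t w) - g (pre t w)) < 1 / real (Suc k)"
        using g(2) ew bd[OF t] by blast
      then obtain n where n: "n \<ge> 2 * k + 1" "e n (pre t w) < 1 / real (Suc (2 * k + 1))"
        "norm (rho n (Suc t) (pre t w) - g (pre t w)) < 1 / real (Suc (2 * k + 1))" by blast
      have "(\<Sum>s = 1..t. norm (rho n s (pre (s - 1) w) - (phi(Suc t := g)) s (pre (s - 1) w))) = e n (pre t w)"
        unfolding e_def
      proof (rule sum.cong[OF refl])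
        fix s assume s: "s \<in> {1..t}"
        then have "pre (s - 1) (pre t w) = pre (s - 1) w" by (intro restrict_restrict_le) auto
        with s show "norm (rho n s (pre (s - 1) w) - (phi(Suc t := g)) s (pre (s - 1) w))
          = norm (rho n s (pre (s - 1) (pre t w)) - phi s (pre (s - 1) (pre t w)))" by simp
      qed
      then have "(\<Sum>s = 1..Suc t. norm (rho n s (pre (s - 1) w) - (phi(Suc t := g)) s (pre (s - 1) w)))
        = e n (pre t w) + norm (rho n (Suc t) (pre t w) - g (pre t w))" by simp
      also have "\<dots> < 1 / real (Suc k)" using n(2,3) unfolding half_tolerance by linarith
      finally show "\<exists>n\<ge>k. (\<Sum>s = 1..Suc t. norm (rho n s (pre (s - 1) w) - (phi(Suc t := g)) s (pre (s - 1) w))) < 1 / real (Suc k)"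
        using n(1) by (intro exI[of _ n]) simp
    qed
  qed
  from this[OF order_refl] obtain phi where phi: "\<And>s. s < T \<Longrightarrow> phi (Suc s) \<in> borel_measurable (universal (M s))"
    "\<forall>w. \<forall>k. \<exists>n\<ge>k. (\<Sum>s = 1..T. norm (rho n s (pre (s - 1) w) - phi s (pre (s - 1) w))) < 1 / real (Suc k)" by blast
  have "phi \<in> Phi Om T"
    unfolding Phi_def univ_meas_iff
  proof (intro CollectI ballI)
    fix s assume "s \<in> {1..T}"
    then have "s - 1 < T" "Suc (s - 1) = s" by auto
    with phi(1)[of "s - 1"] show "phi s \<in> borel_measurable (universal (M (s - 1)))" by simp
  qed
  with phi(2) show ?thesis by blast
qed

lemma V_diff_le:
  "V S T z f w \<le> V S T z g w + (\<Sum>s = 1..T. \<bar>(f s (pre (s - 1) w) - g s (pre (s - 1) w)) \<bullet> dS S s (pre s w)\<bar>)"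
  unfolding V_def add.assoc sum.distrib[symmetric]
  by (intro add_left_mono sum_mono) (simp add: inner_diff_left)

text \<open>On almost every path, rounding changes final wealth by at most D/(n+1), where D is the
  total length of the increments, and along suitable indices the rounded strategies approach their
  cluster point. As the latter is defined path by path, it serves all models.\<close>

lemma superhedge_limit:
  fixes phi :: "nat \<Rightarrow> nat \<Rightarrow> (nat \<Rightarrow> 'a) \<Rightarrow> real^'d"
  assumes phi: "\<And>n. phi n \<in> Phi Om T" and nn: "\<And>n P. P \<in> Q T \<Longrightarrow> AE w in P. V S T z (phi n) w \<ge> 0"
    and lim: "\<And>P. P \<in> Q T \<Longrightarrow> AE w in P. \<forall>e>0. \<exists>N. \<forall>n\<ge>N. H w \<le> ereal (V S T z (phi n) w + e)"
  shows "\<exists>psi\<in>Phi Om T. \<forall>P\<in>Q T. AE w in P. H w \<le> ereal (V S T z psi w)"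
proof -
  define rho where "rho n s = reduced (1 / real (Suc n)) z (phi n s) (s - 1)" for n s
  have "rho n (Suc s) \<in> borel_measurable (universal (M s))" if "s < T" for n s
    unfolding rho_def using reduced_umeas[OF that PhiD[OF phi that]] by simp
  moreover have "bounded (range (\<lambda>n. rho n (Suc s) w))" for s w
    unfolding rho_def bounded_iff by (auto intro!: exI[of _ "radius z s w"] norm_reduced)
  ultimately obtain psi where psi: "psi \<in> Phi Om T"
    "\<And>w k. \<exists>n\<ge>k. (\<Sum>s = 1..T. norm (rho n s (pre (s - 1) w) - psi s (pre (s - 1) w))) < 1 / real (Suc k)"
    using limit_strategy[of rho] by blast
  have "AE w in P. H w \<le> ereal (V S T z psi w)" if P: "P \<in> Q T" for P
  proof -
    have 1: "AE v in P. \<forall>n. \<forall>t<T. hedgeable t z (phi n) (pre t v)"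
    proof (rule AE_all_countable[THEN iffD2], rule allI)
      fix n show "AE v in P. \<forall>t<T. hedgeable t z (phi n) (pre t v)" by (rule hedgeable_path_AE[OF phi nn P])
    qed
    have 2: "AE v in P. \<forall>n. \<forall>t\<le>T. V S t z (phi n) v \<le> z * growth t v"
    proof (rule AE_all_countable[THEN iffD2], rule allI)
      fix n show "AE v in P. \<forall>t\<le>T. V S t z (phi n) v \<le> z * growth t v" by (rule wealth_le_growth[OF phi nn P])
    qed
    from 1 2 increments_in_supp_AE[OF P] AE_space[OF P] lim[OF P] show ?thesis
    proof eventually_elim
      case (elim v)
      define D where "D = (\<Sum>s = 1..T. norm (dS S s (pre s v)))"
      have D: "D \<ge> 0" unfolding D_def by (intro sum_nonneg) simp
      have approx: "\<bar>(phi n s (pre (s - 1) v) - rho n s (pre (s - 1) v)) \<bullet> dS S s (pre s v)\<bar> \<le> norm (dS S s (pre s v)) * (1 / real (Suc n))"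
        if "s \<in> {1..T}" for n s
      proof -
        obtain t where s: "s = Suc t" and t: "t < T" using \<open>s \<in> {1..T}\<close> by (cases s) auto
        have V: "V S t z (phi n) (pre t v) \<le> z * growth t (pre t v)"
          unfolding V_restrict[OF order_refl] growth_restrict[OF order_refl] using elim(2) t by simp
        have ex: "\<exists>j. admissible_index (1 / real (Suc n)) z (phi n (Suc t)) t (pre t v) j"
          using elim(1) t by (intro admissible_index_exists[OF t pre_space[OF elim(4)] _ V]) auto
        define j where "j = (LEAST j. admissible_index (1 / real (Suc n)) z (phi n (Suc t)) t (pre t v) j)"
        have adm: "admissible_index (1 / real (Suc n)) z (phi n (Suc t)) t (pre t v) j"
          unfolding j_def by (rule LeastI_ex[OF ex])
        have "rho n s (pre (s - 1) v) = c j" using ex by (simp add: rho_def reduced_def s j_def)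
        moreover have "dS S (Suc t) (pre (Suc t) v) \<in> supp t (pre t v)" using elim(3) t by blast
        ultimately show ?thesis using admissible_index_approx[OF adm, of "dS S (Suc t) (pre (Suc t) v)"] by (simp add: s)
      qed
      have main: "H v \<le> ereal (V S T z psi v + e)" if "e > 0" for e
      proof -
        obtain N where N: "\<forall>n\<ge>N. H v \<le> ereal (V S T z (phi n) v + e / 2)" using elim(5) \<open>e > 0\<close> by (metis half_gt_zero)
        \<comment> \<open>Each of the two replacements, rounding and passage to the cluster point,
          costs at most a quarter of e; the other half is used by the hypothesis on H. Adding 1 to D
          avoids division by zero.\<close>
        obtain k0 where k0: "1 / real (Suc k0) < e / (4 * (D + 1))"
          using nat_approx_posE[of "e / (4 * (D + 1))"] \<open>e > 0\<close> D by (metis divide_pos_pos add_nonneg_pos mult_pos_pos zero_less_numeral zero_less_one)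
        define k where "k = max N k0"
        obtain n where n: "n \<ge> k" "(\<Sum>s = 1..T. norm (rho n s (pre (s - 1) v) - psi s (pre (s - 1) v))) < 1 / real (Suc k)"
          using psi(2) by blast
        define d where "d = 1 / real (Suc k0)"
        have d: "1 / real (Suc k) \<le> d" "1 / real (Suc n) \<le> d" "d \<ge> 0"
          using n(1) unfolding d_def k_def by (auto intro!: divide_left_mono)
        have "V S T z (phi n) v \<le> V S T z (rho n) v + (\<Sum>s = 1..T. norm (dS S s (pre s v)) * d)"
        proof -
          have "(\<Sum>s = 1..T. \<bar>(phi n s (pre (s - 1) v) - rho n s (pre (s - 1) v)) \<bullet> dS S s (pre s v)\<bar>) \<le> (\<Sum>s = 1..T. norm (dS S s (pre s v)) * d)"
            using d(2) by (intro sum_mono order_trans[OF approx] mult_left_mono) auto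
          with V_diff_le[of z "phi n" v "rho n"] show ?thesis by linarith
        qed
        also have "(\<Sum>s = 1..T. norm (dS S s (pre s v)) * d) = D * d" unfolding D_def by (rule sum_distrib_right[symmetric])
        also have "V S T z (rho n) v \<le> V S T z psi v + D * d"
        proof -
          have "(\<Sum>s = 1..T. \<bar>(rho n s (pre (s - 1) v) - psi s (pre (s - 1) v)) \<bullet> dS S s (pre s v)\<bar>)
            \<le> (\<Sum>s = 1..T. d * norm (dS S s (pre s v)))"
          proof (rule sum_mono)
            fix s assume s: "s \<in> {1..T}"
            have "norm (rho n s (pre (s - 1) v) - psi s (pre (s - 1) v)) \<le> (\<Sum>s = 1..T. norm (rho n s (pre (s - 1) v) - psi s (pre (s - 1) v)))"
              using s by (intro member_le_sum) auto
            also have "\<dots> \<le> d" using n(2) d(1) by linarith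
            finally have "norm (rho n s (pre (s - 1) v) - psi s (pre (s - 1) v)) * norm (dS S s (pre s v)) \<le> d * norm (dS S s (pre s v))"
              by (intro mult_right_mono) auto
            with Cauchy_Schwarz_ineq2[of "rho n s (pre (s - 1) v) - psi s (pre (s - 1) v)" "dS S s (pre s v)"]
            show "\<bar>(rho n s (pre (s - 1) v) - psi s (pre (s - 1) v)) \<bullet> dS S s (pre s v)\<bar> \<le> d * norm (dS S s (pre s v))" by linarith
          qed
          also have "\<dots> = D * d" unfolding D_def by (simp only: sum_distrib_left[symmetric] mult.commute)
          finally show ?thesis using V_diff_le[of z "rho n" v psi] by linarith
        qed
        finally have "V S T z (phi n) v \<le> V S T z psi v + 2 * (D * d)" by simp
        moreover have "2 * (D * d) \<le> e / 2"
        proof -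
          have "(D + 1) * d \<le> e / 4" using k0 D unfolding d_def by (simp add: field_simps)
          moreover have "D * d \<le> (D + 1) * d" using d(3) by (simp add: algebra_simps)
          ultimately show ?thesis by simp
        qed
        ultimately have "V S T z (phi n) v + e / 2 \<le> V S T z psi v + e" by simp
        moreover have "H v \<le> ereal (V S T z (phi n) v + e / 2)" using N n(1) by (simp add: k_def)
        ultimately show ?thesis by (meson ereal_less_eq(3) order_trans)
      qed
      show "H v \<le> ereal (V S T z psi v)"
      proof (rule ereal_le_epsilon)
        fix e :: ereal assume "0 < e"
        show "H v \<le> ereal (V S T z psi v) + e"
          using \<open>0 < e\<close> main[of "real_of_ereal e"] by (cases e) auto
      qed
    qed
  qed
  with psi(1) show ?thesis by blast
qed

end

subsection \<open>Utility functions with exploding risk aversion\<close>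

lemma utility_deriv:
  assumes "utility f" "x > 0"
  shows "(f has_real_derivative deriv f x) (at x)"
    "(deriv f has_real_derivative deriv (deriv f) x) (at x)"
  using assms unfolding utility_def by (auto intro: DERIV_deriv_iff_real_differentiable[THEN iffD2])

lemma utility_tangent:
  assumes f: "utility f" and xy: "x > 0" "y > 0"
  shows "f y \<le> f x + deriv f x * (y - x)"
proof -
  have "((\<lambda>x. - f x) has_real_derivative - deriv f x) (at x within {0<..})"
    by (rule DERIV_minus[OF has_field_derivative_at_within[OF utility_deriv(1)[OF f xy(1)]]])
  then have "- f y - (- f x) \<ge> - deriv f x * (y - x)"
    using f xy by (intro convex_on_imp_above_tangent[where A="{0<..}"])
      (auto simp: utility_def concave_on_def interior_open)
  then show ?thesis by simp
qed

lemma utility_deriv_pos: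
  assumes f: "utility f" and x: "x > 0"
  shows "deriv f x > 0"
proof -
  have "f x < f (x + 1)" using f x by (auto simp: utility_def strict_mono_on_def)
  with utility_tangent[OF f x, of "x + 1"] x show ?thesis by simp
qed

lemma utility_deriv_antimono:
  assumes f: "utility f" and xy: "0 < x" "x \<le> y"
  shows "deriv f y \<le> deriv f x"
proof (cases "x = y")
  case False
  then have "y - x > 0" using xy by simp
  have "deriv f y * (y - x) \<le> deriv f x * (y - x)"
    using utility_tangent[OF f, of x y] utility_tangent[OF f, of y x] xy by (simp add: algebra_simps)
  with \<open>y - x > 0\<close> show ?thesis by (simp add: mult_le_cancel_right)
qed simp

lemma abs_risk_nonneg:
  assumes f: "utility f" and x: "x > 0"
  shows "abs_risk f x \<ge> 0"
proof -
  have "deriv (deriv f) x \<le> 0"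
  proof (rule ccontr)
    assume "\<not> ?thesis"
    then have "deriv (deriv f) x > 0" by simp
    from DERIV_pos_inc_right[OF utility_deriv(2)[OF f x] this] obtain d
      where "d > 0" "\<And>h. 0 < h \<Longrightarrow> h < d \<Longrightarrow> deriv f x < deriv f (x + h)" by blast
    then have "deriv f x < deriv f (x + d / 2)" by simp
    with utility_deriv_antimono[OF f x, of "x + d / 2"] \<open>d > 0\<close> show False by simp
  qed
  with utility_deriv_pos[OF f x] show ?thesis by (simp add: abs_risk_def divide_nonpos_pos)
qed

text \<open>Absolute risk aversion is the derivative of - ln f'. Cutting it off outside the interval
  yields a Borel function on the whole line.\<close>

lemma abs_risk_integral:
  assumes f: "utility f" and xy: "0 < x" "x \<le> y"
  defines "\<rho> \<equiv> \<lambda>z. if z \<in> {x..y} then abs_risk f z else 0"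
  shows "\<rho> \<in> borel_measurable borel"
    "(\<integral>\<^sup>+ z. ennreal (\<rho> z) * indicator {x..y} z \<partial>lborel) = ennreal (ln (deriv f x) - ln (deriv f y))"
proof -
  have pos: "z > 0" if "z \<in> {x..y}" for z using that xy by auto
  have nz: "deriv f z \<noteq> 0" if "z \<in> {x..y}" for z using utility_deriv_pos[OF f pos[OF that]] by simp
  have 1: "continuous_on {x..y} (deriv f)"
  proof (intro continuous_at_imp_continuous_on ballI)
    fix z assume "z \<in> {x..y}"
    from utility_deriv(2)[OF f pos[OF this]] show "isCont (deriv f) z" by (rule DERIV_isCont)
  qed
  have "{x..y} \<subseteq> {0<..}" using xy by auto
  moreover have "continuous_on {0<..} (deriv (deriv f))" using f by (simp add: utility_def)
  ultimately have 2: "continuous_on {x..y} (deriv (deriv f))" by (rule continuous_on_subset[rotated])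
  have "continuous_on {x..y} (abs_risk f)"
    unfolding abs_risk_def using nz by (intro continuous_on_divide continuous_on_minus 1 2) simp
  then show m: "\<rho> \<in> borel_measurable borel"
    unfolding \<rho>_def by (intro borel_measurable_continuous_on_if) auto
  have "(\<integral>\<^sup>+ z. ennreal (\<rho> z) * indicator {x..y} z \<partial>lborel) = ennreal (- ln (deriv f y) - - ln (deriv f x))"
  proof (rule nn_integral_FTC_Icc[OF m])
    fix z assume z: "z \<in> {x..y}"
    note z0 = pos[OF z]
    have "((\<lambda>z. - ln (deriv f z)) has_real_derivative - (inverse (deriv f z) * deriv (deriv f) z)) (at z)"
      by (rule DERIV_minus[OF DERIV_chain2[OF DERIV_ln[OF utility_deriv_pos[OF f z0]] utility_deriv(2)[OF f z0]]])
    then show "((\<lambda>z. - ln (deriv f z)) has_real_derivative \<rho> z) (at z)"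
      using z by (simp add: \<rho>_def abs_risk_def divide_inverse mult.commute)
    show "0 \<le> \<rho> z" using abs_risk_nonneg[OF f z0] by (simp add: \<rho>_def)
  qed (rule xy(2))
  then show "(\<integral>\<^sup>+ z. ennreal (\<rho> z) * indicator {x..y} z \<partial>lborel) = ennreal (ln (deriv f x) - ln (deriv f y))" by simp
qed

text \<open>The ratio of marginal utilities is the exponential of the integrated risk aversion; Fatou's lemma
  passes from pointwise explosion of the risk aversion to explosion of the integral.\<close>
lemma marginal_utility_ratio_at_top:
  assumes U: "\<And>n. n \<ge> 1 \<Longrightarrow> utility (U n)" and risk: "\<And>z. z > 0 \<Longrightarrow> filterlim (\<lambda>n. abs_risk (U n) z) at_top sequentially"
    and xy: "0 < x" "x < y"
  shows "filterlim (\<lambda>n. deriv (U n) x / deriv (U n) y) at_top sequentially"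
proof -
  \<comment> \<open>The index is shifted by one because the functions are known to be utilities only
    from index 1 on.\<close>
  define L where "L n = ln (deriv (U (Suc n)) x) - ln (deriv (U (Suc n)) y)" for n
  define \<rho> where "\<rho> n z = (if z \<in> {x..y} then abs_risk (U (Suc n)) z else 0)" for n z
  have u: "utility (U (Suc n))" for n by (rule U) simp
  have \<rho>: "\<rho> n \<in> borel_measurable borel" "(\<integral>\<^sup>+ z. ennreal (\<rho> n z) * indicator {x..y} z \<partial>lborel) = ennreal (L n)" for n
    unfolding L_def \<rho>_def using abs_risk_integral[OF u xy(1) less_imp_le[OF xy(2)], of n] by simp_all
  have lim: "liminf (\<lambda>n. ennreal (\<rho> n z) * indicator {x..y} z) = \<top>" if z: "z \<in> {x..y}" for z
  proof -
    have "filterlim (\<lambda>n. abs_risk (U (Suc n)) z) at_top sequentially"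
      using z xy by (intro filterlim_compose[OF risk filterlim_Suc]) auto
    then have ev: "eventually (\<lambda>n. K < abs_risk (U (Suc n)) z) sequentially" for K
      by (auto simp: filterlim_at_top_dense)
    have "\<top> \<le> liminf (\<lambda>n. ennreal (\<rho> n z) * indicator {x..y} z)"
      unfolding le_Liminf_iff
    proof (intro allI impI)
      fix c :: ennreal assume "c < \<top>"
      then obtain K where K: "c = ennreal K" "K \<ge> 0" by (cases c) auto
      show "eventually (\<lambda>n. c < ennreal (\<rho> n z) * indicator {x..y} z) sequentially"
        using ev[of K] by eventually_elim (use z K in \<open>simp add: \<rho>_def ennreal_less_iff\<close>)
    qed
    then show ?thesis by (simp add: top_unique)
  qed
  have "(\<integral>\<^sup>+ z. \<top> * indicator {x..y} z \<partial>lborel) \<le> (\<integral>\<^sup>+ z. liminf (\<lambda>n. ennreal (\<rho> n z) * indicator {x..y} z) \<partial>lborel)"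
  proof (rule nn_integral_mono)
    fix z
    show "\<top> * indicator {x..y} z \<le> liminf (\<lambda>n. ennreal (\<rho> n z) * indicator {x..y} z)"
    proof (cases "z \<in> {x..y}")
      case True
      show ?thesis unfolding lim[OF True] by (rule top_greatest)
    qed simp
  qed
  also have "\<dots> \<le> liminf (\<lambda>n. \<integral>\<^sup>+ z. ennreal (\<rho> n z) * indicator {x..y} z \<partial>lborel)"
  proof (rule nn_integral_liminf)
    fix n
    note [measurable] = \<rho>(1)[of n]
    show "(\<lambda>z. ennreal (\<rho> n z) * indicator {x..y} z) \<in> borel_measurable lborel" by measurable
  qed
  finally have "\<top> * ennreal (y - x) \<le> liminf (\<lambda>n. ennreal (L n))"
    using xy by (simp add: \<rho>(2) nn_integral_cmult_indicator)
  moreover have "\<top> * ennreal (y - x) = \<top>" using xy by (simp add: ennreal_top_mult ennreal_eq_0_iff)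
  ultimately have Linf: "\<top> \<le> liminf (\<lambda>n. ennreal (L n))" by simp
  have "filterlim L at_top sequentially"
    unfolding filterlim_at_top_dense
  proof
    fix K :: real
    have "eventually (\<lambda>n. ennreal (max K 0) < ennreal (L n)) sequentially"
      using Linf unfolding le_Liminf_iff by simp
    then show "eventually (\<lambda>n. K < L n) sequentially"
      by eventually_elim (auto simp: ennreal_less_iff max_def split: if_splits)
  qed
  then have "filterlim (\<lambda>n. exp (L n)) at_top sequentially" by (rule filterlim_compose[OF exp_at_top])
  moreover have "exp (L n) = deriv (U (Suc n)) x / deriv (U (Suc n)) y" for n
    using utility_deriv_pos[OF u, of x n] utility_deriv_pos[OF u, of y n] xy by (simp add: L_def exp_diff)
  ultimately have "filterlim (\<lambda>n. deriv (U (Suc n)) x / deriv (U (Suc n)) y) at_top sequentially" by simp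
  then show ?thesis by (rule filterlim_sequentially_Suc[THEN iffD1])
qed

text \<open>By concavity the loss over the lower half of the interval is at least d/2 times the
  slope at the midpoint. The midpoint lies strictly below x, so this slope explodes relative to the
  slope at x.\<close>

lemma utility_loss_at_top:
  assumes U: "\<And>n. n \<ge> 1 \<Longrightarrow> utility (U n)" and risk: "\<And>z. z > 0 \<Longrightarrow> filterlim (\<lambda>n. abs_risk (U n) z) at_top sequentially"
    and d: "0 < d" "d < x"
  shows "filterlim (\<lambda>n. (U n x - U n (x - d)) / deriv (U n) x) at_top sequentially"
proof -
  let ?m = "x - d / 2"
  have "filterlim (\<lambda>n. deriv (U n) ?m / deriv (U n) x) at_top sequentially"
    using d by (intro marginal_utility_ratio_at_top[OF U risk]) auto
  then have "filterlim (\<lambda>n. d / 2 * (deriv (U n) ?m / deriv (U n) x)) at_top sequentially"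
    using d by (intro filterlim_tendsto_pos_mult_at_top[OF tendsto_const]) auto
  then show ?thesis
  proof (rule filterlim_at_top_mono)
    show "eventually (\<lambda>n. d / 2 * (deriv (U n) ?m / deriv (U n) x) \<le> (U n x - U n (x - d)) / deriv (U n) x) sequentially"
      using eventually_ge_at_top[of 1]
    proof eventually_elim
      case (elim n)
      note u = U[OF elim]
      have "U n (x - d) \<le> U n ?m + deriv (U n) ?m * ((x - d) - ?m)" using d by (intro utility_tangent[OF u]) auto
      moreover have "U n ?m \<le> U n x" using u d by (intro less_imp_le) (auto simp: utility_def strict_mono_on_def)
      ultimately have "d / 2 * deriv (U n) ?m \<le> U n x - U n (x - d)" by (simp add: algebra_simps)
      from divide_right_mono[OF this, of "deriv (U n) x"] show ?case using utility_deriv_pos[OF u, of x] d by simp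
    qed
  qed
qed

lemma UE_mono:
  assumes f: "utility f" and "y \<le> y'"
  shows "UE f y \<le> UE f y'"
proof -
  have mono: "f a \<le> f b" if "0 < a" "a \<le> b" for a b
    using f that by (cases "a = b") (auto simp: utility_def strict_mono_on_def intro: less_imp_le)
  show ?thesis
  proof (cases "y' = \<infinity> \<or> y < 0")
    case True
    then show ?thesis by (auto simp: UE_def)
  next
    case False
    with \<open>y \<le> y'\<close> obtain a b where ab: "y = ereal a" "y' = ereal b" "0 \<le> a" "a \<le> b"
      by (cases y; cases y') auto
    show ?thesis
    proof (cases "a = 0")
      case True
      then show ?thesis using ab by (auto simp: UE_def zero_ereal_def[symmetric] intro: INF_lower)
    next
      case False
      then show ?thesis using ab mono[of a b] by (auto simp: UE_def)
    qed
  qed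
qed

text \<open>The tangent at x, with its negative term dropped. At Y = 0 the extended utility is a
  limit, possibly minus infinity, and monotonicity replaces the tangent.\<close>

lemma UE_le_affine:
  assumes f: "utility f" and x: "x > 0" and y: "y \<le> ereal Y" and Y: "Y \<ge> 0"
  shows "UE f y \<le> ereal (f x + deriv f x * Y)"
proof (cases "Y = 0")
  case True
  have "UE f y \<le> UE f (ereal x)" using y True x by (intro UE_mono[OF f]) (auto elim: order_trans)
  then show ?thesis using True x by (simp add: UE_def)
next
  case False
  have "UE f y \<le> UE f (ereal Y)" by (rule UE_mono[OF f y])
  also have "\<dots> = ereal (f Y)" using False Y by (simp add: UE_def)
  also have "f Y \<le> f x + deriv f x * (Y - x)" using False Y by (intro utility_tangent[OF f x]) simp
  also have "\<dots> \<le> f x + deriv f x * Y" using utility_deriv_pos[OF f x] x by (simp add: algebra_simps)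
  finally show ?thesis by simp
qed

subsection \<open>Extended expectations\<close>

lemma expE_mono:
  assumes "AE w in P. X w \<le> Y w"
  shows "expE P X \<le> expE P Y"
  unfolding expE_def
proof (rule ereal_minus_mono)
  show "enn2ereal (\<integral>\<^sup>+ w. e2ennreal (X w) \<partial>P) \<le> enn2ereal (\<integral>\<^sup>+ w. e2ennreal (Y w) \<partial>P)"
    using assms by (intro less_eq_ennreal.rep_eq[THEN iffD1] nn_integral_mono_AE) (auto elim!: eventually_mono intro: e2ennreal_mono)
  show "enn2ereal (\<integral>\<^sup>+ w. e2ennreal (- Y w) \<partial>P) \<le> enn2ereal (\<integral>\<^sup>+ w. e2ennreal (- X w) \<partial>P)"
    using assms by (intro less_eq_ennreal.rep_eq[THEN iffD1] nn_integral_mono_AE) (auto elim!: eventually_mono intro: e2ennreal_mono)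
qed

lemma expE_ereal:
  assumes "integrable P f"
  shows "expE P (\<lambda>w. ereal (f w)) = ereal (\<integral>w. f w \<partial>P)"
proof -
  have "enn2ereal a - enn2ereal b = ereal (enn2real a - enn2real b)" if "a \<noteq> \<infinity>" "b \<noteq> \<infinity>" for a b
    using that by (cases a; cases b) (auto simp: enn2ereal_ennreal)
  with assms show ?thesis
    unfolding expE_def real_lebesgue_integral_def[OF assms] by (simp add: real_integrable_def)
qed

subsection \<open>Prices\<close>

lemma V_add: "V S T (x + z) (\<lambda>t w. f t w + g t w) w = V S T x f w + V S T z g w"
  by (simp add: V_def inner_add_left sum.distrib)

lemma V_shift: "V S T (z + a) f w = V S T z f w + a"
  by (simp add: V_def)

context market
begin

lemma Phi_add: "f \<in> Phi Om T \<Longrightarrow> g \<in> Phi Om T \<Longrightarrow> (\<lambda>t w. f t w + g t w) \<in> Phi Om T"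
  unfolding Phi_def univ_meas_iff by (auto intro!: borel_measurable_add)

lemma Phi_zero: "(\<lambda>t w. 0) \<in> Phi Om T"
  unfolding Phi_def univ_meas_iff by simp

lemma Aset_iff: "phi \<in> Aset Om QR S T G z \<longleftrightarrow> phi \<in> Phi Om T \<and> (\<forall>P\<in>Q T. AE w in P. G w \<le> ereal (V S T z phi w))"
  unfolding Aset_def by (auto simp: qs_iff)

lemma Aset_nonneg:
  assumes G: "\<forall>w\<in>space (M T). G w \<ge> 0" and phi: "phi \<in> Aset Om QR S T G z" and P: "P \<in> Q T"
  shows "AE w in P. V S T z phi w \<ge> 0"
proof -
  have "AE w in P. G w \<le> ereal (V S T z phi w)" using phi P unfolding Aset_iff by blast
  with AE_space[OF P] show ?thesis
  proof eventually_elim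
    case (elim w)
    from order_trans[OF bspec[OF G elim(1)] elim(2)] show ?case by simp
  qed
qed

lemma V_completion_measurable:
  assumes "phi \<in> Phi Om T" "P \<in> Q T"
  shows "V S T z phi \<in> borel_measurable (completion P)"
  by (rule measurable_univ_completion[OF V_umeas[OF assms(1) order_refl order_refl] Q_probs[OF order_refl assms(2)]])

lemma prob_completion: "P \<in> Q T \<Longrightarrow> prob_space (completion P)"
  by (rule prob_space.prob_space_completion[OF probsD(3)[OF Q_probs[OF order_refl]]])

text \<open>Superposing a superhedge on a strategy for the zero claim leaves at least the original
  wealth once G is paid. The integrability demanded of admissible strategies comes from the affine
  bound on utility at 1 and the uniform wealth moment.\<close>

lemma uval_add:
  assumes f: "utility f" and G: "\<forall>w\<in>space (M T). G w \<ge> 0" and phi: "phi \<in> Aset Om QR S T G z"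
  shows "uval Om QR S T f (\<lambda>_. 0) x \<le> uval Om QR S T f G (x + z)"
  unfolding uval_def
proof (rule SUP_mono)
  fix psi assume psi: "psi \<in> AUset Om QR S T f (\<lambda>_. 0) x"
  let ?s = "\<lambda>t w. psi t w + phi t w"
  have phi': "phi \<in> Phi Om T" "\<And>P. P \<in> Q T \<Longrightarrow> AE w in P. G w \<le> ereal (V S T z phi w)"
    using phi unfolding Aset_iff by auto
  have psi': "psi \<in> Phi Om T" "\<And>P. P \<in> Q T \<Longrightarrow> AE w in P. 0 \<le> ereal (V S T x psi w)"
    using psi unfolding AUset_def Aset_iff by auto
  have s: "?s \<in> Phi Om T" by (rule Phi_add[OF psi'(1) phi'(1)])
  have sG: "AE w in P. G w \<le> ereal (V S T (x + z) ?s w)" if "P \<in> Q T" for P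
    using phi'(2)[OF that] psi'(2)[OF that]
  proof eventually_elim
    case (elim w)
    then have "V S T z phi w \<le> V S T (x + z) ?s w" unfolding V_add by simp
    with elim(1) show ?case by (meson ereal_less_eq(3) order_trans)
  qed
  then have sA: "?s \<in> Aset Om QR S T G (x + z)" unfolding Aset_iff using s by blast
  note snn = Aset_nonneg[OF G sA]
  have "(\<integral>\<^sup>+ w. e2ennreal (UE f (ereal (V S T (x + z) ?s w) - G w)) \<partial>(completion P)) < \<infinity>" if P: "P \<in> Q T" for P
  proof -
    have "(\<integral>\<^sup>+ w. e2ennreal (UE f (ereal (V S T (x + z) ?s w) - G w)) \<partial>(completion P))
      \<le> (\<integral>\<^sup>+ w. ennreal \<bar>f 1\<bar> + ennreal (deriv f 1) * ennreal (V S T (x + z) ?s w) \<partial>(completion P))"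
    proof (rule nn_integral_mono_AE)
      have "AE w in P. e2ennreal (UE f (ereal (V S T (x + z) ?s w) - G w)) \<le> ennreal \<bar>f 1\<bar> + ennreal (deriv f 1) * ennreal (V S T (x + z) ?s w)"
        using snn[OF P] AE_space[OF P]
      proof eventually_elim
        case (elim w)
        let ?v = "V S T (x + z) ?s w"
        have "ereal ?v - G w \<le> ereal ?v" using bspec[OF G elim(2)] by (cases "G w") auto
        then have "UE f (ereal ?v - G w) \<le> ereal (f 1 + deriv f 1 * ?v)" using elim by (intro UE_le_affine[OF f]) auto
        then have "e2ennreal (UE f (ereal ?v - G w)) \<le> ennreal (f 1 + deriv f 1 * ?v)"
          using e2ennreal_mono by fastforce
        also have "\<dots> \<le> ennreal (\<bar>f 1\<bar> + deriv f 1 * ?v)" by (intro ennreal_leI) simp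
        also have "\<dots> = ennreal \<bar>f 1\<bar> + ennreal (deriv f 1) * ennreal ?v"
          using utility_deriv_pos[OF f, of 1] elim(1) by (simp add: ennreal_plus ennreal_mult)
        finally show ?case .
      qed
      then show "AE w in completion P. e2ennreal (UE f (ereal (V S T (x + z) ?s w) - G w)) \<le> ennreal \<bar>f 1\<bar> + ennreal (deriv f 1) * ennreal (V S T (x + z) ?s w)"
        by (simp only: AE_completion_iff)
    qed
    also have "\<dots> = ennreal \<bar>f 1\<bar> * emeasure (completion P) (space (completion P)) + ennreal (deriv f 1) * (\<integral>\<^sup>+ w. ennreal (V S T (x + z) ?s w) \<partial>(completion P))"
    proof -
      note [measurable] = V_completion_measurable[OF s P]
      show ?thesis by (subst nn_integral_add) (simp_all add: nn_integral_cmult)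
    qed
    also have "\<dots> < \<infinity>"
    proof -
      obtain C where "(\<integral>\<^sup>+ w. ennreal (V S T (x + z) ?s w) \<partial>P) \<le> ennreal C"
        using wealth_moment s snn P by blast
      then have "(\<integral>\<^sup>+ w. ennreal (V S T (x + z) ?s w) \<partial>P) < \<infinity>" by (simp add: le_less_trans)
      then show ?thesis using prob_space.emeasure_space_1[OF prob_completion[OF P]]
        by (simp add: nn_integral_completion ennreal_mult_less_top)
    qed
    finally show ?thesis .
  qed
  then have "?s \<in> AUset Om QR S T f G (x + z)" unfolding AUset_def using sA by blast
  moreover have "(INF P\<in>Q T. expE (completion P) (\<lambda>w. UE f (ereal (V S T x psi w) - 0)))
    \<le> (INF P\<in>Q T. expE (completion P) (\<lambda>w. UE f (ereal (V S T (x + z) ?s w) - G w)))"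
  proof (rule INF_mono)
    fix P assume P: "P \<in> Q T"
    have "AE w in P. UE f (ereal (V S T x psi w) - 0) \<le> UE f (ereal (V S T (x + z) ?s w) - G w)"
      using phi'(2)[OF P]
    proof eventually_elim
      case (elim w)
      show ?case
      proof (rule UE_mono[OF f])
        show "ereal (V S T x psi w) - 0 \<le> ereal (V S T (x + z) ?s w) - G w"
          using elim unfolding V_add by (cases "G w") auto
      qed
    qed
    then have "expE (completion P) (\<lambda>w. UE f (ereal (V S T x psi w) - 0)) \<le> expE (completion P) (\<lambda>w. UE f (ereal (V S T (x + z) ?s w) - G w))"
      by (intro expE_mono) (simp only: AE_completion_iff)
    with P show "\<exists>P'\<in>Q T. expE (completion P') (\<lambda>w. UE f (ereal (V S T x psi w) - 0)) \<le> expE (completion P) (\<lambda>w. UE f (ereal (V S T (x + z) ?s w) - G w))"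
      by blast
  qed
  ultimately show "\<exists>m\<in>AUset Om QR S T f G (x + z). (INF P\<in>Q T. expE (completion P) (\<lambda>w. UE f (ereal (V S T x psi w) - 0)))
    \<le> (INF P\<in>Q T. expE (completion P) (\<lambda>w. UE f (ereal (V S T (x + z) m w) - G w)))"
    by (intro bexI[of _ ?s])
qed

lemma indiff_price_le_superhedging_price:
  assumes f: "utility f" and G: "\<forall>w\<in>space (M T). G w \<ge> 0"
  shows "indiff_price Om QR S T f G x \<le> superhedging_price Om QR S T G"
  unfolding indiff_price_def superhedging_price_def
proof (rule Inf_superset_mono, rule subsetI)
  fix a assume "a \<in> {ereal z |z. Aset Om QR S T G z \<noteq> {}}"
  then obtain z phi where "a = ereal z" "phi \<in> Aset Om QR S T G z" by blast
  then show "a \<in> {ereal z |z. uval Om QR S T f (\<lambda>_. 0) x \<le> uval Om QR S T f G (x + z)}"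
    using uval_add[OF f G] by blast
qed

lemma uval_zero_ge:
  assumes f: "utility f" and x: "x > 0"
  shows "ereal (f x) \<le> uval Om QR S T f (\<lambda>_. 0) x"
proof -
  let ?o = "\<lambda>(t :: nat) (w :: nat \<Rightarrow> 'a). (0 :: real^'d)"
  have V: "V S T x ?o w = x" for w by (simp add: V_def)
  have U: "UE f (ereal x - 0) = ereal (f x)" using x by (simp add: UE_def)
  have "?o \<in> AUset Om QR S T f (\<lambda>_. 0) x"
    unfolding AUset_def Aset_iff mem_Collect_eq V U
    using Phi_zero x prob_space.emeasure_space_1[OF prob_completion] by simp
  moreover have "ereal (f x) \<le> (INF P\<in>Q T. expE (completion P) (\<lambda>w. UE f (ereal (V S T x ?o w) - 0)))"
  proof (rule INF_greatest)
    fix P assume P: "P \<in> Q T"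
    interpret prob_space "completion P" by (rule prob_completion[OF P])
    show "ereal (f x) \<le> expE (completion P) (\<lambda>w. UE f (ereal (V S T x ?o w) - 0))"
      unfolding V U using expE_ereal[of "completion P" "\<lambda>_. f x"] prob_space by simp
  qed
  ultimately show ?thesis unfolding uval_def by (rule SUP_upper2[of ?o])
qed

section \<open>Shortfall events and the lower bound on indifference prices\<close>

definition shortfall :: "((nat \<Rightarrow> 'a) \<Rightarrow> ereal) \<Rightarrow> real \<Rightarrow> (nat \<Rightarrow> (nat \<Rightarrow> 'a) \<Rightarrow> real^'d) \<Rightarrow> real \<Rightarrow> (nat \<Rightarrow> 'a) set" where
  "shortfall G y phi a = {w \<in> space (M T). ereal (V S T y phi w) < G w + ereal a}"

lemma shortfall_sets:
  assumes "G \<in> borel_measurable (universal (M T))" "phi \<in> Phi Om T" "P \<in> Q T"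
  shows "shortfall G y phi a \<in> sets (completion P)"
proof -
  note [measurable] = assms(1) V_umeas[OF assms(2) order_refl order_refl]
  have "{w \<in> space (universal (M T)). ereal (V S T y phi w) < G w + ereal a} \<in> sets (universal (M T))" by measurable
  then have "shortfall G y phi a \<in> sets (universal (M T))" unfolding shortfall_def space_universal .
  then show ?thesis by (rule sets_universalD[OF _ Q_probs[OF order_refl assms(3)]])
qed

text \<open>The bounds are summable and hold in every model for the same strategies, so
  Borel-Cantelli applies model by model, with a null set that may depend on the model. Closedness is
  applied to the claim G + x, and x is then subtracted from the capital.\<close>

lemma superhedge_if_small_shortfalls:
  assumes Gm: "G \<in> borel_measurable (universal (M T))" and G: "\<forall>w\<in>space (M T). G w \<ge> 0"
    and e: "e \<longlonglongrightarrow> 0"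
    and small: "\<And>n. \<exists>phi\<in>Aset Om QR S T G y. \<forall>P\<in>Q T. measure (completion P) (shortfall G y phi (x - e n)) \<le> (1/2) ^ n"
  shows "Aset Om QR S T G (y - x) \<noteq> {}"
proof -
  have "\<exists>phi. phi \<in> Aset Om QR S T G y \<and> (\<forall>P\<in>Q T. measure (completion P) (shortfall G y phi (x - e n)) \<le> (1/2) ^ n)" for n
    using small[of n] unfolding Bex_def .
  then have "\<forall>n. \<exists>phi. phi \<in> Aset Om QR S T G y \<and> (\<forall>P\<in>Q T. measure (completion P) (shortfall G y phi (x - e n)) \<le> (1/2) ^ n)"
    by (rule allI)
  then have "\<exists>phi. \<forall>n. phi n \<in> Aset Om QR S T G y \<and> (\<forall>P\<in>Q T. measure (completion P) (shortfall G y (phi n) (x - e n)) \<le> (1/2) ^ n)"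
    by (rule choice)
  then obtain phi where "\<forall>n. phi n \<in> Aset Om QR S T G y \<and> (\<forall>P\<in>Q T. measure (completion P) (shortfall G y (phi n) (x - e n)) \<le> (1/2) ^ n)" ..
  then have phi: "\<And>n. phi n \<in> Aset Om QR S T G y"
    "\<And>n P. P \<in> Q T \<Longrightarrow> measure (completion P) (shortfall G y (phi n) (x - e n)) \<le> (1/2) ^ n" by simp_all
  have phiP: "phi n \<in> Phi Om T" for n using phi(1) unfolding Aset_iff by blast
  have nn: "AE w in P. V S T y (phi n) w \<ge> 0" if "P \<in> Q T" for n P by (rule Aset_nonneg[OF G phi(1) that])
  have lim: "AE w in P. \<forall>d>0. \<exists>N. \<forall>n\<ge>N. G w + ereal x \<le> ereal (V S T y (phi n) w + d)" if P: "P \<in> Q T" for P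
  proof -
    interpret prob_space "completion P" by (rule prob_completion[OF P])
    let ?A = "\<lambda>n. shortfall G y (phi n) (x - e n)"
    have "AE w in completion P. eventually (\<lambda>n. w \<in> space (completion P) - ?A n) sequentially"
    proof (rule borel_cantelli_AE1)
      show "?A n \<in> sets (completion P)" for n by (rule shortfall_sets[OF Gm phiP P])
      show "emeasure (completion P) (?A n) < \<infinity>" for n by (simp add: emeasure_eq_measure)
      show "summable (\<lambda>n. measure (completion P) (?A n))"
        by (rule summable_comparison_test'[of "\<lambda>n. (1/2) ^ n" 0]) (use phi(2)[OF P] in auto)
    qed
    then have "AE w in P. eventually (\<lambda>n. w \<in> space (completion P) - ?A n) sequentially" by (simp only: AE_completion_iff)
    then show ?thesis
    proof (rule eventually_mono, intro allI impI)
      fix w and d :: real assume ev: "eventually (\<lambda>n. w \<in> space (completion P) - ?A n) sequentially" and d: "d > 0"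
      have "eventually (\<lambda>n. e n < d) sequentially" using order_tendstoD(2)[OF e d] .
      with ev have "eventually (\<lambda>n. G w + ereal x \<le> ereal (V S T y (phi n) w + d)) sequentially"
      proof eventually_elim
        case (elim n)
        then have "G w + ereal (x - e n) \<le> ereal (V S T y (phi n) w)"
          using probsD(2)[OF Q_probs[OF order_refl P]] by (auto simp: shortfall_def)
        then show ?case using elim(2) by (cases "G w") auto
      qed
      then show "\<exists>N. \<forall>n\<ge>N. G w + ereal x \<le> ereal (V S T y (phi n) w + d)"
        by (simp only: eventually_sequentially)
    qed
  qed
  have "\<exists>psi\<in>Phi Om T. \<forall>P\<in>Q T. AE w in P. G w + ereal x \<le> ereal (V S T y psi w)"
    by (rule superhedge_limit[of phi y "\<lambda>w. G w + ereal x", OF phiP nn lim])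
  then obtain psi where psi: "psi \<in> Phi Om T" "\<forall>P\<in>Q T. AE w in P. G w + ereal x \<le> ereal (V S T y psi w)" ..
  have "AE w in P. G w \<le> ereal (V S T (y - x) psi w)" if "P \<in> Q T" for P
  proof -
    have eq: "V S T (y - x) psi w = V S T y psi w - x" for w using V_shift[of S T y "- x" psi w] by simp
    have "AE w in P. G w + ereal x \<le> ereal (V S T y psi w)" using psi(2) that by blast
    then show ?thesis
    proof eventually_elim
      case (elim w)
      then show ?case unfolding eq by (cases "G w") auto
    qed
  qed
  with psi(1) have "psi \<in> Aset Om QR S T G (y - x)" unfolding Aset_iff by blast
  then show ?thesis by blast
qed

text \<open>Two capitals occur because the competing strategy starts from the smaller y', while the
  shortfall event has to be measured at the fixed capital y; wealth increases with capital.\<close>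

lemma expected_utility_bound:
  assumes f: "utility f" and x: "x > 0" and d: "0 < d" "d < x"
    and Gm: "G \<in> borel_measurable (universal (M T))" and G: "\<forall>w\<in>space (M T). G w \<ge> 0"
    and phi: "phi \<in> Aset Om QR S T G y" and y': "y' \<le> y" and P: "P \<in> Q T"
    and C: "(\<integral>\<^sup>+ w. ennreal (V S T y phi w) \<partial>P) \<le> ennreal C" "C \<ge> 0"
  shows "expE (completion P) (\<lambda>w. UE f (ereal (V S T y' phi w) - G w))
    \<le> ereal (f x + deriv f x * C - (f x - f (x - d)) * measure (completion P) (shortfall G y phi (x - d)))"
proof -
  interpret prob_space "completion P" by (rule prob_completion[OF P])
  let ?B = "shortfall G y phi (x - d)"
  have phiP: "phi \<in> Phi Om T" using phi unfolding Aset_iff by blast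
  note [measurable] = V_completion_measurable[OF phiP P, of y] shortfall_sets[OF Gm phiP P, of y "x - d"]
  note nn = Aset_nonneg[OF G phi P]
  have nnC: "AE w in completion P. V S T y phi w \<ge> 0" using nn by (simp only: AE_completion_iff)
  have fin: "(\<integral>\<^sup>+ w. ennreal (V S T y phi w) \<partial>completion P) \<le> ennreal C" using C(1) by (simp only: nn_integral_completion)
  have int: "integrable (completion P) (V S T y phi)"
  proof (rule integrableI_nonneg[OF _ nnC])
    show "(\<integral>\<^sup>+ w. ennreal (V S T y phi w) \<partial>completion P) < \<infinity>" using fin by (simp add: le_less_trans)
  qed measurable
  have EV: "(\<integral>w. V S T y phi w \<partial>completion P) \<le> C"
  proof -
    have "ennreal (\<integral>w. V S T y phi w \<partial>completion P) = (\<integral>\<^sup>+ w. ennreal (V S T y phi w) \<partial>completion P)"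
      by (rule nn_integral_eq_integral[OF int nnC, symmetric])
    also note fin
    finally show ?thesis using C(2) by (simp add: ennreal_le_iff)
  qed
  have sp: "?B \<inter> space P = ?B" using probsD(2)[OF Q_probs[OF order_refl P]] by (auto simp: shortfall_def)
  \<comment> \<open>An integrable majorant: off the shortfall event it is the affine bound, on it
    the first and last terms leave f (x - d), to which a nonnegative multiple of wealth is
    added.\<close>
  define psi where "psi w = f x + deriv f x * V S T y phi w - (f x - f (x - d)) * indicator ?B w" for w
  have ind: "integrable (completion P) (\<lambda>w. indicator ?B w :: real)" by (simp add: emeasure_eq_measure)
  have psi_int: "integrable (completion P) psi" unfolding psi_def using int ind by auto
  have "AE w in P. UE f (ereal (V S T y' phi w) - G w) \<le> ereal (psi w)"
    using nn AE_space[OF P]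
  proof eventually_elim
    case (elim w)
    have "V S T y' phi w \<le> V S T y phi w" using y' by (simp add: V_def)
    then have le: "ereal (V S T y' phi w) - G w \<le> ereal (V S T y phi w) - G w" by (intro ereal_minus_mono) auto
    show ?case
    proof (cases "w \<in> ?B")
      case True
      then have "ereal (V S T y phi w) - G w \<le> ereal (x - d)" by (cases "G w") (auto simp: shortfall_def)
      with le have "UE f (ereal (V S T y' phi w) - G w) \<le> UE f (ereal (x - d))" by (intro UE_mono[OF f]) (rule order_trans)
      also have "\<dots> = ereal (f (x - d))" using d by (simp add: UE_def)
      also have "\<dots> \<le> ereal (psi w)" using True elim(1) utility_deriv_pos[OF f x] by (simp add: psi_def)
      finally show ?thesis .
    next
      case False
      have "ereal (V S T y phi w) - G w \<le> ereal (V S T y phi w)" using bspec[OF G elim(2)] by (cases "G w") auto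
      with le have "ereal (V S T y' phi w) - G w \<le> ereal (V S T y phi w)" by (rule order_trans)
      from UE_le_affine[OF f x this elim(1)] False show ?thesis by (simp add: psi_def)
    qed
  qed
  then have "AE w in completion P. UE f (ereal (V S T y' phi w) - G w) \<le> ereal (psi w)" by (simp only: AE_completion_iff)
  then have "expE (completion P) (\<lambda>w. UE f (ereal (V S T y' phi w) - G w)) \<le> expE (completion P) (\<lambda>w. ereal (psi w))"
    by (rule expE_mono)
  also have "\<dots> = ereal (\<integral>w. psi w \<partial>completion P)" by (rule expE_ereal[OF psi_int])
  also have "(\<integral>w. psi w \<partial>completion P) = f x + deriv f x * (\<integral>w. V S T y phi w \<partial>completion P) - (f x - f (x - d)) * measure (completion P) ?B"
    unfolding psi_def using int ind prob_space sp by simp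
  also have "\<dots> \<le> f x + deriv f x * C - (f x - f (x - d)) * measure (completion P) ?B"
    using mult_left_mono[OF EV, of "deriv f x"] utility_deriv_pos[OF f x] by simp
  finally show ?thesis by simp
qed

theorem indiff_price_tendsto:
  assumes U: "\<And>n. n \<ge> 1 \<Longrightarrow> utility (U n)" and risk: "\<And>z. z > 0 \<Longrightarrow> filterlim (\<lambda>n. abs_risk (U n) z) at_top sequentially"
    and Gm: "G \<in> borel_measurable (universal (M T))" and G: "\<forall>w\<in>space (M T). G w \<ge> 0"
    and x: "x > 0"
  shows "(\<lambda>n. indiff_price Om QR S T (U n) G x) \<longlonglongrightarrow> superhedging_price Om QR S T G"
proof (rule order_tendstoI)
  fix a assume a: "superhedging_price Om QR S T G < a"
  show "eventually (\<lambda>n. indiff_price Om QR S T (U n) G x < a) sequentially"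
    using eventually_ge_at_top[of 1]
    by eventually_elim (rule le_less_trans[OF indiff_price_le_superhedging_price[OF U G] a])
next
  fix a assume "a < superhedging_price Om QR S T G"
  \<comment> \<open>A real capital between a and the superhedging price is inserted, because a may
    be minus infinity.\<close>
  then obtain b where b: "a < ereal b" "ereal b < superhedging_price Om QR S T G" using ereal_dense2 by blast
  let ?y = "x + b"
  \<comment> \<open>The shift by 2 keeps every term strictly between 0 and x, the first one
    included, so that utility at x minus the chosen term is finite.\<close>
  let ?e = "\<lambda>n. x / real (n + 2)"
  have empty: "Aset Om QR S T G (?y - x) = {}"
  proof (rule ccontr)
    assume "\<not> ?thesis"
    then have "superhedging_price Om QR S T G \<le> ereal b" unfolding superhedging_price_def by (intro Inf_lower) auto
    with b(2) show False by simp
  qed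
  have elim0: "?e \<longlonglongrightarrow> 0" by real_asymp
  obtain n0 where n0: "\<And>phi. phi \<in> Aset Om QR S T G ?y \<Longrightarrow>
      \<exists>P\<in>Q T. (1/2) ^ n0 < measure (completion P) (shortfall G ?y phi (x - ?e n0))"
    using superhedge_if_small_shortfalls[OF Gm G elim0, of ?y x] empty by (meson not_le)
  define d where "d = ?e n0"
  have d: "0 < d" "d < x" using x by (auto simp: d_def field_simps intro!: add_pos_nonneg)
  define p where "p = (1/2 :: real) ^ n0"
  have p: "p > 0" by (simp add: p_def)
  obtain C0 where C0: "C0 \<ge> 0" "\<And>z phi P. phi \<in> Phi Om T \<Longrightarrow> (\<forall>P\<in>Q T. AE w in P. V S T z phi w \<ge> 0) \<Longrightarrow> P \<in> Q T \<Longrightarrow>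
    (\<integral>\<^sup>+ v. ennreal (V S T z phi v) \<partial>P) \<le> ennreal (z * C0)" using wealth_moment by blast
  \<comment> \<open>The threshold collects the uniform bound on expected wealth and a slack of one
    unit, both in multiples of the marginal utility at x, divided by the least probability of a
    shortfall.\<close>
  have key: "ereal b \<le> indiff_price Om QR S T (U n) G x"
    if n: "n \<ge> 1" and loss: "(\<bar>?y\<bar> * C0 + 1) / p < (U n x - U n (x - d)) / deriv (U n) x" for n
    unfolding indiff_price_def
  proof (rule Inf_greatest)
    fix q assume "q \<in> {ereal z |z. uval Om QR S T (U n) (\<lambda>_. 0) x \<le> uval Om QR S T (U n) G (x + z)}"
    then obtain z where z: "q = ereal z" "uval Om QR S T (U n) (\<lambda>_. 0) x \<le> uval Om QR S T (U n) G (x + z)" by blast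
    note u = U[OF n]
    have D: "deriv (U n) x > 0" by (rule utility_deriv_pos[OF u x])
    show "ereal b \<le> q"
    proof (rule ccontr)
      assume "\<not> ereal b \<le> q"
      then have zb: "z \<le> b" by (simp add: z(1))
      \<comment> \<open>The supremum need not be attained. A slack equal to the marginal utility at
        x keeps the final inequality homogeneous in it and accounts for the 1 in the
        threshold.\<close>
      have "ereal (U n x - deriv (U n) x) < ereal (U n x)" using D by simp
      also have "\<dots> \<le> uval Om QR S T (U n) G (x + z)" by (rule order_trans[OF uval_zero_ge[OF u x] z(2)])
      finally obtain phi where phi: "phi \<in> AUset Om QR S T (U n) G (x + z)"
        "ereal (U n x - deriv (U n) x) < (INF P\<in>Q T. expE (completion P) (\<lambda>w. UE (U n) (ereal (V S T (x + z) phi w) - G w)))"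
        unfolding uval_def less_SUP_iff by blast
      have phi1: "phi \<in> Aset Om QR S T G (x + z)" using phi(1) unfolding AUset_def by blast
      have phi2: "phi \<in> Aset Om QR S T G ?y"
      proof -
        have "ereal (V S T (x + z) phi w) \<le> ereal (V S T ?y phi w)" for w using zb by (simp add: V_def)
        then show ?thesis using phi1 unfolding Aset_iff by (blast intro: eventually_mono order_trans)
      qed
      obtain P where P: "P \<in> Q T" "p < measure (completion P) (shortfall G ?y phi (x - d))"
        using n0[OF phi2] unfolding p_def d_def by blast
      let ?m = "measure (completion P) (shortfall G ?y phi (x - d))"
      have "phi \<in> Phi Om T" using phi2 unfolding Aset_iff by blast
      moreover have "\<forall>P\<in>Q T. AE w in P. V S T ?y phi w \<ge> 0" using Aset_nonneg[OF G phi2] by blast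
      ultimately have "(\<integral>\<^sup>+ v. ennreal (V S T ?y phi v) \<partial>P) \<le> ennreal (?y * C0)" by (rule C0(2)[OF _ _ P(1)])
      also have "\<dots> \<le> ennreal (\<bar>?y\<bar> * C0)" using C0(1) by (intro ennreal_leI mult_right_mono) auto
      finally have C: "(\<integral>\<^sup>+ v. ennreal (V S T ?y phi v) \<partial>P) \<le> ennreal (\<bar>?y\<bar> * C0)" .
      have "ereal (U n x - deriv (U n) x) < expE (completion P) (\<lambda>w. UE (U n) (ereal (V S T (x + z) phi w) - G w))"
        using phi(2) P(1) by (rule less_INF_D)
      also have "\<dots> \<le> ereal (U n x + deriv (U n) x * (\<bar>?y\<bar> * C0) - (U n x - U n (x - d)) * ?m)"
        using zb C0(1) by (intro expected_utility_bound[OF u x d Gm G phi2 _ P(1) C]) auto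
      finally have "(U n x - U n (x - d)) * ?m < deriv (U n) x * (\<bar>?y\<bar> * C0 + 1)" by (simp add: algebra_simps)
      moreover have "(U n x - U n (x - d)) * p \<le> (U n x - U n (x - d)) * ?m"
      proof (rule mult_left_mono)
        show "0 \<le> U n x - U n (x - d)" using u d by (auto simp: utility_def strict_mono_on_def intro: less_imp_le)
      qed (use P(2) in simp)
      ultimately have "(U n x - U n (x - d)) * p < deriv (U n) x * (\<bar>?y\<bar> * C0 + 1)" by simp
      then have "(U n x - U n (x - d)) / deriv (U n) x < (\<bar>?y\<bar> * C0 + 1) / p" using D p by (simp add: field_simps)
      with loss show False by simp
    qed
  qed
  have "filterlim (\<lambda>n. (U n x - U n (x - d)) / deriv (U n) x) at_top sequentially"
    by (rule utility_loss_at_top[OF U risk d])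
  then have "eventually (\<lambda>n. (\<bar>?y\<bar> * C0 + 1) / p < (U n x - U n (x - d)) / deriv (U n) x) sequentially"
    unfolding filterlim_at_top_dense by blast
  with eventually_ge_at_top[of 1] show "eventually (\<lambda>n. a < indiff_price Om QR S T (U n) G x) sequentially"
    by eventually_elim (rule less_le_trans[OF b(1) key])
qed

end

theorem theorem4p10:
  fixes Om :: "nat \<Rightarrow> 'a topology"
    and QR :: "nat \<Rightarrow> (nat \<Rightarrow> 'a) \<Rightarrow> 'a measure set"
    and S :: "nat \<Rightarrow> (nat \<Rightarrow> 'a) \<Rightarrow> real^'d"
    and T :: nat
    and OmNA :: "nat \<Rightarrow> (nat \<Rightarrow> 'a) set"
    and alpha :: "nat \<Rightarrow> (nat \<Rightarrow> 'a) \<Rightarrow> real"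
    and U :: "nat \<Rightarrow> real \<Rightarrow> real"
    and G :: "(nat \<Rightarrow> 'a) \<Rightarrow> ereal"
  assumes T_pos: "T \<ge> 1"
    and polish: "\<forall>t\<in>{1..T}. Polish_space (Om t)"
    and A1_values: "\<forall>t<T. \<forall>w\<in>topspace (OmT Om t).
        QR (Suc t) w \<noteq> {} \<and> QR (Suc t) w \<subseteq> probs (borel_of (Om (Suc t))) \<and>
        convex_measures (QR (Suc t) w)"
    and A1_graph: "\<forall>t<T. analytic_in (prod_topology (OmT Om t) (weak_top (Om (Suc t))))
        {(w, P). w \<in> topspace (OmT Om t) \<and> P \<in> QR (Suc t) w}"
    and S_univ: "\<forall>t\<le>T. univ_meas (OmM Om t) borel (S t)"
    and A2: "\<forall>t\<le>T. S t \<in> borel_measurable (OmM Om t)"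
    and A3: "\<forall>phi\<in>Phi Om T. qs Om QR T (\<lambda>w. V S T 0 phi w \<ge> 0) \<longrightarrow>
        qs Om QR T (\<lambda>w. V S T 0 phi w = 0)"
    and NA_full: "\<forall>t<T. full_measure Om QR t (OmNA t)"
    and alpha_meas: "\<forall>t<T. univ_meas (OmM Om t) borel (alpha t) \<and>
        (\<forall>w\<in>space (OmM Om t). alpha t w > 0)"
    and NA_prop: "\<forall>t<T. \<forall>w\<in>OmNA t. subspace (Dset Om QR S t w) \<and>
        (\<forall>h\<in>Dset Om QR S t w - {0}. \<exists>Ph\<in>QR (Suc t) w.
           emeasure Ph {y \<in> topspace (Om (Suc t)).
              ((1 / norm h) *\<^sub>R h) \<bullet> dS S (Suc t) (w(Suc t := y)) < - alpha t w}
           > ennreal (alpha t w))"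
    and A4: "\<forall>r>0. (\<forall>t\<in>{1..T}. Wr Om QR t r (dS S t)) \<and>
        (\<forall>t\<in>{1..T - 1}. Wr Om QR t r (\<lambda>w. 1 / alpha t w))"
    and U_util: "\<forall>n\<ge>1. utility (U n)"
    and U_risk: "\<forall>x>0. filterlim (\<lambda>n. abs_risk (U n) x) at_top sequentially"
    and G_meas: "univ_meas (OmM Om T) borel G"
    and G_nonneg: "\<forall>w\<in>space (OmM Om T). G w \<ge> 0"
    and G_nonzero: "\<not> qs Om QR T (\<lambda>w. G w = 0)"
  shows "\<forall>x>0. (\<lambda>n. indiff_price Om QR S T (U n) G x) \<longlonglongrightarrow> superhedging_price Om QR S T G"
proof (intro allI impI)
  fix x :: real assume x: "x > 0"
  obtain c :: "nat \<Rightarrow> real^'d" and r where cr: "\<forall>k. r k > 0"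
    "\<forall>x e. e > 0 \<longrightarrow> (\<exists>k. r k < e \<and> dist x (c k) < r k)"
    using rational_balls_exist by blast
  \<comment> \<open>Without any model every property would hold quasi-surely, in particular G =
    0.\<close>
  have ne: "QQ Om QR T \<noteq> {}" using G_nonzero by (auto simp: qs_def polar_def)
  interpret market Om QR S T OmNA alpha c r
    using A1_values cr ne
    by (intro market.intro T_pos polish A1_graph A2 A3 NA_full alpha_meas NA_prop A4) blast+
  show "(\<lambda>n. indiff_price Om QR S T (U n) G x) \<longlonglongrightarrow> superhedging_price Om QR S T G"
    using U_util U_risk G_meas G_nonneg x
    by (intro indiff_price_tendsto) (simp_all add: univ_meas_iff)
qed

end
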